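(* Let $2\le p<\infty$ and let $f\in L^p$ be regular. If $$\sum_{i_1\in\mathbb Z}\cdots\sum_{i_d\in\mathbb Z}\bar i_1^{\,2}\,\bar i_2^{\,2}\cdots\bar i_d^{\,2}\,\|P_{i_1,i_2,\dots,i_d}f\|_p^2<\infty ,$$ then there exist functions $g_S\in L^p$, $S\subset\{1,\dots,d\}$, with $g_S\in\bigcap_{q\in S}\big(L^p(\mathcal F_0^{(q)})\ominus L^p(\mathcal F_{-1}^{(q)})\big)$, such that $$f=\sum_{S\subset\{1,\dots,d\}}\ \prod_{q\in S^c}(I-U_{\epsilon_q})\,g_S .$$
   Context: For $i\in\mathbb Z$, $\bar i=i$ if $i\le-1$ and $\bar i=i+1$ if $i\ge0$. Let $d\ge1$, let $(\Omega,\mathcal A,\mu)$ be a probability space and $(T_{\underline i})_{\underline i\in\mathbb Z^d}$ a $\mathbb Z^d$-action on it generated by commuting invertible measure-preserving transformations $T_{\epsilon_1},\dots,T_{\epsilon_d}$, where $\epsilon_q\in\mathbb Z^d$ has $1$ at the $q$-th place and $0$ elsewhere. $U_{\underline i}f=f\circ T_{\underline i}$. $I$ is the identity operator, an empty product of operators is $I$, $S^c=\{1,\dots,d\}\setminus S$, and $\underline i\le\underline j$ means $i_q\le j_q$ for all $q$. Functions are real-valued. There is a completely commuting filtration $(\mathcal F_{\underline j})_{\underline j\in\mathbb Z^d}$: there is a sub-$\sigma$-algebra $\mathcal F\subset\mathcal A$ with $\mathcal F_{\underline i}=T_{-\underline i}\mathcal F$ for all $\underline i$; $\mathcal F_{\underline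 i}\subset\mathcal F_{\underline j}$ if $\underline i\le\underline j$; and for every integrable $f$, $E\big(E(f|\mathcal F_{i_1,\dots,i_d})\,|\,\mathcal F_{j_1,\dots,j_d}\big)=E(f|\mathcal F_{i_1\wedge j_1,\dots,i_d\wedge j_d})$. $\mathcal F_l^{(q)}$ is the $\sigma$-algebra generated by all $\mathcal F_{\underline i}$ with $i_q\le l$; $\mathcal F_{-\infty}^{(q)}=\bigcap_{k}\mathcal F_{-k}^{(q)}$; $\mathcal F_{\underline\infty}$ is the $\sigma$-algebra generated by all $\mathcal F_{\underline i}$. For $\sigma$-algebras $\mathcal G\subset\mathcal H$, $L^p(\mathcal H)\ominus L^p(\mathcal G)=\{h\in L^p(\mathcal H):E(h|\mathcal G)=0\}$. $P_l^{(q)}f=E(f|\mathcal F_l^{(q)})-E(f|\mathcal F_{l-1}^{(q)})$; these operators commute, and $P_{j_1,\dots,j_d}=P_{j_1}^{(1)}\cdots P_{j_d}^{(d)}$. An integrable function $f$ is regular if it is $\mathcal F_{\underline\infty}$-measurable and $E(f|\mathcal F_{-\infty}^{(q)})=0$ for every $1\le q\le d$. *)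

theory Defs
  imports "HOL-Probability.Probability"
begin

text \<open>
  A finite linearly ordered type \<open>'d\<close> plays the role of \<open>{1,\<dots>,d}\<close>, and \<open>int ^ 'd\<close> that of
  \<open>\<int>\<^sup>d\<close>; the order of \<open>int ^ 'd\<close> is the componentwise one and \<open>axis q 1\<close> is the \<open>q\<close>-th unit vector.
  The order of \<open>'d\<close> only fixes the order in which products of operators are composed.

  A sub-\<open>\<sigma>\<close>-algebra is represented, as in the library's conditional expectations, by a measure of
  which only the space and the measurable sets matter; probabilities are always those of \<open>M\<close>.
\<close>

definition measure_preserving_action :: "'a measure \<Rightarrow> (int ^ 'd \<Rightarrow> 'a \<Rightarrow> 'a) \<Rightarrow> bool" where
  "measure_preserving_action M T \<longleftrightarrow>
     (\<forall>i. T i \<in> M \<rightarrow>\<^sub>M M \<and> distr M M (T i) = M) \<and>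
     (\<forall>x\<in>space M. T 0 x = x) \<and>
     (\<forall>i j. \<forall>x\<in>space M. T (i + j) x = T i (T j x))"

definition koopman :: "(int ^ 'd \<Rightarrow> 'a \<Rightarrow> 'a) \<Rightarrow> int ^ 'd \<Rightarrow> ('a \<Rightarrow> real) \<Rightarrow> 'a \<Rightarrow> real" where
  "koopman T i f = f \<circ> T i"

definition filt :: "'a measure \<Rightarrow> (int ^ 'd \<Rightarrow> 'a \<Rightarrow> 'a) \<Rightarrow> 'a measure \<Rightarrow> int ^ 'd \<Rightarrow> 'a measure" where
  "filt M T F i = sigma (space M) ((\<lambda>A. T (- i) ` A) ` sets F)"

definition completely_commuting_filtration ::
    "'a measure \<Rightarrow> (int ^ 'd \<Rightarrow> 'a \<Rightarrow> 'a) \<Rightarrow> 'a measure \<Rightarrow> bool" where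
  "completely_commuting_filtration M T F \<longleftrightarrow>
     subalgebra M F \<and>
     (\<forall>i j. i \<le> j \<longrightarrow> sets (filt M T F i) \<subseteq> sets (filt M T F j)) \<and>
     (\<forall>f i j. integrable M f \<longrightarrow>
        (AE x in M. real_cond_exp M (filt M T F j) (real_cond_exp M (filt M T F i) f) x =
                    real_cond_exp M (filt M T F (\<chi> q. min (i $ q) (j $ q))) f x))"

definition filt_dir ::
    "'a measure \<Rightarrow> (int ^ 'd \<Rightarrow> 'a \<Rightarrow> 'a) \<Rightarrow> 'a measure \<Rightarrow> 'd \<Rightarrow> int \<Rightarrow> 'a measure" where
  "filt_dir M T F q l = sigma (space M) (\<Union>i\<in>{i. i $ q \<le> l}. sets (filt M T F i))"

definition filt_dir_minf ::
    "'a measure \<Rightarrow> (int ^ 'd \<Rightarrow> 'a \<Rightarrow> 'a) \<Rightarrow> 'a measure \<Rightarrow> 'd \<Rightarrow> 'a measure" where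
  "filt_dir_minf M T F q = sigma (space M) (\<Inter>k::int. sets (filt_dir M T F q (- k)))"

definition filt_inf :: "'a measure \<Rightarrow> (int ^ 'd \<Rightarrow> 'a \<Rightarrow> 'a) \<Rightarrow> 'a measure \<Rightarrow> 'a measure" where
  "filt_inf M T F = sigma (space M) (\<Union>i. sets (filt M T F i))"

text \<open>
  Elements of \<open>L\<^sup>p\<close> are represented by functions, identified up to equality almost everywhere;
  hence measurability with respect to \<open>G\<close> means having a \<open>G\<close>-measurable version.
\<close>

definition ae_measurable_wrt :: "'a measure \<Rightarrow> 'a measure \<Rightarrow> ('a \<Rightarrow> real) \<Rightarrow> bool" where
  "ae_measurable_wrt M G f \<longleftrightarrow> (\<exists>g\<in>borel_measurable G. AE x in M. f x = g x)"

definition Lp :: "'a measure \<Rightarrow> real \<Rightarrow> ('a \<Rightarrow> real) set" where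
  "Lp M p = {f \<in> borel_measurable M. integrable M (\<lambda>x. \<bar>f x\<bar> powr p)}"

definition Lp_norm :: "'a measure \<Rightarrow> real \<Rightarrow> ('a \<Rightarrow> real) \<Rightarrow> real" where
  "Lp_norm M p f = (\<integral>x. \<bar>f x\<bar> powr p \<partial>M) powr (1 / p)"

definition Lp_sub :: "'a measure \<Rightarrow> real \<Rightarrow> 'a measure \<Rightarrow> ('a \<Rightarrow> real) set" where
  "Lp_sub M p G = {f \<in> Lp M p. ae_measurable_wrt M G f}"

definition Lp_ominus :: "'a measure \<Rightarrow> real \<Rightarrow> 'a measure \<Rightarrow> 'a measure \<Rightarrow> ('a \<Rightarrow> real) set" where
  "Lp_ominus M p H G = {h \<in> Lp_sub M p H. AE x in M. real_cond_exp M G h x = 0}"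

definition regular ::
    "'a measure \<Rightarrow> (int ^ 'd \<Rightarrow> 'a \<Rightarrow> 'a) \<Rightarrow> 'a measure \<Rightarrow> ('a \<Rightarrow> real) \<Rightarrow> bool" where
  "regular M T F f \<longleftrightarrow>
     integrable M f \<and> ae_measurable_wrt M (filt_inf M T F) f \<and>
     (\<forall>q. AE x in M. real_cond_exp M (filt_dir_minf M T F q) f x = 0)"

definition proj_dir ::
    "'a measure \<Rightarrow> (int ^ 'd \<Rightarrow> 'a \<Rightarrow> 'a) \<Rightarrow> 'a measure \<Rightarrow> 'd \<Rightarrow> int \<Rightarrow> ('a \<Rightarrow> real) \<Rightarrow> 'a \<Rightarrow> real" where
  "proj_dir M T F q l f = (\<lambda>x. real_cond_exp M (filt_dir M T F q l) f x
                             - real_cond_exp M (filt_dir M T F q (l - 1)) f x)"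

text \<open>The product over \<open>q \<in> A\<close> of the operators \<open>Q q\<close>; the factor with the least index is
  applied last.\<close>

definition op_prod :: "('d::{finite,linorder} \<Rightarrow> 'b \<Rightarrow> 'b) \<Rightarrow> 'd set \<Rightarrow> 'b \<Rightarrow> 'b" where
  "op_prod Q A = foldr Q (sorted_list_of_set A)"

definition proj ::
    "'a measure \<Rightarrow> (int ^ 'd::{finite,linorder} \<Rightarrow> 'a \<Rightarrow> 'a) \<Rightarrow> 'a measure \<Rightarrow>
     int ^ 'd::{finite,linorder} \<Rightarrow> ('a \<Rightarrow> real) \<Rightarrow> 'a \<Rightarrow> real" where
  "proj M T F j = op_prod (\<lambda>q. proj_dir M T F q (j $ q)) UNIV"

definition cobdry :: "(int ^ 'd \<Rightarrow> 'a \<Rightarrow> 'a) \<Rightarrow> 'd \<Rightarrow> ('a \<Rightarrow> real) \<Rightarrow> 'a \<Rightarrow> real" where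
  "cobdry T q g = (\<lambda>x. g x - koopman T (axis q 1) g x)"

definition bar :: "int \<Rightarrow> int" where
  "bar i = (if i \<le> - 1 then i else i + 1)"

end

(*
  Formally U^i = U^0 + (I - U) G_i, where G_i is minus the sum of U^l over 0 <= l < i if i >= 0, and
  the sum of U^l over i <= l < 0 if i < 0. Applied in every direction to P_i f = U^i (U^-i P_i f),
  this writes each P_i f as the required sum over S, and g_S is the sum over i of the resulting
  pieces. Sorting these by the index l of the martingale difference they belong to, the
  inequality ||sum_l Y_l||^2 <= C sum_l ||Y_l||^2 for multiparameter martingale differences in
  L^p, p >= 2, and Hardy's inequality bound partial sums of g_S by the weighted square sum of the
  hypothesis, so they converge in L^p. The martingale inequality follows by iterating
  ||X + Y||^2 <= ||X||^2 + C ||Y||^2 for E(X|G) = X, E(Y|G) = 0. Regularity and martingale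
  convergence give that the sum of the P_i f over cubes tends to f.
*)

theory Submission
  imports Defs
begin

section \<open>The spaces \<open>L\<^sup>p\<close>\<close>

text \<open>In one direction, the pieces of g_S with index l come from those i with |bar l| <= |bar
  i|, so their p-norm is at most the sum of a_i = ||P_i f||_p over these i. Using the triangle
  inequality over l as well would demand that |bar i| * a_i be summable, which does not follow from
  summability of the squares. Near orthogonality of different l replaces the sum over l by a square
  sum, and the dual form of Hardy's inequality holds with just the weight bar i^2. This needs P_i f
  to be a martingale difference in all directions at once. The filtration hypothesis speaks of the
  F_i only, so commutation of the conditional expectations given the F_l^(q) is derived by an upward
  limit in each argument. Two modes of convergence meet at the end: the partial sums of g_S converge
  in L^p, while the cube sums of P_i f are shown to tend to f in L^1. On every cube the
  decomposition is an exact pointwise identity, so comparing L^1 limits identifies f almost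
  everywhere.\<close>

lemma Lp_norm_nonneg: "0 \<le> Lp_norm M p f"
  by (simp add: Lp_norm_def)

lemma Lp_norm_powr:
  assumes "1 \<le> p"
  shows "Lp_norm M p f powr p = (\<integral>x. \<bar>f x\<bar> powr p \<partial>M)"
proof -
  have "0 \<le> (\<integral>x. \<bar>f x\<bar> powr p \<partial>M)" by (intro integral_nonneg_AE) auto
  then show ?thesis using assms by (auto simp: Lp_norm_def powr_powr)
qed

lemma LpD:
  assumes "f \<in> Lp M p"
  shows "f \<in> borel_measurable M" "integrable M (\<lambda>x. \<bar>f x\<bar> powr p)"
  using assms by (auto simp: Lp_def)

lemma Lp_AE_cong:
  assumes "f \<in> Lp M p" "g \<in> borel_measurable M" "AE x in M. f x = g x"
  shows "g \<in> Lp M p" "Lp_norm M p g = Lp_norm M p f"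
proof -
  have [measurable]: "f \<in> borel_measurable M" "g \<in> borel_measurable M"
    using assms LpD by auto
  have ae: "AE x in M. \<bar>f x\<bar> powr p = \<bar>g x\<bar> powr p" using assms(3) by auto
  have "integrable M (\<lambda>x. \<bar>f x\<bar> powr p) = integrable M (\<lambda>x. \<bar>g x\<bar> powr p)"
    by (intro integrable_cong_AE) (use ae in auto)
  then show "g \<in> Lp M p" using assms by (auto simp: Lp_def)
  have "(\<integral>x. \<bar>f x\<bar> powr p \<partial>M) = (\<integral>x. \<bar>g x\<bar> powr p \<partial>M)"
    by (intro integral_cong_AE) (use ae in auto)
  then show "Lp_norm M p g = Lp_norm M p f" by (simp add: Lp_norm_def)
qed

lemma Lp_norm_eq_0_AE:
  assumes "1 \<le> p" "f \<in> Lp M p" "Lp_norm M p f = 0"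
  shows "AE x in M. f x = 0"
proof -
  have "(\<integral>x. \<bar>f x\<bar> powr p \<partial>M) = 0"
    using Lp_norm_powr[OF assms(1), of M f] assms by simp
  then have "AE x in M. \<bar>f x\<bar> powr p = 0"
    using integral_nonneg_eq_0_iff_AE[OF LpD(2)[OF assms(2)]] by simp
  then show ?thesis by simp
qed

lemma Lp_AE_0:
  assumes "f \<in> borel_measurable M" "AE x in M. f x = 0"
  shows "f \<in> Lp M p" "Lp_norm M p f = 0"
proof -
  have *: "(\<lambda>_. 0) \<in> Lp M p" by (simp add: Lp_def)
  have **: "AE x in M. 0 = f x" using assms(2) by auto
  show "f \<in> Lp M p" "Lp_norm M p f = 0"
    using Lp_AE_cong[OF * assms(1) **] by (auto simp: Lp_norm_def)
qed

lemma Lp_zero [simp]: "(\<lambda>_. 0) \<in> Lp M p" and Lp_norm_zero [simp]: "Lp_norm M p (\<lambda>_. 0) = 0"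
  by (auto intro: Lp_AE_0)

lemma powr_sum_le:
  fixes a b :: real
  assumes "0 \<le> a" "0 \<le> b" "0 \<le> p"
  shows "(a + b) powr p \<le> 2 powr p * (a powr p + b powr p)"
proof -
  have "(a + b) powr p \<le> (2 * max a b) powr p"
    using assms by (intro powr_mono2) auto
  also have "\<dots> = 2 powr p * max a b powr p" using assms by (simp add: powr_mult)
  also have "max a b powr p \<le> a powr p + b powr p"
    by (simp add: max_def)
  finally show ?thesis by simp
qed

lemma Lp_dominated:
  assumes "f \<in> borel_measurable M" "integrable M h" "AE x in M. \<bar>f x\<bar> powr p \<le> h x"
  shows "f \<in> Lp M p"
proof -
  have [measurable]: "f \<in> borel_measurable M" by fact
  have "integrable M (\<lambda>x. \<bar>f x\<bar> powr p)"
    by (rule Bochner_Integration.integrable_bound[OF assms(2)]) (use assms(3) in auto)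
  then show ?thesis by (simp add: Lp_def)
qed

lemma Lp_add:
  assumes "1 \<le> p" "f \<in> Lp M p" "g \<in> Lp M p"
  shows "(\<lambda>x. f x + g x) \<in> Lp M p"
proof (rule Lp_dominated)
  show "(\<lambda>x. f x + g x) \<in> borel_measurable M"
    using LpD(1)[OF assms(2)] LpD(1)[OF assms(3)] by simp
  show "integrable M (\<lambda>x. 2 powr p * (\<bar>f x\<bar> powr p + \<bar>g x\<bar> powr p))"
    using LpD(2)[OF assms(2)] LpD(2)[OF assms(3)] by auto
  have "\<bar>f x + g x\<bar> powr p \<le> 2 powr p * (\<bar>f x\<bar> powr p + \<bar>g x\<bar> powr p)" for x
  proof -
    have "\<bar>f x + g x\<bar> powr p \<le> (\<bar>f x\<bar> + \<bar>g x\<bar>) powr p"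
      using assms by (intro powr_mono2) auto
    also have "\<dots> \<le> 2 powr p * (\<bar>f x\<bar> powr p + \<bar>g x\<bar> powr p)"
      using assms by (intro powr_sum_le) auto
    finally show ?thesis .
  qed
  then show "AE x in M. \<bar>f x + g x\<bar> powr p \<le> 2 powr p * (\<bar>f x\<bar> powr p + \<bar>g x\<bar> powr p)" by auto
qed

lemma Lp_cmult:
  assumes "f \<in> Lp M p"
  shows "(\<lambda>x. c * f x) \<in> Lp M p"
  using assms by (auto simp: Lp_def abs_mult powr_mult)

lemma Lp_norm_cmult:
  assumes "1 \<le> p"
  shows "Lp_norm M p (\<lambda>x. c * f x) = \<bar>c\<bar> * Lp_norm M p f"
proof -
  have "0 \<le> (\<integral>x. \<bar>f x\<bar> powr p \<partial>M)" by (intro integral_nonneg_AE) auto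
  then show ?thesis using assms by (simp add: Lp_norm_def abs_mult powr_mult powr_powr)
qed

text \<open>Convexity on the open half-line extends to the endpoint: for \<open>x = 0\<close> the
  claim reduces to t^p <= t with 0 < t < 1.\<close>

lemma convex_on_powr_nonneg:
  assumes "1 \<le> p"
  shows "convex_on {0..} (\<lambda>x::real. x powr p)"
proof (rule convex_on_linorderI)
  fix t x y :: real
  assume t: "0 < t" "t < 1" and xy: "x \<in> {0..}" "y \<in> {0..}" "x < y"
  show "((1 - t) *\<^sub>R x + t *\<^sub>R y) powr p \<le> (1 - t) * x powr p + t * y powr p"
  proof (cases "x = 0")
    case True
    have "t powr p \<le> t powr 1" using t assms by (intro powr_mono') auto
    then show ?thesis using True t by (simp add: powr_mult mult_right_mono)
  next
    case False
    then show ?thesis using convex_onD[OF powr_convex[OF assms], of t x y] t xy by auto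
  qed
qed simp

text \<open>Convexity of the p-th power at the points u/\<alpha> and v/\<beta> with weights
  proportional to \<alpha> and \<beta>. With the two norms as \<alpha> and \<beta> it integrates to
  Minkowski's inequality.\<close>

lemma powr_convex_comb:
  fixes u v \<alpha> \<beta> p :: real
  assumes "0 \<le> u" "0 \<le> v" "0 < \<alpha>" "0 < \<beta>" "1 \<le> p"
  shows "(u + v) powr p \<le> (\<alpha> + \<beta>) powr p * (\<alpha> / (\<alpha> + \<beta>) * (u powr p / \<alpha> powr p) + \<beta> / (\<alpha> + \<beta>) * (v powr p / \<beta> powr p))"
proof -
  define t where "t = \<beta> / (\<alpha> + \<beta>)"
  have t: "0 \<le> t" "t \<le> 1" "1 - t = \<alpha> / (\<alpha> + \<beta>)"
    using assms add_pos_pos[of \<alpha> \<beta>] by (auto simp: t_def field_simps)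
  have "((1 - t) *\<^sub>R (u / \<alpha>) + t *\<^sub>R (v / \<beta>)) powr p \<le> (1 - t) * (u / \<alpha>) powr p + t * (v / \<beta>) powr p"
    using convex_onD[OF convex_on_powr_nonneg, of p t "u / \<alpha>" "v / \<beta>"] assms t by auto
  moreover have "(1 - t) *\<^sub>R (u / \<alpha>) + t *\<^sub>R (v / \<beta>) = (u + v) / (\<alpha> + \<beta>)"
    using assms unfolding t(3) by (simp add: t_def add_divide_distrib)
  ultimately have "(u + v) powr p / (\<alpha> + \<beta>) powr p \<le> \<alpha> / (\<alpha> + \<beta>) * (u powr p / \<alpha> powr p) + \<beta> / (\<alpha> + \<beta>) * (v powr p / \<beta> powr p)"
    using assms unfolding t(3) unfolding t_def by (simp add: powr_divide)
  then show ?thesis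
    using assms by (subst (asm) pos_divide_le_eq) (auto simp: mult.commute)
qed

lemma Lp_norm_add:
  assumes p: "1 \<le> p" and f: "f \<in> Lp M p" and g: "g \<in> Lp M p"
  shows "Lp_norm M p (\<lambda>x. f x + g x) \<le> Lp_norm M p f + Lp_norm M p g"
proof -
  have [measurable]: "f \<in> borel_measurable M" "g \<in> borel_measurable M"
    using f g LpD by auto
  define a where "a = Lp_norm M p f"
  define b where "b = Lp_norm M p g"
  have fi: "integrable M (\<lambda>x. \<bar>f x\<bar> powr p)" and gi: "integrable M (\<lambda>x. \<bar>g x\<bar> powr p)"
    and fgi: "integrable M (\<lambda>x. \<bar>f x + g x\<bar> powr p)"
    using LpD[OF f] LpD[OF g] LpD[OF Lp_add[OF p f g]] by auto
  consider "a = 0" | "b = 0" | "a > 0" "b > 0"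
    using Lp_norm_nonneg[of M p] unfolding a_def b_def by (metis less_eq_real_def)
  then show ?thesis
  proof cases
    case 1
    then have "AE x in M. f x = 0" using Lp_norm_eq_0_AE[OF p f] by (simp add: a_def)
    then have "AE x in M. g x = f x + g x" by auto
    from Lp_AE_cong(2)[OF g _ this] show ?thesis using Lp_norm_nonneg[of M p f] by simp
  next
    case 2
    then have "AE x in M. g x = 0" using Lp_norm_eq_0_AE[OF p g] by (simp add: b_def)
    then have "AE x in M. f x = f x + g x" by auto
    from Lp_AE_cong(2)[OF f _ this] show ?thesis using Lp_norm_nonneg[of M p g] by simp
  next
    case 3
    \<comment> \<open>Both |f|^p / a^p and |g|^p / b^p have integral 1 and the weights add up to 1,
      so this majorant has integral (a + b)^p.\<close>
    let ?h = "\<lambda>x. (a + b) powr p * (a / (a + b) * (\<bar>f x\<bar> powr p / a powr p) + b / (a + b) * (\<bar>g x\<bar> powr p / b powr p))"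
    have "\<bar>f x + g x\<bar> powr p \<le> ?h x" for x
    proof -
      have "\<bar>f x + g x\<bar> powr p \<le> (\<bar>f x\<bar> + \<bar>g x\<bar>) powr p"
        using p by (intro powr_mono2) auto
      also have "\<dots> \<le> ?h x"
        using 3 p by (intro powr_convex_comb) auto
      finally show ?thesis .
    qed
    then have "(\<integral>x. \<bar>f x + g x\<bar> powr p \<partial>M) \<le> (\<integral>x. ?h x \<partial>M)"
      using fi gi fgi by (intro integral_mono) auto
    also have "\<dots> = (a + b) powr p * (a / (a + b) * ((\<integral>x. \<bar>f x\<bar> powr p \<partial>M) / a powr p)
                      + b / (a + b) * ((\<integral>x. \<bar>g x\<bar> powr p \<partial>M) / b powr p))"
      using fi gi by simp
    also have "\<dots> = (a + b) powr p"
    proof -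
      have "(\<integral>x. \<bar>f x\<bar> powr p \<partial>M) = a powr p" "(\<integral>x. \<bar>g x\<bar> powr p \<partial>M) = b powr p"
        by (simp_all add: Lp_norm_powr[OF p] a_def b_def)
      then show ?thesis using 3 by (simp flip: add_divide_distrib)
    qed
    finally have "Lp_norm M p (\<lambda>x. f x + g x) powr p \<le> (a + b) powr p"
      by (simp add: Lp_norm_powr[OF p])
    then show ?thesis unfolding a_def b_def
      using p Lp_norm_nonneg[of M p]
      by (metis add_nonneg_nonneg less_le_trans not_le powr_less_mono2 zero_less_one)
  qed
qed

lemma Lp_diff:
  assumes "1 \<le> p" "f \<in> Lp M p" "g \<in> Lp M p"
  shows "(\<lambda>x. f x - g x) \<in> Lp M p"
  using Lp_add[OF assms(1,2) Lp_cmult[OF assms(3), of "-1"]] by simp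

lemma Lp_norm_minus_commute:
  "Lp_norm M p (\<lambda>x. f x - g x) = Lp_norm M p (\<lambda>x. g x - f x)"
  by (simp add: Lp_norm_def abs_minus_commute)

lemma Lp_norm_diff:
  assumes "1 \<le> p" "f \<in> Lp M p" "g \<in> Lp M p"
  shows "Lp_norm M p (\<lambda>x. f x - g x) \<le> Lp_norm M p f + Lp_norm M p g"
  using Lp_norm_add[OF assms(1,2) Lp_cmult[OF assms(3), of "-1"]] Lp_norm_cmult[OF assms(1), of M "-1" g] by simp

lemma Lp_norm_triangle:
  assumes "1 \<le> p" "f \<in> Lp M p" "g \<in> Lp M p" "h \<in> Lp M p"
  shows "Lp_norm M p (\<lambda>x. f x - h x) \<le> Lp_norm M p (\<lambda>x. f x - g x) + Lp_norm M p (\<lambda>x. g x - h x)"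
  using Lp_norm_add[OF assms(1) Lp_diff[OF assms(1,2,3)] Lp_diff[OF assms(1,3,4)]] by simp

lemma Lp_sum:
  assumes "1 \<le> p" "\<And>i. i \<in> I \<Longrightarrow> f i \<in> Lp M p"
  shows "(\<lambda>x. \<Sum>i\<in>I. f i x) \<in> Lp M p"
  using assms(2) by (induction I rule: infinite_finite_induct) (auto intro: Lp_add[OF assms(1)])

lemma Lp_norm_sum:
  assumes "1 \<le> p" "\<And>i. i \<in> I \<Longrightarrow> f i \<in> Lp M p"
  shows "Lp_norm M p (\<lambda>x. \<Sum>i\<in>I. f i x) \<le> (\<Sum>i\<in>I. Lp_norm M p (f i))"
  using assms(2)
proof (induction I rule: infinite_finite_induct)
  case (insert i I)
  then show ?case
    using Lp_norm_add[OF assms(1), of "f i" M "\<lambda>x. \<Sum>i\<in>I. f i x"] Lp_sum[OF assms(1), of I f M]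
    by fastforce
qed auto

text \<open>The constant \<open>2\<close> is not optimal, but it avoids Jensen's inequality.\<close>

lemma (in prob_space) Lp_norm_1_le:
  assumes "1 \<le> p" "f \<in> Lp M p"
  shows "integrable M f" "(\<integral>x. \<bar>f x\<bar> \<partial>M) \<le> 2 * Lp_norm M p f"
proof -
  have [measurable]: "f \<in> borel_measurable M" using assms LpD by auto
  have fi: "integrable M (\<lambda>x. \<bar>f x\<bar> powr p)" using LpD[OF assms(2)] by auto
  have le: "t \<le> 1 + t powr p" if "0 \<le> t" for t :: real
  proof (cases "t \<le> 1")
    case True
    then show ?thesis by (smt (verit) powr_ge_zero)
  next
    case False
    then have "t powr 1 \<le> t powr p" using assms by (intro powr_mono) auto
    then show ?thesis using False by simp
  qed
  have "integrable M (\<lambda>x. 1 + \<bar>f x\<bar> powr p)" using fi by simp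
  then show int: "integrable M f"
    by (rule Bochner_Integration.integrable_bound) (use le[of "\<bar>f _\<bar>"] in auto)
  show "(\<integral>x. \<bar>f x\<bar> \<partial>M) \<le> 2 * Lp_norm M p f"
  proof (cases "Lp_norm M p f = 0")
    case True
    then have "AE x in M. f x = 0" using Lp_norm_eq_0_AE assms by blast
    then have "(\<integral>x. \<bar>f x\<bar> \<partial>M) = 0" by (intro integral_eq_zero_AE) auto
    then show ?thesis using True by simp
  next
    case False
    define a where "a = Lp_norm M p f"
    have a: "a > 0" using False Lp_norm_nonneg[of M p f] by (simp add: a_def)
    \<comment> \<open>Scaling by the norm \<open>a\<close> before using t <= 1 + t^p makes each of
      the two summands integrate to 1; this is where the factor 2 arises.\<close>
    have "\<bar>f x\<bar> \<le> a * (1 + \<bar>f x\<bar> powr p / a powr p)" for x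
      using le[of "\<bar>f x\<bar> / a"] a by (simp add: powr_divide pos_divide_le_eq mult.commute)
    then have "(\<integral>x. \<bar>f x\<bar> \<partial>M) \<le> (\<integral>x. a * (1 + \<bar>f x\<bar> powr p / a powr p) \<partial>M)"
      using int fi by (intro integral_mono) auto
    also have "\<dots> = a * (1 + (\<integral>x. \<bar>f x\<bar> powr p \<partial>M) / a powr p)"
      using fi by (simp add: prob_space)
    also have "\<dots> = 2 * a"
    proof -
      have "(\<integral>x. \<bar>f x\<bar> powr p \<partial>M) = a powr p"
        by (simp add: Lp_norm_powr[OF assms(1)] a_def)
      then show ?thesis using a by simp
    qed
    finally show ?thesis by (simp add: a_def)
  qed
qed

text \<open>On a probability space a Cauchy sequence in L^p is Cauchy in L^1, so a subsequence
  converges almost everywhere. Fatou's lemma along that subsequence turns the Cauchy bound on |u_n -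
  u_(r i)|^p into a bound on |u_n - v|^p.\<close>

lemma (in prob_space) Lp_complete:
  assumes p: "1 \<le> p" and u: "\<And>n. u n \<in> Lp M p"
    and cau: "\<And>e. e > 0 \<Longrightarrow> \<exists>N. \<forall>m\<ge>N. \<forall>n\<ge>N. Lp_norm M p (\<lambda>x. u m x - u n x) < e"
  obtains v where "v \<in> Lp M p" "(\<lambda>n. Lp_norm M p (\<lambda>x. u n x - v x)) \<longlonglongrightarrow> 0"
proof -
  have [measurable]: "u n \<in> borel_measurable M" for n using LpD(1)[OF u] .
  have d: "(\<lambda>x. u m x - u n x) \<in> Lp M p" for m n using Lp_diff[OF p u u] .
  have "\<exists>N. \<forall>i\<ge>N. \<forall>j\<ge>N. LINT x|M. norm (u i x - u j x) < e" if "e > 0" for e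
  proof -
    from cau[of "e/2"] that obtain N where
      N: "\<forall>m\<ge>N. \<forall>n\<ge>N. Lp_norm M p (\<lambda>x. u m x - u n x) < e / 2" by auto
    have "LINT x|M. norm (u i x - u j x) < e" if "i \<ge> N" "j \<ge> N" for i j
      using Lp_norm_1_le(2)[OF p d[of i j]] N that by fastforce
    then show ?thesis by blast
  qed
  from cauchy_L1_AE_cauchy_subseq[OF Lp_norm_1_le(1)[OF p u] this]
  obtain r where r: "strict_mono r" "AE x in M. Cauchy (\<lambda>i. u (r i) x)" by blast
  define v where "v x = lim (\<lambda>i. u (r i) x)" for x
  have [measurable]: "v \<in> borel_measurable M" unfolding v_def by measurable
  have v: "AE x in M. (\<lambda>i. u (r i) x) \<longlonglongrightarrow> v x"
    using r(2) by eventually_elim (simp add: v_def Cauchy_convergent_iff convergent_LIMSEQ_iff)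
  have key: "(\<lambda>x. u n x - v x) \<in> Lp M p \<and> Lp_norm M p (\<lambda>x. u n x - v x) \<le> e"
    if e: "e > 0" and N: "\<forall>m\<ge>N. \<forall>n\<ge>N. Lp_norm M p (\<lambda>x. u m x - u n x) < e" and n: "n \<ge> N" for e N n
  proof -
    have bd: "(\<integral>\<^sup>+x. ennreal (\<bar>u n x - u (r i) x\<bar> powr p) \<partial>M) \<le> ennreal (e powr p)" if "i \<ge> N" for i
    proof -
      have ri: "r i \<ge> N" using that seq_suble[OF r(1), of i] by simp
      have "(\<integral>\<^sup>+x. ennreal (\<bar>u n x - u (r i) x\<bar> powr p) \<partial>M) = ennreal (\<integral>x. \<bar>u n x - u (r i) x\<bar> powr p \<partial>M)"
        using LpD(2)[OF d] by (intro nn_integral_eq_integral) auto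
      also have "\<dots> = ennreal (Lp_norm M p (\<lambda>x. u n x - u (r i) x) powr p)"
        by (simp add: Lp_norm_powr[OF p])
      also have "\<dots> \<le> ennreal (e powr p)"
        using N n ri p Lp_norm_nonneg by (intro ennreal_leI powr_mono2) (auto intro: less_imp_le)
      finally show ?thesis .
    qed
    have "AE x in M. ennreal (\<bar>u n x - v x\<bar> powr p) = liminf (\<lambda>i. ennreal (\<bar>u n x - u (r i) x\<bar> powr p))"
      using v
    proof eventually_elim
      case (elim x)
      have "(\<lambda>i. \<bar>u n x - u (r i) x\<bar> powr p) \<longlonglongrightarrow> \<bar>u n x - v x\<bar> powr p"
        using p by (intro tendsto_powr2 tendsto_rabs tendsto_diff elim tendsto_const) auto
      then have "(\<lambda>i. ennreal (\<bar>u n x - u (r i) x\<bar> powr p)) \<longlonglongrightarrow> ennreal (\<bar>u n x - v x\<bar> powr p)"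
        by (rule tendsto_ennrealI)
      then show ?case using lim_imp_Liminf[OF sequentially_bot] by metis
    qed
    then have "(\<integral>\<^sup>+x. ennreal (\<bar>u n x - v x\<bar> powr p) \<partial>M)
        = (\<integral>\<^sup>+x. liminf (\<lambda>i. ennreal (\<bar>u n x - u (r i) x\<bar> powr p)) \<partial>M)"
      by (rule nn_integral_cong_AE)
    also have "\<dots> \<le> liminf (\<lambda>i. \<integral>\<^sup>+x. ennreal (\<bar>u n x - u (r i) x\<bar> powr p) \<partial>M)"
      by (intro nn_integral_liminf) auto
    also have "\<dots> \<le> ennreal (e powr p)"
      by (intro Liminf_le) (auto simp: eventually_sequentially intro!: exI[of _ N] bd)
    finally have le: "(\<integral>\<^sup>+x. ennreal (\<bar>u n x - v x\<bar> powr p) \<partial>M) \<le> ennreal (e powr p)" .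
    then have int: "integrable M (\<lambda>x. \<bar>u n x - v x\<bar> powr p)"
      by (intro integrableI_bounded) (auto simp: le_less_trans)
    then have L: "(\<lambda>x. u n x - v x) \<in> Lp M p" by (simp add: Lp_def)
    have "ennreal (Lp_norm M p (\<lambda>x. u n x - v x) powr p) \<le> ennreal (e powr p)"
      using le int by (subst (asm) nn_integral_eq_integral) (auto simp: Lp_norm_powr[OF p])
    then have "Lp_norm M p (\<lambda>x. u n x - v x) powr p \<le> e powr p" by simp
    then have "Lp_norm M p (\<lambda>x. u n x - v x) \<le> e"
      using e p by (meson not_le powr_less_mono2 less_imp_le less_le_trans zero_less_one)
    then show ?thesis using L by blast
  qed
  have "v \<in> Lp M p"
  proof -
    obtain N where N: "\<forall>m\<ge>N. \<forall>n\<ge>N. Lp_norm M p (\<lambda>x. u m x - u n x) < 1" using cau[of 1] by auto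
    have "(\<lambda>x. u N x - v x) \<in> Lp M p" using key[OF _ N, of N] by simp
    from Lp_diff[OF p u[of N] this] show ?thesis by simp
  qed
  moreover have "(\<lambda>n. Lp_norm M p (\<lambda>x. u n x - v x)) \<longlonglongrightarrow> 0"
  proof (rule LIMSEQ_I)
    fix e :: real assume "e > 0"
    then have e: "e/2 > 0" by simp
    obtain N where N: "\<forall>m\<ge>N. \<forall>n\<ge>N. Lp_norm M p (\<lambda>x. u m x - u n x) < e/2" using cau[OF e] by auto
    have "norm (Lp_norm M p (\<lambda>x. u n x - v x) - 0) < e" if "n \<ge> N" for n
      using key[OF e N that] Lp_norm_nonneg[of M p "\<lambda>x. u n x - v x"] \<open>e > 0\<close> by simp
    then show "\<exists>no. \<forall>n\<ge>no. norm (Lp_norm M p (\<lambda>x. u n x - v x) - 0) < e" by blast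
  qed
  ultimately show ?thesis by (rule that)
qed

section \<open>A Burkholder inequality\<close>

lemma exp_le_quadratic:
  fixes x :: real
  assumes "\<bar>x\<bar> \<le> 1"
  shows "exp x \<le> 1 + x + x\<^sup>2"
proof (cases "0 \<le> x")
  case True
  then show ?thesis using exp_bound[of x] assms by simp
next
  case False
  define y where "y = - x"
  have y: "0 \<le> y" using False by (simp add: y_def)
  \<comment> \<open>The claim for x = -y amounts to (1 - y + y^2) * exp y >= 1, and the quadratic
    Taylor polynomial of exp y already suffices: its product with 1 - y + y^2 has no negative
    coefficient and no linear term.\<close>
  have "1 \<le> 1 + y\<^sup>2 / 2 + y ^ 3 / 2 + y ^ 4 / 2" using y by simp
  also have "\<dots> = (1 - y + y\<^sup>2) * (1 + y + y\<^sup>2 / 2)"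
    by (simp add: field_simps power2_eq_square power3_eq_cube power4_eq_xxxx)
  also have "\<dots> \<le> (1 - y + y\<^sup>2) * exp y"
  proof (rule mult_left_mono)
    show "1 + y + y\<^sup>2 / 2 \<le> exp y" using exp_lower_Taylor_quadratic[OF y] by simp
    show "0 \<le> 1 - y + y\<^sup>2" using assms by (simp add: y_def)
  qed
  finally have "1 / exp y \<le> 1 - y + y\<^sup>2" by (simp add: divide_le_eq)
  then show ?thesis by (simp add: y_def exp_minus field_simps)
qed

text \<open>Each summand of the constant serves one range of t. If |p t| < 1, then (1 + t)^p <= exp
  (p t), and the quadratic bound of the exponential contributes p^2. Otherwise 1 + |t| <= (p + 1)
  |t| contributes (p + 1)^p, and (p t)^2 compensates a negative linear term.\<close>

lemma one_add_powr_le: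
  fixes p t :: real
  assumes "1 \<le> p"
  shows "\<bar>1 + t\<bar> powr p \<le> 1 + p * t + ((p + 1) powr p + p\<^sup>2) * (t\<^sup>2 + \<bar>t\<bar> powr p)"
proof -
  have c: "0 \<le> (p + 1) powr p" "0 \<le> p\<^sup>2" "0 \<le> t\<^sup>2" "0 \<le> \<bar>t\<bar> powr p" by auto
  have expand: "((p + 1) powr p + p\<^sup>2) * (t\<^sup>2 + \<bar>t\<bar> powr p)
      = (p * t)\<^sup>2 + (p + 1) powr p * \<bar>t\<bar> powr p + ((p + 1) powr p * t\<^sup>2 + p\<^sup>2 * \<bar>t\<bar> powr p)"
    by (simp add: algebra_simps power2_eq_square)
  have nn: "0 \<le> (p + 1) powr p * t\<^sup>2 + p\<^sup>2 * \<bar>t\<bar> powr p" "0 \<le> (p + 1) powr p * \<bar>t\<bar> powr p" using c by auto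
  show ?thesis
  proof (cases "\<bar>p * t\<bar> < 1")
    case True
    have "\<bar>t\<bar> \<le> \<bar>p * t\<bar>" using assms by (simp add: abs_mult mult_le_cancel_right1)
    then have t: "0 < 1 + t" using True by auto
    then have "\<bar>1 + t\<bar> powr p = exp (p * ln (1 + t))" by (simp add: powr_def)
    also have "\<dots> \<le> exp (p * t)"
      using assms ln_add_one_self_le_self2[of t] t by (auto intro!: mult_left_mono)
    also have "\<dots> \<le> 1 + p * t + (p * t)\<^sup>2"
      using True by (intro exp_le_quadratic) simp
    finally show ?thesis unfolding expand using nn by linarith
  next
    case False
    then have pt: "1 \<le> p * \<bar>t\<bar>" using assms by (simp add: abs_mult)
    have "\<bar>1 + t\<bar> \<le> (p + 1) * \<bar>t\<bar>" using pt by (simp add: algebra_simps)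
    then have "\<bar>1 + t\<bar> powr p \<le> ((p + 1) * \<bar>t\<bar>) powr p" using assms by (intro powr_mono2) auto
    also have "\<dots> = (p + 1) powr p * \<bar>t\<bar> powr p" by (simp add: powr_mult)
    finally have 1: "\<bar>1 + t\<bar> powr p \<le> (p + 1) powr p * \<bar>t\<bar> powr p" .
    have "p * \<bar>t\<bar> * 1 \<le> (p * \<bar>t\<bar>) * (p * \<bar>t\<bar>)" using pt by (intro mult_left_mono) auto
    moreover have "(p * \<bar>t\<bar>) * (p * \<bar>t\<bar>) = (p * t)\<^sup>2"
      by (simp add: power2_eq_square mult.assoc mult.left_commute)
    ultimately have "- (p * t) \<le> (p * t)\<^sup>2"
      using assms abs_ge_minus_self[of "p * t"] by (simp add: abs_mult)
    then show ?thesis unfolding expand using nn 1 by linarith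
  qed
qed

text \<open>The preceding inequality for t = y/x, multiplied by |x|^p. The coefficient of y is the
  derivative of |x|^p; keeping it exact lets the linear term disappear under a conditional
  expectation.\<close>

lemma abs_add_powr_le:
  fixes p x y :: real
  assumes "2 \<le> p"
  shows "\<bar>x + y\<bar> powr p \<le> \<bar>x\<bar> powr p + p * (sgn x * \<bar>x\<bar> powr (p - 1)) * y
           + ((p + 1) powr p + p\<^sup>2) * (\<bar>x\<bar> powr (p - 2) * y\<^sup>2 + \<bar>y\<bar> powr p)"
proof (cases "x = 0")
  case True
  have "1 * \<bar>y\<bar> powr p \<le> ((p + 1) powr p + p\<^sup>2) * \<bar>y\<bar> powr p"
    using assms ge_one_powr_ge_zero[of "p + 1" p] by (intro mult_right_mono add_increasing2) auto
  moreover have "0 \<le> ((p + 1) powr p + p\<^sup>2) * (\<bar>x\<bar> powr (p - 2) * y\<^sup>2)" by simp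
  ultimately show ?thesis using True by (simp add: distrib_left)
next
  case False
  let ?c = "(p + 1) powr p + p\<^sup>2"
  have pos: "\<bar>x\<bar> > 0" using False by simp
  have "\<bar>x + y\<bar> powr p = \<bar>x\<bar> powr p * \<bar>1 + y / x\<bar> powr p"
  proof -
    have "x + y = x * (1 + y / x)" using False by (simp add: field_simps)
    then show ?thesis by (metis abs_mult powr_mult)
  qed
  also have "\<dots> \<le> \<bar>x\<bar> powr p * (1 + p * (y / x) + ?c * ((y / x)\<^sup>2 + \<bar>y / x\<bar> powr p))"
    using one_add_powr_le[of p "y / x"] assms by (intro mult_left_mono) auto
  also have "\<dots> = \<bar>x\<bar> powr p + p * (\<bar>x\<bar> powr p / x) * y + ?c * (\<bar>x\<bar> powr p / x\<^sup>2 * y\<^sup>2 + \<bar>x\<bar> powr p * \<bar>y / x\<bar> powr p)"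
    by (simp add: algebra_simps power_divide)
  also have "\<bar>x\<bar> powr p * \<bar>y / x\<bar> powr p = \<bar>y\<bar> powr p"
    using pos by (simp add: abs_divide powr_divide)
  also have "\<bar>x\<bar> powr p / x\<^sup>2 = \<bar>x\<bar> powr (p - 2)"
    using pos by (simp add: powr_diff)
  also have "\<bar>x\<bar> powr p / x = sgn x * \<bar>x\<bar> powr (p - 1)"
    using pos by (simp add: powr_diff sgn_real_def)
  finally show ?thesis .
qed

text \<open>Writing each r-th power as one factor times an (r-1)-st power, every (r-1)-st power on
  the left is at most that of a + 2 c b, and the remaining factors add up to a + c b + c b. With r =
  p/2 and squared norms for a and b, this converts an estimate of p-th powers into one of
  squares.\<close>

lemma powr_add_ge:
  fixes a b c r :: real
  assumes "0 \<le> a" "0 \<le> b" "1 \<le> r" "1 \<le> c"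
  shows "a powr r + c * (a powr (r - 1) * b + b powr r) \<le> (a + 2 * c * b) powr r"
proof -
  have split: "x powr r = x * x powr (r - 1)" if "0 \<le> x" for x :: real
    using that by (cases "x = 0") (auto simp: powr_diff)
  have cb: "b \<le> 2 * c * b" using mult_right_mono[of 1 "2 * c" b] assms by simp
  have "a * a powr (r - 1) \<le> a * (a + 2 * c * b) powr (r - 1)"
    using assms cb by (intro mult_left_mono powr_mono2) auto
  moreover have "(c * b) * a powr (r - 1) \<le> (c * b) * (a + 2 * c * b) powr (r - 1)"
    using assms cb by (intro mult_left_mono powr_mono2) auto
  moreover have "(c * b) * b powr (r - 1) \<le> (c * b) * (a + 2 * c * b) powr (r - 1)"
    using assms cb by (intro mult_left_mono powr_mono2) auto
  moreover have "(a + 2 * c * b) powr r = (a + 2 * c * b) * (a + 2 * c * b) powr (r - 1)"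
    using assms by (intro split) auto
  ultimately show ?thesis
    using split[OF assms(1)] split[OF assms(2)] by (simp add: algebra_simps)
qed

text \<open>A crude Young inequality: both bases are replaced by the larger one.\<close>

lemma powr_mult_powr_le:
  fixes u v s t :: real
  assumes "0 \<le> u" "0 \<le> v" "0 \<le> s" "0 \<le> t"
  shows "u powr s * v powr t \<le> u powr (s + t) + v powr (s + t)"
proof -
  have "u powr s * v powr t \<le> max u v powr s * max u v powr t"
    using assms by (intro mult_mono powr_mono2) auto
  also have "\<dots> = max u v powr (s + t)" by (simp add: powr_add)
  also have "\<dots> \<le> u powr (s + t) + v powr (s + t)" by (simp add: max_def)
  finally show ?thesis .
qed

lemma convex_on_abs_powr:
  assumes "1 \<le> p"
  shows "convex_on UNIV (\<lambda>x::real. \<bar>x\<bar> powr p)"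
proof (rule convex_on_linorderI)
  fix t x y :: real
  assume t: "0 < t" "t < 1"
  have "\<bar>(1 - t) *\<^sub>R x + t *\<^sub>R y\<bar> \<le> (1 - t) * \<bar>x\<bar> + t * \<bar>y\<bar>"
    using abs_triangle_ineq[of "(1 - t) * x" "t * y"] t by (simp add: abs_mult)
  then have "\<bar>(1 - t) *\<^sub>R x + t *\<^sub>R y\<bar> powr p \<le> ((1 - t) * \<bar>x\<bar> + t * \<bar>y\<bar>) powr p"
    using assms by (intro powr_mono2) auto
  also have "\<dots> \<le> (1 - t) * \<bar>x\<bar> powr p + t * \<bar>y\<bar> powr p"
    using convex_onD[OF convex_on_powr_nonneg[OF assms], of t "\<bar>x\<bar>" "\<bar>y\<bar>"] t by simp
  finally show "\<bar>(1 - t) *\<^sub>R x + t *\<^sub>R y\<bar> powr p \<le> (1 - t) * \<bar>x\<bar> powr p + t * \<bar>y\<bar> powr p" .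
qed simp

section \<open>Conditional expectations in L^p and one step of a martingale\<close>

context prob_space
begin

lemma subalgebra_sigma_finite:
  "subalgebra M G \<Longrightarrow> sigma_finite_subalgebra M G"
  by (intro finite_measure_subalgebra_is_sigma_finite finite_measure_subalgebra.intro
        finite_measure_subalgebra_axioms.intro) unfold_locales

lemma Lp_cond_exp:
  assumes p: "1 \<le> p" and G: "subalgebra M G" and f: "f \<in> Lp M p"
  shows "real_cond_exp M G f \<in> Lp M p" "Lp_norm M p (real_cond_exp M G f) \<le> Lp_norm M p f"
proof -
  interpret G: sigma_finite_subalgebra M G using G by (rule subalgebra_sigma_finite)
  have fi: "integrable M f" using Lp_norm_1_le(1)[OF p f] .
  have fp: "integrable M (\<lambda>x. \<bar>f x\<bar> powr p)" using LpD[OF f] by simp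
  let ?e = "real_cond_exp M G (\<lambda>x. \<bar>f x\<bar> powr p)"
  have J: "AE x in M. \<bar>real_cond_exp M G f x\<bar> powr p \<le> ?e x"
    by (rule G.real_cond_exp_jensens_inequality(2)[OF fi, of UNIV])
       (use fp convex_on_abs_powr[OF p] in auto)
  show L: "real_cond_exp M G f \<in> Lp M p"
    by (rule Lp_dominated[OF _ _ J]) (use fp in auto)
  have "Lp_norm M p (real_cond_exp M G f) powr p \<le> (\<integral>x. ?e x \<partial>M)"
    unfolding Lp_norm_powr[OF p] using LpD[OF L] fp J by (intro integral_mono_AE) auto
  also have "\<dots> = Lp_norm M p f powr p"
    using G.real_cond_exp_int(2)[OF fp] by (simp add: Lp_norm_powr[OF p])
  finally show "Lp_norm M p (real_cond_exp M G f) \<le> Lp_norm M p f"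
    using p Lp_norm_nonneg powr_less_mono2[of p "Lp_norm M p f" "Lp_norm M p (real_cond_exp M G f)"]
    by force
qed

text \<open>After integration of \<open>abs_add_powr_le\<close> the linear term vanishes, because it
  is a function of X times Y; the mixed term is at most 2 ||X||^(p-2) ||Y||^2, and
  \<open>powr_add_ge\<close> passes to squares. The coefficient 1 of ||X||^2 is essential: it lets
  the step be iterated with a constant independent of the number of summands.\<close>

lemma Lp_norm_martingale_step:
  assumes p: "2 \<le> p" and G: "subalgebra M G"
    and X: "X \<in> Lp M p" "AE x in M. real_cond_exp M G X x = X x"
    and Y: "Y \<in> Lp M p" "AE x in M. real_cond_exp M G Y x = 0"
  shows "(Lp_norm M p (\<lambda>x. X x + Y x))\<^sup>2 \<le>
    (Lp_norm M p X)\<^sup>2 + 4 * ((p + 1) powr p + p\<^sup>2) * (Lp_norm M p Y)\<^sup>2"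
proof -
  interpret G: sigma_finite_subalgebra M G using G by (rule subalgebra_sigma_finite)
  have p1: "1 \<le> p" using p by simp
  define c where "c = (p + 1) powr p + p\<^sup>2"
  have c: "1 \<le> c" using p ge_one_powr_ge_zero[of "p + 1" p] by (simp add: c_def add_increasing2)
  define a where "a = Lp_norm M p X"
  define b where "b = Lp_norm M p Y"
  define n where "n = Lp_norm M p (\<lambda>x. X x + Y x)"
  have nn: "0 \<le> a" "0 \<le> b" "0 \<le> n" by (auto simp: a_def b_def n_def Lp_norm_nonneg)
  have [measurable]: "X \<in> borel_measurable M" "Y \<in> borel_measurable M"
    using LpD(1)[OF X(1)] LpD(1)[OF Y(1)] by auto
  have Xi: "integrable M (\<lambda>x. \<bar>X x\<bar> powr p)" and Yi: "integrable M (\<lambda>x. \<bar>Y x\<bar> powr p)"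
    using LpD(2)[OF X(1)] LpD(2)[OF Y(1)] by auto
  have nab: "n \<le> a + b" unfolding n_def a_def b_def using Lp_norm_add[OF p1 X(1) Y(1)] .
  consider "a = 0" | "b = 0" | "a > 0" "b > 0" using nn by linarith
  then have "n\<^sup>2 \<le> a\<^sup>2 + 4 * c * b\<^sup>2"
  proof cases
    case 1
    have "n\<^sup>2 \<le> b\<^sup>2" using nab nn 1 by (intro power_mono) auto
    also have "\<dots> \<le> 4 * c * b\<^sup>2" using c mult_right_mono[of 1 "4 * c" "b\<^sup>2"] by simp
    finally show ?thesis using 1 by simp
  next
    case 2
    have "n\<^sup>2 \<le> a\<^sup>2" using nab nn 2 by (intro power_mono) auto
    then show ?thesis using 2 by simp
  next
    case 3
    define \<phi> where "\<phi> x = sgn (X x) * \<bar>X x\<bar> powr (p - 1)" for x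
    \<comment> \<open>X agrees with its conditional expectation only almost everywhere.
      \<open>\<psi>\<close> is a version of \<open>\<phi>\<close> that is genuinely measurable for
      \<open>G\<close>, so that Y may be replaced by its conditional expectation in the
      integral.\<close>
    define \<psi> where "\<psi> x = sgn (real_cond_exp M G X x) * \<bar>real_cond_exp M G X x\<bar> powr (p - 1)" for x
    have [measurable]: "\<phi> \<in> borel_measurable M" unfolding \<phi>_def by measurable
    have \<psi>G[measurable]: "\<psi> \<in> borel_measurable G" unfolding \<psi>_def by measurable
    have [measurable]: "\<psi> \<in> borel_measurable M" unfolding \<psi>_def by measurable
    have \<phi>\<psi>: "AE x in M. \<psi> x = \<phi> x" using X(2) by eventually_elim (simp add: \<phi>_def \<psi>_def)
    have \<phi>Yi: "integrable M (\<lambda>x. \<phi> x * Y x)"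
    proof (rule Bochner_Integration.integrable_bound)
      show "integrable M (\<lambda>x. \<bar>X x\<bar> powr p + \<bar>Y x\<bar> powr p)" using Xi Yi by simp
      have "norm (\<phi> x * Y x) \<le> norm (\<bar>X x\<bar> powr p + \<bar>Y x\<bar> powr p)" for x
        using powr_mult_powr_le[of "\<bar>X x\<bar>" "\<bar>Y x\<bar>" "p - 1" 1] p
        by (auto simp: \<phi>_def abs_mult sgn_real_def)
      then show "AE x in M. norm (\<phi> x * Y x) \<le> norm (\<bar>X x\<bar> powr p + \<bar>Y x\<bar> powr p)" by simp
    qed simp
    have \<psi>Yi: "integrable M (\<lambda>x. \<psi> x * Y x)"
      by (subst integrable_cong_AE[of _ _ "\<lambda>x. \<phi> x * Y x"]) (use \<phi>Yi \<phi>\<psi> in auto)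
    have "(\<integral>x. \<phi> x * Y x \<partial>M) = (\<integral>x. \<psi> x * Y x \<partial>M)"
      using \<phi>\<psi> by (intro integral_cong_AE) auto
    also have "\<dots> = (\<integral>x. \<psi> x * real_cond_exp M G Y x \<partial>M)"
      using G.real_cond_exp_intg(2)[OF \<psi>Yi \<psi>G] by simp
    also have "\<dots> = 0" using Y(2) by (intro integral_eq_zero_AE) auto
    finally have \<phi>0: "(\<integral>x. \<phi> x * Y x \<partial>M) = 0" .
    define \<theta> where "\<theta> x = \<bar>X x\<bar> powr (p - 2) * (Y x)\<^sup>2" for x
    have [measurable]: "\<theta> \<in> borel_measurable M" unfolding \<theta>_def by measurable
    \<comment> \<open>Young's inequality with exponents p - 2 and 2 for |X|/a and |Y|/b. Because of
      the normalisation its integral is Hoelder's bound up to a factor 2.\<close>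
    have \<theta>le: "\<theta> x \<le> a powr (p - 2) * b\<^sup>2 * (\<bar>X x\<bar> powr p / a powr p + \<bar>Y x\<bar> powr p / b powr p)" for x
    proof -
      have sq: "y powr 2 = y\<^sup>2" if "0 \<le> y" for y :: real
        using that by (cases "y = 0") auto
      have "(\<bar>X x\<bar> / a) powr (p - 2) * (\<bar>Y x\<bar> / b) powr 2 \<le> (\<bar>X x\<bar> / a) powr p + (\<bar>Y x\<bar> / b) powr p"
        using powr_mult_powr_le[of "\<bar>X x\<bar> / a" "\<bar>Y x\<bar> / b" "p - 2" 2] p 3 by simp
      moreover have "(\<bar>Y x\<bar> / b) powr 2 = (Y x)\<^sup>2 / b\<^sup>2"
        using 3 by (subst sq) (auto simp: power_divide)
      ultimately have "\<theta> x / (a powr (p - 2) * b\<^sup>2) \<le> \<bar>X x\<bar> powr p / a powr p + \<bar>Y x\<bar> powr p / b powr p"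
        using 3 sq[of b] by (simp add: \<theta>_def powr_divide)
      then show ?thesis using 3 by (subst (asm) pos_divide_le_eq) (auto simp: mult.commute)
    qed
    have \<theta>n: "0 \<le> \<theta> x" for x by (simp add: \<theta>_def)
    have ri: "integrable M (\<lambda>x. a powr (p - 2) * b\<^sup>2 * (\<bar>X x\<bar> powr p / a powr p + \<bar>Y x\<bar> powr p / b powr p))"
      using Xi Yi by simp
    have \<theta>i: "integrable M \<theta>"
      by (rule Bochner_Integration.integrable_bound[OF ri]) (use \<theta>le \<theta>n abs_of_nonneg in \<open>auto intro: order_trans[OF _ abs_ge_self]\<close>)
    have na: "(\<integral>x. \<bar>X x\<bar> powr p \<partial>M) = a powr p" "(\<integral>x. \<bar>Y x\<bar> powr p \<partial>M) = b powr p"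
      by (simp_all add: Lp_norm_powr[OF p1] a_def b_def)
    have "(\<integral>x. \<theta> x \<partial>M) \<le> (\<integral>x. a powr (p - 2) * b\<^sup>2 * (\<bar>X x\<bar> powr p / a powr p + \<bar>Y x\<bar> powr p / b powr p) \<partial>M)"
      using \<theta>i ri \<theta>le by (intro integral_mono) auto
    also have "\<dots> = 2 * (a powr (p - 2) * b\<^sup>2)" using Xi Yi na 3 by simp
    finally have \<theta>I: "(\<integral>x. \<theta> x \<partial>M) \<le> 2 * (a powr (p - 2) * b\<^sup>2)" .
    have "n powr p = (\<integral>x. \<bar>X x + Y x\<bar> powr p \<partial>M)" by (simp add: n_def Lp_norm_powr[OF p1])
    also have "\<dots> \<le> (\<integral>x. \<bar>X x\<bar> powr p + p * (\<phi> x * Y x) + c * (\<theta> x + \<bar>Y x\<bar> powr p) \<partial>M)"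
    proof (rule integral_mono)
      show "integrable M (\<lambda>x. \<bar>X x + Y x\<bar> powr p)" using LpD(2)[OF Lp_add[OF p1 X(1) Y(1)]] .
      show "integrable M (\<lambda>x. \<bar>X x\<bar> powr p + p * (\<phi> x * Y x) + c * (\<theta> x + \<bar>Y x\<bar> powr p))"
        using Xi Yi \<phi>Yi \<theta>i by simp
      show "\<bar>X x + Y x\<bar> powr p \<le> \<bar>X x\<bar> powr p + p * (\<phi> x * Y x) + c * (\<theta> x + \<bar>Y x\<bar> powr p)" for x
        using abs_add_powr_le[OF p, of "X x" "Y x"] unfolding \<phi>_def \<theta>_def c_def by (simp add: mult.assoc)
    qed
    also have "\<dots> = a powr p + c * ((\<integral>x. \<theta> x \<partial>M) + b powr p)"
      using Xi Yi \<phi>Yi \<theta>i \<phi>0 na by simp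
    also have "\<dots> \<le> a powr p + c * (2 * (a powr (p - 2) * b\<^sup>2) + b powr p)"
      using \<theta>I c by simp
    also have "\<dots> \<le> a powr p + (2 * c) * (a powr (p - 2) * b\<^sup>2 + b powr p)"
      using c by (simp add: algebra_simps)
    \<comment> \<open>Rewritten in a^2 and b^2, this is the left side of \<open>powr_add_ge\<close>
      with r = p/2 and constant 2c; the doubling in that lemma produces the final 4c.\<close>
    also have "\<dots> = (a\<^sup>2) powr (p / 2) + (2 * c) * ((a\<^sup>2) powr (p / 2 - 1) * b\<^sup>2 + (b\<^sup>2) powr (p / 2))"
    proof -
      have "(y\<^sup>2) powr s = y powr (2 * s)" if "0 < y" for y s :: real
        using that by (simp add: powr_powr flip: powr_numeral)
      from this[OF 3(1)] this[OF 3(2)] show ?thesis by (simp add: algebra_simps)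
    qed
    also have "\<dots> \<le> (a\<^sup>2 + 2 * (2 * c) * b\<^sup>2) powr (p / 2)"
      using p c by (intro powr_add_ge) auto
    finally have le: "n powr p \<le> (a\<^sup>2 + 4 * c * b\<^sup>2) powr (p / 2)" by simp
    have "n powr p = (n\<^sup>2) powr (p / 2)"
      using nn(3) p by (cases "n = 0") (simp_all add: powr_powr flip: powr_numeral)
    with le show ?thesis
      using p c powr_less_mono2[of "p / 2" "a\<^sup>2 + 4 * c * b\<^sup>2" "n\<^sup>2"] by fastforce
  qed
  then show ?thesis by (simp add: a_def b_def c_def n_def)
qed

end

section \<open>Convergence in the p-norm\<close>

lemma Lp_1_iff: "f \<in> Lp M 1 \<longleftrightarrow> integrable M f"
proof
  assume "f \<in> Lp M 1"
  then show "integrable M f"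
    using LpD[of f M 1] integrable_norm_cancel[of M f] by auto
next
  assume "integrable M f"
  then show "f \<in> Lp M 1" by (simp add: Lp_def)
qed

lemma Lp_norm_1: "Lp_norm M 1 f = (\<integral>x. \<bar>f x\<bar> \<partial>M)"
  by (simp add: Lp_norm_def)

lemma Lp_norm_2_power2: "(Lp_norm M 2 f)\<^sup>2 = (\<integral>x. (f x)\<^sup>2 \<partial>M)"
  using Lp_norm_powr[of 2 M f] Lp_norm_nonneg[of M 2 f] by simp

text \<open>The integral of a non-integrable function has value 0, so this condition is meaningful
  only together with membership in \<open>Lp M p\<close>, which the lemmas carry separately where it
  matters.\<close>

definition Lp_lim :: "'a measure \<Rightarrow> real \<Rightarrow> (nat \<Rightarrow> 'a \<Rightarrow> real) \<Rightarrow> ('a \<Rightarrow> real) \<Rightarrow> bool" where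
  "Lp_lim M p u f \<longleftrightarrow> (\<lambda>n. Lp_norm M p (\<lambda>x. u n x - f x)) \<longlonglongrightarrow> 0"

lemma Lp_limI_bound:
  assumes "\<And>n. Lp_norm M p (\<lambda>x. u n x - f x) \<le> b n" "b \<longlonglongrightarrow> 0"
  shows "Lp_lim M p u f"
  unfolding Lp_lim_def using assms(1)
  by (intro tendsto_sandwich[OF _ _ tendsto_const assms(2)]) (auto simp: Lp_norm_nonneg)

lemma Lp_lim_const: "Lp_lim M p (\<lambda>n. f) f"
  by (simp add: Lp_lim_def)

lemma Lp_lim_unique:
  assumes p: "1 \<le> p" and u: "\<And>n. u n \<in> Lp M p" and f: "f \<in> Lp M p" and g: "g \<in> Lp M p"
    and lim: "Lp_lim M p u f" "Lp_lim M p u g"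
  shows "AE x in M. f x = g x"
proof -
  have "(\<lambda>n. Lp_norm M p (\<lambda>x. u n x - f x) + Lp_norm M p (\<lambda>x. u n x - g x)) \<longlonglongrightarrow> 0 + 0"
    using lim unfolding Lp_lim_def by (rule tendsto_add)
  moreover have "Lp_norm M p (\<lambda>x. f x - g x) \<le> Lp_norm M p (\<lambda>x. u n x - f x) + Lp_norm M p (\<lambda>x. u n x - g x)" for n
    using Lp_norm_triangle[OF p f u[of n] g] Lp_norm_minus_commute[of M p f "u n"] by simp
  ultimately have "Lp_norm M p (\<lambda>x. f x - g x) \<le> 0"
    by (intro LIMSEQ_le_const[where X = "\<lambda>n. Lp_norm M p (\<lambda>x. u n x - f x) + Lp_norm M p (\<lambda>x. u n x - g x)"]) auto
  then have "Lp_norm M p (\<lambda>x. f x - g x) = 0" using Lp_norm_nonneg[of M p] by (simp add: order_antisym)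
  then show ?thesis using Lp_norm_eq_0_AE[OF p Lp_diff[OF p f g]] by simp
qed

lemma Lp_lim_AE_cong:
  assumes u: "\<And>n. u n \<in> borel_measurable M" "\<And>n. v n \<in> borel_measurable M"
    "f \<in> borel_measurable M" "g \<in> borel_measurable M"
    and uv: "\<And>n. AE x in M. u n x = v n x" "AE x in M. f x = g x" and lim: "Lp_lim M p u f"
  shows "Lp_lim M p v g"
proof -
  have "Lp_norm M p (\<lambda>x. u n x - f x) = Lp_norm M p (\<lambda>x. v n x - g x)" for n
  proof -
    have "(\<integral>x. \<bar>u n x - f x\<bar> powr p \<partial>M) = (\<integral>x. \<bar>v n x - g x\<bar> powr p \<partial>M)"
      using uv(1)[of n] uv(2) u by (intro integral_cong_AE) auto
    then show ?thesis by (simp add: Lp_norm_def)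
  qed
  then show ?thesis using lim by (simp add: Lp_lim_def)
qed

lemma Lp_lim_cmult:
  assumes "1 \<le> p" "Lp_lim M p u f"
  shows "Lp_lim M p (\<lambda>n x. c * u n x) (\<lambda>x. c * f x)"
  using tendsto_mult[OF tendsto_const[of "\<bar>c\<bar>"] assms(2)[unfolded Lp_lim_def]]
    Lp_norm_cmult[OF assms(1), of M c "\<lambda>x. u _ x - f x"] by (simp add: Lp_lim_def right_diff_distrib)

lemma Lp_lim_add:
  assumes p: "1 \<le> p" and "\<And>n. u n \<in> Lp M p" "f \<in> Lp M p" "\<And>n. v n \<in> Lp M p" "g \<in> Lp M p"
    and lim: "Lp_lim M p u f" "Lp_lim M p v g"
  shows "Lp_lim M p (\<lambda>n x. u n x + v n x) (\<lambda>x. f x + g x)"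
proof (rule Lp_limI_bound)
  show "Lp_norm M p (\<lambda>x. u n x + v n x - (f x + g x)) \<le>
      Lp_norm M p (\<lambda>x. u n x - f x) + Lp_norm M p (\<lambda>x. v n x - g x)" for n
    using Lp_norm_add[OF p Lp_diff[OF p assms(2,3), of n] Lp_diff[OF p assms(4,5), of n]]
    by (simp add: algebra_simps)
  show "(\<lambda>n. Lp_norm M p (\<lambda>x. u n x - f x) + Lp_norm M p (\<lambda>x. v n x - g x)) \<longlonglongrightarrow> 0"
    using tendsto_add[OF lim[unfolded Lp_lim_def]] by simp
qed

lemma Lp_lim_diff:
  assumes p: "1 \<le> p" and "\<And>n. u n \<in> Lp M p" "f \<in> Lp M p" "\<And>n. v n \<in> Lp M p" "g \<in> Lp M p"
    and lim: "Lp_lim M p u f" "Lp_lim M p v g"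
  shows "Lp_lim M p (\<lambda>n x. u n x - v n x) (\<lambda>x. f x - g x)"
proof -
  have "Lp_lim M p (\<lambda>n x. u n x + (-1) * v n x) (\<lambda>x. f x + (-1) * g x)"
    by (rule Lp_lim_add[OF p assms(2,3) Lp_cmult[OF assms(4)] Lp_cmult[OF assms(5)] lim(1) Lp_lim_cmult[OF p lim(2)]])
  then show ?thesis by simp
qed

lemma Lp_lim_sum:
  assumes p: "1 \<le> p" and "\<And>i n. i \<in> I \<Longrightarrow> u i n \<in> Lp M p" "\<And>i. i \<in> I \<Longrightarrow> f i \<in> Lp M p"
    and lim: "\<And>i. i \<in> I \<Longrightarrow> Lp_lim M p (u i) (f i)"
  shows "Lp_lim M p (\<lambda>n x. \<Sum>i\<in>I. u i n x) (\<lambda>x. \<Sum>i\<in>I. f i x)"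
  using assms(2-)
proof (induction I rule: infinite_finite_induct)
  case (insert i I)
  have "Lp_lim M p (\<lambda>n x. u i n x + (\<Sum>i\<in>I. u i n x)) (\<lambda>x. f i x + (\<Sum>i\<in>I. f i x))"
    by (intro Lp_lim_add p Lp_sum insert) auto
  then show ?case using insert by simp
qed (auto simp: Lp_lim_const)

context prob_space
begin

lemma Lp_lim_imp_Lp_lim_1:
  assumes p: "1 \<le> p" and u: "\<And>n. u n \<in> Lp M p" and f: "f \<in> Lp M p" and lim: "Lp_lim M p u f"
  shows "Lp_lim M 1 u f"
proof (rule Lp_limI_bound)
  show "Lp_norm M 1 (\<lambda>x. u n x - f x) \<le> 2 * Lp_norm M p (\<lambda>x. u n x - f x)" for n
    using Lp_norm_1_le(2)[OF p Lp_diff[OF p u[of n] f]] by (simp add: Lp_norm_1)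
  show "(\<lambda>n. 2 * Lp_norm M p (\<lambda>x. u n x - f x)) \<longlonglongrightarrow> 0"
    using tendsto_mult[OF tendsto_const[of 2] lim[unfolded Lp_lim_def]] by simp
qed

lemma Lp_norm_cond_exp_diff:
  assumes p: "1 \<le> p" and G: "subalgebra M G" and f: "f \<in> Lp M p" and g: "g \<in> Lp M p"
  shows "Lp_norm M p (\<lambda>x. real_cond_exp M G f x - real_cond_exp M G g x) \<le> Lp_norm M p (\<lambda>x. f x - g x)"
proof -
  interpret G: sigma_finite_subalgebra M G using G by (rule subalgebra_sigma_finite)
  have "AE x in M. real_cond_exp M G (\<lambda>x. f x - g x) x = real_cond_exp M G f x - real_cond_exp M G g x"
    using Lp_norm_1_le(1)[OF p f] Lp_norm_1_le(1)[OF p g] by simp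
  from Lp_AE_cong(2)[OF Lp_cond_exp(1)[OF p G Lp_diff[OF p f g]] _ this] Lp_cond_exp(2)[OF p G Lp_diff[OF p f g]]
  show ?thesis by simp
qed

lemma Lp_lim_cond_exp:
  assumes p: "1 \<le> p" and G: "subalgebra M G" and u: "\<And>n. u n \<in> Lp M p" and f: "f \<in> Lp M p"
    and lim: "Lp_lim M p u f"
  shows "Lp_lim M p (\<lambda>n. real_cond_exp M G (u n)) (real_cond_exp M G f)"
  using Lp_norm_cond_exp_diff[OF p G u f] lim unfolding Lp_lim_def[of M p u]
  by (rule Lp_limI_bound)

section \<open>Convergence of conditional expectations\<close>

text \<open>An \<epsilon>/3 argument: conditional expectations are contractions of L^1 uniformly in
  n, so the functions for which the convergence holds form a closed set. This reduces the upward
  theorem to a dense class.\<close>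

lemma cond_exp_upward_closed:
  assumes G: "\<And>n. subalgebra M (G n)"
    and s: "\<And>k. s k \<in> Lp M 1" and f: "f \<in> Lp M 1" and lim: "Lp_lim M 1 s f"
    and conv: "\<And>k. Lp_lim M 1 (\<lambda>n. real_cond_exp M (G n) (s k)) (s k)"
  shows "Lp_lim M 1 (\<lambda>n. real_cond_exp M (G n) f) f"
  unfolding Lp_lim_def
proof (rule LIMSEQ_I)
  fix e :: real assume "e > 0"
  then have e: "e / 3 > 0" by simp
  obtain k where k: "Lp_norm M 1 (\<lambda>x. s k x - f x) < e / 3"
    using LIMSEQ_D[OF lim[unfolded Lp_lim_def] e] Lp_norm_nonneg[of M 1] by auto
  obtain N where N: "\<And>n. n \<ge> N \<Longrightarrow> Lp_norm M 1 (\<lambda>x. real_cond_exp M (G n) (s k) x - s k x) < e / 3"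
    using LIMSEQ_D[OF conv[of k, unfolded Lp_lim_def] e] Lp_norm_nonneg[of M 1] by auto
  have "norm (Lp_norm M 1 (\<lambda>x. real_cond_exp M (G n) f x - f x) - 0) < e" if "n \<ge> N" for n
  proof -
    have L: "real_cond_exp M (G n) f \<in> Lp M 1" "real_cond_exp M (G n) (s k) \<in> Lp M 1"
      using Lp_cond_exp(1)[OF _ G] f s by auto
    have "Lp_norm M 1 (\<lambda>x. real_cond_exp M (G n) f x - f x) \<le>
        Lp_norm M 1 (\<lambda>x. real_cond_exp M (G n) f x - real_cond_exp M (G n) (s k) x)
        + Lp_norm M 1 (\<lambda>x. real_cond_exp M (G n) (s k) x - f x)"
      using Lp_norm_triangle[OF _ L f] by simp
    also have "Lp_norm M 1 (\<lambda>x. real_cond_exp M (G n) (s k) x - f x) \<le>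
        Lp_norm M 1 (\<lambda>x. real_cond_exp M (G n) (s k) x - s k x) + Lp_norm M 1 (\<lambda>x. s k x - f x)"
      using Lp_norm_triangle[OF _ L(2) s f] by simp
    also have "Lp_norm M 1 (\<lambda>x. real_cond_exp M (G n) f x - real_cond_exp M (G n) (s k) x) \<le> Lp_norm M 1 (\<lambda>x. f x - s k x)"
      using Lp_norm_cond_exp_diff[OF _ G f s] by simp
    finally show ?thesis
      using k N[OF that] Lp_norm_minus_commute[of M 1 f "s k"] Lp_norm_nonneg[of M 1] by simp
  qed
  then show "\<exists>no. \<forall>n\<ge>no. norm (Lp_norm M 1 (\<lambda>x. real_cond_exp M (G n) f x - f x) - 0) < e" by blast
qed

lemma cond_exp_lim_cmult:
  assumes G: "\<And>n. subalgebra M (G n)" and f: "f \<in> Lp M 1"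
    and conv: "Lp_lim M 1 (\<lambda>n. real_cond_exp M (G n) f) f"
  shows "Lp_lim M 1 (\<lambda>n. real_cond_exp M (G n) (\<lambda>x. c * f x)) (\<lambda>x. c * f x)"
proof (rule Lp_lim_AE_cong[OF _ _ _ _ _ _ Lp_lim_cmult[OF _ conv, of c]])
  show "AE x in M. c * real_cond_exp M (G n) f x = real_cond_exp M (G n) (\<lambda>x. c * f x) x" for n
  proof -
    interpret G: sigma_finite_subalgebra M "G n" using G by (rule subalgebra_sigma_finite)
    show ?thesis using AE_symmetric[OF G.real_cond_exp_cmult[of f c]] f by (simp add: Lp_1_iff)
  qed
qed (use LpD(1)[OF f] in auto)

lemma cond_exp_lim_add:
  assumes G: "\<And>n. subalgebra M (G n)" and f: "f \<in> Lp M 1" and g: "g \<in> Lp M 1"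
    and conv: "Lp_lim M 1 (\<lambda>n. real_cond_exp M (G n) f) f" "Lp_lim M 1 (\<lambda>n. real_cond_exp M (G n) g) g"
  shows "Lp_lim M 1 (\<lambda>n. real_cond_exp M (G n) (\<lambda>x. f x + g x)) (\<lambda>x. f x + g x)"
proof (rule Lp_lim_AE_cong[OF _ _ _ _ _ _ Lp_lim_add[OF _ _ f _ g conv]])
  show "AE x in M. real_cond_exp M (G n) f x + real_cond_exp M (G n) g x = real_cond_exp M (G n) (\<lambda>x. f x + g x) x" for n
  proof -
    interpret G: sigma_finite_subalgebra M "G n" using G by (rule subalgebra_sigma_finite)
    show ?thesis using AE_symmetric[OF G.real_cond_exp_add[of f g]] f g by (simp add: Lp_1_iff)
  qed
qed (use LpD(1)[OF f] LpD(1)[OF g] Lp_cond_exp(1)[OF _ G f] Lp_cond_exp(1)[OF _ G g] in auto)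

lemma cond_exp_lim_sum:
  assumes G: "\<And>n. subalgebra M (G n)" and f: "\<And>i. i \<in> I \<Longrightarrow> f i \<in> Lp M 1"
    and conv: "\<And>i. i \<in> I \<Longrightarrow> Lp_lim M 1 (\<lambda>n. real_cond_exp M (G n) (f i)) (f i)" and I: "finite I"
  shows "Lp_lim M 1 (\<lambda>n. real_cond_exp M (G n) (\<lambda>x. \<Sum>i\<in>I. f i x)) (\<lambda>x. \<Sum>i\<in>I. f i x)"
  using I f conv
proof (induction I)
  case empty
  show ?case
  proof -
    have "Lp_norm M 1 (\<lambda>x. real_cond_exp M (G n) (\<lambda>_. 0) x - 0) = 0" for n
      using Lp_cond_exp(2)[OF _ G Lp_zero, of 1 n] Lp_norm_nonneg[of M 1 "real_cond_exp M (G n) (\<lambda>_. 0)"] by simp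
    then show ?thesis by (simp add: Lp_lim_def)
  qed
next
  case (insert i I)
  have "Lp_lim M 1 (\<lambda>n. real_cond_exp M (G n) (\<lambda>x. f i x + (\<Sum>i\<in>I. f i x))) (\<lambda>x. f i x + (\<Sum>i\<in>I. f i x))"
    by (intro cond_exp_lim_add G Lp_sum insert) auto
  then show ?case using insert by simp
qed

text \<open>Dynkin's theorem for the union of the \<open>G n\<close>, which is closed under
  intersection because the sequence increases. On a set of some \<open>G m\<close> the sequence is
  eventually constant; complements follow by linearity and disjoint unions by closedness in
  L^1.\<close>

lemma cond_exp_lim_indicator:
  assumes G: "\<And>n. subalgebra M (G n)" and mono: "\<And>m n. m \<le> n \<Longrightarrow> sets (G m) \<subseteq> sets (G n)"
    and A: "A \<in> sigma_sets (space M) (\<Union>n. sets (G n))"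
  shows "Lp_lim M 1 (\<lambda>n. real_cond_exp M (G n) (indicator A)) (indicator A :: 'a \<Rightarrow> real)"
proof -
  have GM: "sets (G n) \<subseteq> sets M" "space (G n) = space M" for n
    using G[of n] by (auto simp: subalgebra_def)
  have HM: "sigma_sets (space M) (\<Union>n. sets (G n)) \<subseteq> sets M"
    using GM by (intro sets.sigma_sets_subset) auto
  have ind: "(indicator B :: 'a \<Rightarrow> real) \<in> Lp M 1" if "B \<in> sets M" for B
    using that by (simp add: Lp_1_iff emeasure_eq_measure)
  have basic: "Lp_lim M 1 (\<lambda>n. real_cond_exp M (G n) (indicator B)) (indicator B :: 'a \<Rightarrow> real)"
    if B: "B \<in> sets (G m)" for B m
    unfolding Lp_lim_def
  proof (rule tendsto_eventually, rule eventually_sequentiallyI)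
    fix n assume "m \<le> n"
    interpret G: sigma_finite_subalgebra M "G n" using G by (rule subalgebra_sigma_finite)
    have Bn: "B \<in> sets (G n)" "B \<in> sets M" using mono[OF \<open>m \<le> n\<close>] B GM by auto
    then have "AE x in M. real_cond_exp M (G n) (indicator B) x = (indicator B x :: real)"
      using ind[of B] by (intro G.real_cond_exp_F_meas) (auto simp: Lp_1_iff)
    then show "Lp_norm M 1 (\<lambda>x. real_cond_exp M (G n) (indicator B) x - indicator B x) = 0"
      using Bn by (intro Lp_AE_0(2)) auto
  qed
  show ?thesis
  proof (rule sigma_sets_induct_disjoint[OF _ _ A])
    show "Int_stable (\<Union>n. sets (G n))"
    proof (rule Int_stableI)
      fix a b assume "a \<in> (\<Union>n. sets (G n))" "b \<in> (\<Union>n. sets (G n))"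
      then obtain m n where mn: "a \<in> sets (G m)" "b \<in> sets (G n)" by auto
      then have "a \<in> sets (G (max m n))" "b \<in> sets (G (max m n))"
        using mono[of m "max m n"] mono[of n "max m n"] by auto
      then show "a \<inter> b \<in> (\<Union>n. sets (G n))" by blast
    qed
    show "(\<Union>n. sets (G n)) \<subseteq> Pow (space M)" using GM sets.sets_into_space by fastforce
    fix B assume "B \<in> (\<Union>n. sets (G n))"
    then show "Lp_lim M 1 (\<lambda>n. real_cond_exp M (G n) (indicator B)) (indicator B :: 'a \<Rightarrow> real)"
      using basic by auto
  next
    show "Lp_lim M 1 (\<lambda>n. real_cond_exp M (G n) (indicator {})) (indicator {} :: 'a \<Rightarrow> real)"
      using basic[of "{}" 0] by simp
  next
    fix B assume B: "B \<in> sigma_sets (space M) (\<Union>n. sets (G n))"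
      and IH: "Lp_lim M 1 (\<lambda>n. real_cond_exp M (G n) (indicator B)) (indicator B :: 'a \<Rightarrow> real)"
    have BM: "B \<in> sets M" using B HM by blast
    have sp: "Lp_lim M 1 (\<lambda>n. real_cond_exp M (G n) (indicator (space M))) (indicator (space M) :: 'a \<Rightarrow> real)"
      using basic[of "space M" 0] GM(2)[of 0] sets.top[of "G 0"] by simp
    have eq: "AE x in M. indicator (space M) x + (-1) * indicator B x = (indicator (space M - B) x :: real)"
      using sets.sets_into_space[OF BM] by (auto simp: indicator_def)
    have "Lp_lim M 1 (\<lambda>n. real_cond_exp M (G n) (\<lambda>x. indicator (space M) x + (-1) * indicator B x))
        (\<lambda>x. indicator (space M) x + (-1) * indicator B x :: real)"
      by (intro cond_exp_lim_add cond_exp_lim_cmult G Lp_cmult ind BM sp IH) auto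
    then show "Lp_lim M 1 (\<lambda>n. real_cond_exp M (G n) (indicator (space M - B))) (indicator (space M - B) :: 'a \<Rightarrow> real)"
    proof (rule Lp_lim_AE_cong[rotated -1])
      fix n
      interpret G: sigma_finite_subalgebra M "G n" using G by (rule subalgebra_sigma_finite)
      show "AE x in M. real_cond_exp M (G n) (\<lambda>x. indicator (space M) x + (-1) * indicator B x) x
          = real_cond_exp M (G n) (indicator (space M - B)) x"
        using eq BM by (intro G.real_cond_exp_cong) auto
    qed (use eq BM in auto)
  next
    fix B :: "nat \<Rightarrow> 'a set"
    assume dis: "disjoint_family B" and B: "range B \<subseteq> sigma_sets (space M) (\<Union>n. sets (G n))"
      and IH: "\<And>i. Lp_lim M 1 (\<lambda>n. real_cond_exp M (G n) (indicator (B i))) (indicator (B i) :: 'a \<Rightarrow> real)"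
    have BM: "B i \<in> sets M" for i using B HM by blast
    have [measurable]: "\<And>i. B i \<in> sets M" "(\<Union>i. B i) \<in> sets M" using BM by auto
    show "Lp_lim M 1 (\<lambda>n. real_cond_exp M (G n) (indicator (\<Union>i. B i))) (indicator (\<Union>i. B i) :: 'a \<Rightarrow> real)"
    proof (rule cond_exp_upward_closed[where s = "\<lambda>k x. \<Sum>i<k. indicator (B i) x", OF G])
      have le: "(\<Sum>i<k. indicator (B i) x) = (indicator (\<Union>i<k. B i) x :: real)" for k x
        using dis by (intro indicator_UN_disjoint[symmetric]) (auto simp: disjoint_family_on_def)
      have "(\<lambda>k. \<integral>x. \<bar>(\<Sum>i<k. indicator (B i) x) - indicator (\<Union>i. B i) x\<bar> \<partial>M) \<longlonglongrightarrow> (\<integral>x. (0::real) \<partial>M)"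
      proof (rule integral_dominated_convergence[where w = "\<lambda>_. 2"])
        show "AE x in M. (\<lambda>k. \<bar>(\<Sum>i<k. indicator (B i) x) - indicator (\<Union>i. B i) x\<bar>) \<longlonglongrightarrow> (0::real)"
          unfolding le by (intro AE_I2 tendsto_rabs_zero LIM_zero LIMSEQ_indicator_UN)
        show "AE x in M. norm (\<bar>(\<Sum>i<k. indicator (B i) x) - indicator (\<Union>i. B i) x\<bar> :: real) \<le> 2" for k
          unfolding le by (auto simp: indicator_def)
      qed auto
      then show "Lp_lim M 1 (\<lambda>k x. \<Sum>i<k. indicator (B i) x) (indicator (\<Union>i. B i) :: 'a \<Rightarrow> real)"
        by (simp add: Lp_lim_def Lp_norm_1)
      show "Lp_lim M 1 (\<lambda>n. real_cond_exp M (G n) (\<lambda>x. \<Sum>i<k. indicator (B i) x)) (\<lambda>x. \<Sum>i<k. indicator (B i) x :: real)" for k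
        by (intro cond_exp_lim_sum G IH ind BM) auto
      show "(\<lambda>x. \<Sum>i<k. indicator (B i) x :: real) \<in> Lp M 1" for k
        by (intro Lp_sum ind BM) auto
      show "(indicator (\<Union>i. B i) :: 'a \<Rightarrow> real) \<in> Lp M 1" by (intro ind) auto
    qed
  qed
qed

text \<open>Levy's upward theorem in L^1. For functions integrable over the restriction of the
  measure to \<open>H\<close> it follows from indicators by linearity and closedness; the tower
  property then allows f to be replaced by its conditional expectation given
  \<open>H\<close>.\<close>

lemma cond_exp_upward:
  assumes G: "\<And>n. subalgebra M (G n)" and mono: "\<And>m n. m \<le> n \<Longrightarrow> sets (G m) \<subseteq> sets (G n)"
    and H: "sets H = sigma_sets (space M) (\<Union>n. sets (G n))" "space H = space M"
    and f: "f \<in> Lp M 1"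
  shows "Lp_lim M 1 (\<lambda>n. real_cond_exp M (G n) f) (real_cond_exp M H f)"
proof -
  have GM: "sets (G n) \<subseteq> sets M" "space (G n) = space M" for n
    using G[of n] by (auto simp: subalgebra_def)
  have HM: "subalgebra M H"
    unfolding subalgebra_def H using GM by (auto intro!: sets.sigma_sets_subset)
  interpret H: sigma_finite_subalgebra M H using HM by (rule subalgebra_sigma_finite)
  have fi: "integrable M f" using f by (simp add: Lp_1_iff)
  let ?R = "restr_to_subalg M H"
  have conv: "h \<in> Lp M 1 \<and> Lp_lim M 1 (\<lambda>n. real_cond_exp M (G n) h) h" if "integrable ?R h" for h
    using that
  proof (induction h rule: integrable_induct)
    case (base A c)
    then have A: "A \<in> sets H" using sets_restr_to_subalg[OF HM] by simp
    then have AM: "A \<in> sets M" using HM by (auto simp: subalgebra_def)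
    have i: "(indicator A :: 'a \<Rightarrow> real) \<in> Lp M 1"
      using AM by (simp add: Lp_1_iff emeasure_eq_measure)
    have "Lp_lim M 1 (\<lambda>n. real_cond_exp M (G n) (\<lambda>x. c * indicator A x)) (\<lambda>x. c * indicator A x)"
      using A H(1) by (intro cond_exp_lim_cmult G i cond_exp_lim_indicator mono) auto
    then show ?case using Lp_cmult[OF i, of c] by (simp add: mult.commute)
  next
    case (add h g)
    then show ?case by (auto intro: Lp_add cond_exp_lim_add G)
  next
    case (lim h s)
    have hi: "integrable M h" using integrable_from_subalg[OF HM lim.hyps(4)] by simp
    have si: "integrable M (s k)" for k using lim.IH by (simp add: Lp_1_iff)
    have sm: "s k \<in> borel_measurable M" "h \<in> borel_measurable M" for k using si hi by auto
    have sp: "space ?R = space M" by (simp add: space_restr_to_subalg)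
    have "(\<lambda>k. \<integral>x. \<bar>s k x - h x\<bar> \<partial>M) \<longlonglongrightarrow> (\<integral>x. (0::real) \<partial>M)"
    proof (rule integral_dominated_convergence[where w = "\<lambda>x. 3 * \<bar>h x\<bar>"])
      show "AE x in M. (\<lambda>k. \<bar>s k x - h x\<bar>) \<longlonglongrightarrow> 0"
        using lim.hyps(2) sp by (intro AE_I2 tendsto_rabs_zero LIM_zero) auto
      show "AE x in M. norm \<bar>s k x - h x\<bar> \<le> 3 * \<bar>h x\<bar>" for k
      proof (rule AE_I2)
        fix x assume "x \<in> space M"
        then have "\<bar>s k x\<bar> \<le> 2 * \<bar>h x\<bar>" using lim.hyps(3) sp by simp
        then show "norm \<bar>s k x - h x\<bar> \<le> 3 * \<bar>h x\<bar>" by simp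
      qed
    qed (use sm hi in auto)
    then have "Lp_lim M 1 s h" by (simp add: Lp_lim_def Lp_norm_1)
    moreover have "h \<in> Lp M 1" using hi by (simp add: Lp_1_iff)
    ultimately show ?case using cond_exp_upward_closed[where G = G and s = s and f = h] G lim.IH by blast
  qed
  have "integrable ?R (real_cond_exp M H f)"
    using H.real_cond_exp_int(1)[OF fi] by (intro integrable_in_subalg[OF HM]) auto
  then have c: "Lp_lim M 1 (\<lambda>n. real_cond_exp M (G n) (real_cond_exp M H f)) (real_cond_exp M H f)"
    using conv by blast
  show ?thesis
  proof (rule Lp_lim_AE_cong[OF _ _ _ _ _ _ c])
    fix n
    have GH: "subalgebra H (G n)"
      unfolding subalgebra_def H using GM by (auto intro: sigma_sets.Basic)
    interpret G: sigma_finite_subalgebra M "G n" using G by (rule subalgebra_sigma_finite)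
    show "AE x in M. real_cond_exp M (G n) (real_cond_exp M H f) x = real_cond_exp M (G n) f x"
      using G.real_cond_exp_nested_subalg[OF HM GH fi] .
  qed auto
qed

end

section \<open>Decreasing sequences of sigma-algebras\<close>

lemma measurable_lim_decreasing:
  fixes u :: "nat \<Rightarrow> 'a \<Rightarrow> real"
  assumes sub: "\<And>n. space (G n) = \<Omega>" and dec: "\<And>m n. m \<le> n \<Longrightarrow> sets (G n) \<subseteq> sets (G m)"
    and H: "sets H = (\<Inter>n. sets (G n))" "space H = \<Omega>"
    and u: "\<And>n. u n \<in> borel_measurable (G n)"
  shows "(\<lambda>x. lim (\<lambda>n. u n x)) \<in> borel_measurable H"
proof (rule measurableI)
  fix A :: "real set" assume A: "A \<in> sets borel"
  have "(\<lambda>x. lim (\<lambda>n. u n x)) -` A \<inter> \<Omega> \<in> sets (G m)" for m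
  proof -
    \<comment> \<open>Dropping the first m terms changes neither convergence nor the value of
      \<open>lim\<close>, also at points of divergence, and from index m on all terms are measurable
      for \<open>G m\<close>.\<close>
    have "((\<lambda>n. u (n + m) x) \<longlonglongrightarrow> L) = ((\<lambda>n. u n x) \<longlonglongrightarrow> L)" for x L
      by (rule iffI, erule LIMSEQ_offset, erule LIMSEQ_ignore_initial_segment)
    then have "lim (\<lambda>n. u (n + m) x) = lim (\<lambda>n. u n x)" for x
      by (simp add: lim_def)
    moreover have "u (n + m) \<in> borel_measurable (G m)" for n
      using u[of "n + m"] dec[of m "n + m"] sub
      by (intro measurable_mono[THEN subsetD, of borel borel "G (n + m)" "G m"]) auto
    then have "(\<lambda>x. lim (\<lambda>n. u (n + m) x)) \<in> borel_measurable (G m)" by measurable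
    ultimately have "(\<lambda>x. lim (\<lambda>n. u n x)) \<in> borel_measurable (G m)" by simp
    from measurable_sets[OF this A] show ?thesis using sub by simp
  qed
  then show "(\<lambda>x. lim (\<lambda>n. u n x)) -` A \<inter> space H \<in> sets H" using H by simp
qed simp

context prob_space
begin

text \<open>Pythagoras: the conditional expectation given the smaller \<open>H\<close> is the
  orthogonal projection of the one given \<open>G\<close>, so the mixed integral equals the integral
  of its square.\<close>

lemma cond_exp_decreasing_L2_dist:
  assumes G: "subalgebra M G" and H: "subalgebra M H" and GH: "sets H \<subseteq> sets G" and f: "f \<in> Lp M 2"
  shows "(Lp_norm M 2 (\<lambda>x. real_cond_exp M G f x - real_cond_exp M H f x))\<^sup>2
     = (Lp_norm M 2 (real_cond_exp M G f))\<^sup>2 - (Lp_norm M 2 (real_cond_exp M H f))\<^sup>2"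
proof -
  interpret G: sigma_finite_subalgebra M G using G by (rule subalgebra_sigma_finite)
  interpret H: sigma_finite_subalgebra M H using H by (rule subalgebra_sigma_finite)
  have fi: "integrable M f" using Lp_norm_1_le(1)[OF _ f] by simp
  define a where "a = real_cond_exp M G f"
  define b where "b = real_cond_exp M H f"
  have [measurable]: "a \<in> borel_measurable M" "b \<in> borel_measurable M" by (auto simp: a_def b_def)
  have ab: "a \<in> Lp M 2" "b \<in> Lp M 2"
    using Lp_cond_exp(1)[OF _ G f] Lp_cond_exp(1)[OF _ H f] by (auto simp: a_def b_def)
  have sq: "integrable M (\<lambda>x. (a x)\<^sup>2)" "integrable M (\<lambda>x. (b x)\<^sup>2)"
    using LpD(2)[OF ab(1)] LpD(2)[OF ab(2)] by auto
  have bai: "integrable M (\<lambda>x. b x * a x)"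
  proof (rule Bochner_Integration.integrable_bound)
    show "integrable M (\<lambda>x. (a x)\<^sup>2 + (b x)\<^sup>2)" using sq by simp
    have "\<bar>b x * a x\<bar> \<le> (a x)\<^sup>2 + (b x)\<^sup>2" for x
    proof -
      have "\<bar>b x * a x\<bar> \<le> 2 * \<bar>a x\<bar> * \<bar>b x\<bar>" by (simp add: abs_mult)
      also have "\<dots> \<le> (a x)\<^sup>2 + (b x)\<^sup>2" using sum_squares_bound[of "\<bar>a x\<bar>" "\<bar>b x\<bar>"] by simp
      finally show ?thesis .
    qed
    then show "AE x in M. norm (b x * a x) \<le> norm ((a x)\<^sup>2 + (b x)\<^sup>2)" by simp
  qed simp
  have HG: "subalgebra G H" using G H GH by (auto simp: subalgebra_def)
  have nest: "AE x in M. real_cond_exp M H a x = b x"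
    unfolding a_def b_def using H.real_cond_exp_nested_subalg[OF G HG fi] .
  have "(\<integral>x. b x * a x \<partial>M) = (\<integral>x. b x * real_cond_exp M H a x \<partial>M)"
    using H.real_cond_exp_intg(2)[OF bai] by (simp add: b_def)
  also have "\<dots> = (\<integral>x. (b x)\<^sup>2 \<partial>M)"
    using nest by (intro integral_cong_AE) (auto simp: power2_eq_square)
  finally have ba: "(\<integral>x. b x * a x \<partial>M) = (\<integral>x. (b x)\<^sup>2 \<partial>M)" .
  have "(\<integral>x. (a x - b x)\<^sup>2 \<partial>M) = (\<integral>x. (a x)\<^sup>2 + (b x)\<^sup>2 - 2 * (b x * a x) \<partial>M)"
    by (simp add: power2_diff mult.commute mult.left_commute)
  also have "\<dots> = (\<integral>x. (a x)\<^sup>2 \<partial>M) + (\<integral>x. (b x)\<^sup>2 \<partial>M) - 2 * (\<integral>x. b x * a x \<partial>M)"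
    using sq bai by simp
  finally show ?thesis unfolding Lp_norm_2_power2 ba a_def[symmetric] b_def[symmetric] by simp
qed

text \<open>The squared L^2 norms decrease and their differences are squared distances, so the
  sequence is Cauchy in L^2. Its limit is fixed by every conditional expectation given
  \<open>G m\<close>, hence has a version measurable for \<open>H\<close>; its conditional
  expectation given \<open>H\<close> is 0, so it vanishes.\<close>

lemma cond_exp_downward_zero:
  assumes G: "\<And>n. subalgebra M (G n)" and dec: "\<And>m n. m \<le> n \<Longrightarrow> sets (G n) \<subseteq> sets (G m)"
    and H: "sets H = (\<Inter>n. sets (G n))" "space H = space M"
    and f: "f \<in> Lp M 2" and zero: "AE x in M. real_cond_exp M H f x = 0"
  shows "Lp_lim M 1 (\<lambda>n. real_cond_exp M (G n) f) (\<lambda>_. 0)"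
proof -
  have GM: "sets (G n) \<subseteq> sets M" "space (G n) = space M" for n
    using G[of n] by (auto simp: subalgebra_def)
  have HM: "subalgebra M H" unfolding subalgebra_def H using GM(1)[of 0] by auto
  interpret H: sigma_finite_subalgebra M H using HM by (rule subalgebra_sigma_finite)
  have fi: "integrable M f" using Lp_norm_1_le(1)[OF _ f] by simp
  let ?u = "\<lambda>n. real_cond_exp M (G n) f"
  have u: "?u n \<in> Lp M 2" for n using Lp_cond_exp(1)[OF _ G f] by simp
  define a where "a n = (Lp_norm M 2 (?u n))\<^sup>2" for n
  have dist: "(Lp_norm M 2 (\<lambda>x. ?u m x - ?u n x))\<^sup>2 = a m - a n" if "m \<le> n" for m n
    unfolding a_def by (rule cond_exp_decreasing_L2_dist[OF G G dec[OF that] f])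
  have "decseq a"
    unfolding decseq_def
  proof (intro allI impI)
    fix m n :: nat assume "m \<le> n"
    from dist[OF this] show "a n \<le> a m"
      using zero_le_power2[of "Lp_norm M 2 (\<lambda>x. ?u m x - ?u n x)"] by linarith
  qed
  then obtain L where "a \<longlonglongrightarrow> L" using decseq_convergent[of a 0] by (auto simp: a_def)
  then have cauchy: "Cauchy a" by (rule LIMSEQ_imp_Cauchy)
  have "\<exists>N. \<forall>m\<ge>N. \<forall>n\<ge>N. Lp_norm M 2 (\<lambda>x. ?u m x - ?u n x) < e" if "e > 0" for e
  proof -
    have e2: "e\<^sup>2 > 0" using that by simp
    obtain N where N: "\<And>m n. m \<ge> N \<Longrightarrow> n \<ge> N \<Longrightarrow> norm (a m - a n) < e\<^sup>2"
      using CauchyD[OF cauchy e2] by blast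
    have le: "Lp_norm M 2 (\<lambda>x. ?u m x - ?u n x) < e" if "m \<ge> N" "n \<ge> N" "m \<le> n" for m n
      using N[OF that(1,2)] dist[OF that(3)] \<open>e > 0\<close>
      by (intro power2_less_imp_less[of _ e]) auto
    have "Lp_norm M 2 (\<lambda>x. ?u m x - ?u n x) < e" if "m \<ge> N" "n \<ge> N" for m n
      using le[OF that] le[OF that(2,1)] Lp_norm_minus_commute[of M 2 "?u m" "?u n"] by linarith
    then show ?thesis by blast
  qed
  from Lp_complete[OF _ u this] obtain v where v: "v \<in> Lp M 2" "Lp_lim M 2 ?u v"
    unfolding Lp_lim_def by auto
  have v1: "v \<in> Lp M 1" and u1: "?u n \<in> Lp M 1" for n
    using Lp_norm_1_le(1)[OF _ v(1)] Lp_norm_1_le(1)[OF _ u] by (auto simp: Lp_1_iff)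
  have lim1: "Lp_lim M 1 ?u v" by (rule Lp_lim_imp_Lp_lim_1[OF _ u v]) simp
  have vG: "AE x in M. real_cond_exp M (G m) v x = v x" for m
  proof -
    interpret Gm: sigma_finite_subalgebra M "G m" using G by (rule subalgebra_sigma_finite)
    have s: "Lp_lim M 1 (\<lambda>n. ?u (n + m)) v"
      using LIMSEQ_ignore_initial_segment[OF lim1[unfolded Lp_lim_def]] by (simp add: Lp_lim_def)
    have "Lp_lim M 1 (\<lambda>n. real_cond_exp M (G m) (?u (n + m))) (real_cond_exp M (G m) v)"
      by (rule Lp_lim_cond_exp[OF _ G u1 v1 s]) simp
    moreover have "AE x in M. real_cond_exp M (G m) (?u (n + m)) x = ?u (n + m) x" for n
      using dec[of m "n + m"] GM u1[of "n + m"]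
      by (intro Gm.real_cond_exp_F_meas measurable_from_subalg[of "G m" "G (n + m)"])
         (auto simp: Lp_1_iff subalgebra_def)
    ultimately have "Lp_lim M 1 (\<lambda>n. ?u (n + m)) (real_cond_exp M (G m) v)"
      by (intro Lp_lim_AE_cong[of "\<lambda>n. real_cond_exp M (G m) (?u (n + m))" M "\<lambda>n. ?u (n + m)"
            "real_cond_exp M (G m) v" "real_cond_exp M (G m) v"]) auto
    from Lp_lim_unique[OF _ u1 _ v1 this s] show ?thesis using Lp_cond_exp(1)[OF _ G v1] by simp
  qed
  \<comment> \<open>For each n there is a version of v measurable for \<open>G n\<close>, but these
    versions differ on null sets. Their pointwise \<open>lim\<close> is a single version measurable
    for the intersection.\<close>
  define w where "w x = lim (\<lambda>n. real_cond_exp M (G n) v x)" for x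
  have wH: "w \<in> borel_measurable H"
    unfolding w_def by (rule measurable_lim_decreasing[OF GM(2) dec H]) auto
  have wM: "w \<in> borel_measurable M" using measurable_from_subalg[OF HM wH] .
  have "AE x in M. \<forall>n. real_cond_exp M (G n) v x = v x" using vG by (simp add: AE_all_countable)
  then have wv: "AE x in M. v x = w x" by eventually_elim (simp add: w_def)
  have wi: "integrable M w" using Lp_AE_cong(1)[OF v1 wM wv] by (simp add: Lp_1_iff)
  have "AE x in M. real_cond_exp M H v x = 0"
  proof -
    have "Lp_lim M 1 (\<lambda>n. real_cond_exp M H (?u n)) (real_cond_exp M H v)"
      by (rule Lp_lim_cond_exp[OF _ HM u1 v1 lim1]) simp
    moreover have "AE x in M. real_cond_exp M H (?u n) x = 0" for n
    proof -
      have "AE x in M. real_cond_exp M H (?u n) x = real_cond_exp M H f x"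
        using GM H by (intro H.real_cond_exp_nested_subalg[OF G _ fi]) (auto simp: subalgebra_def)
      then show ?thesis using zero by eventually_elim simp
    qed
    ultimately have "Lp_lim M 1 (\<lambda>n. (\<lambda>_. 0)) (real_cond_exp M H v)"
      by (intro Lp_lim_AE_cong[of "\<lambda>n. real_cond_exp M H (?u n)" M "\<lambda>n. (\<lambda>_. 0)"
            "real_cond_exp M H v" "real_cond_exp M H v"]) auto
    from Lp_lim_unique[OF _ _ _ _ this Lp_lim_const] show ?thesis
      using Lp_cond_exp(1)[OF _ HM v1] by simp
  qed
  moreover have "AE x in M. real_cond_exp M H v x = real_cond_exp M H w x"
    using wv wM LpD(1)[OF v1] by (intro H.real_cond_exp_cong) auto
  moreover have "AE x in M. real_cond_exp M H w x = w x" using wi wH by (rule H.real_cond_exp_F_meas)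
  ultimately have "AE x in M. v x = 0" using wv by eventually_elim simp
  then show ?thesis
    using lim1 LpD(1)[OF v1] by (intro Lp_lim_AE_cong[of ?u M ?u v "\<lambda>_. 0" 1]) auto
qed

section \<open>Commuting conditional expectations\<close>

definition cond_exp_commute :: "'a measure \<Rightarrow> 'a measure \<Rightarrow> bool" where
  "cond_exp_commute G H \<longleftrightarrow> (\<forall>f\<in>Lp M 1. AE x in M.
     real_cond_exp M G (real_cond_exp M H f) x = real_cond_exp M H (real_cond_exp M G f) x)"

lemma cond_exp_commute_sym: "cond_exp_commute G H \<Longrightarrow> cond_exp_commute H G"
  unfolding cond_exp_commute_def by (intro ballI, rule AE_symmetric) simp

text \<open>For each n the two orders of conditioning on \<open>G n\<close> and \<open>H\<close>
  agree. In one order the limit comes from the upward theorem applied to the conditional expectation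
  given \<open>H\<close>, in the other from the upward theorem for f and continuity of conditioning
  on \<open>H\<close>; L^1 limits are unique.\<close>

lemma cond_exp_commute_upward:
  fixes G :: "nat \<Rightarrow> 'a measure"
  assumes G: "\<And>n. subalgebra M (G n)" and mono: "\<And>m n. m \<le> n \<Longrightarrow> sets (G m) \<subseteq> sets (G n)"
    and G': "sets G' = sigma_sets (space M) (\<Union>n. sets (G n))" "space G' = space M"
    and H: "subalgebra M H" and comm: "\<And>n. cond_exp_commute (G n) H"
  shows "cond_exp_commute G' H"
  unfolding cond_exp_commute_def
proof
  fix f assume f: "f \<in> Lp M 1"
  have GM: "sets (G n) \<subseteq> sets M" "space (G n) = space M" for n
    using G[of n] by (auto simp: subalgebra_def)
  have G'M: "subalgebra M G'"
    unfolding subalgebra_def G' using GM by (auto intro!: sets.sigma_sets_subset)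
  have ce: "real_cond_exp M K g \<in> Lp M 1" if "subalgebra M K" "g \<in> Lp M 1" for K g
    using Lp_cond_exp(1)[OF _ that] by simp
  have 1: "Lp_lim M 1 (\<lambda>n. real_cond_exp M (G n) (real_cond_exp M H f)) (real_cond_exp M G' (real_cond_exp M H f))"
    by (rule cond_exp_upward[OF G mono G' ce[OF H f]])
  have lim: "Lp_lim M 1 (\<lambda>n. real_cond_exp M H (real_cond_exp M (G n) f)) (real_cond_exp M H (real_cond_exp M G' f))"
    by (rule Lp_lim_cond_exp[OF _ H ce[OF G f] ce[OF G'M f] cond_exp_upward[OF G mono G' f]]) auto
  have ae: "AE x in M. real_cond_exp M H (real_cond_exp M (G n) f) x = real_cond_exp M (G n) (real_cond_exp M H f) x" for n
    by (rule AE_symmetric) (use comm[of n] f in \<open>simp add: cond_exp_commute_def\<close>)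
  have 2: "Lp_lim M 1 (\<lambda>n. real_cond_exp M (G n) (real_cond_exp M H f)) (real_cond_exp M H (real_cond_exp M G' f))"
    by (rule Lp_lim_AE_cong[OF _ _ _ _ ae _ lim]) simp_all
  show "AE x in M. real_cond_exp M G' (real_cond_exp M H f) x = real_cond_exp M H (real_cond_exp M G' f) x"
    by (rule Lp_lim_unique[OF _ ce[OF G ce[OF H f]] ce[OF G'M ce[OF H f]] ce[OF H ce[OF G'M f]] 1 2]) simp
qed

lemma cond_exp_sum_AE:
  assumes G: "subalgebra M G" and f: "\<And>i. i \<in> I \<Longrightarrow> f i \<in> Lp M 1"
  shows "AE x in M. real_cond_exp M G (\<lambda>x. \<Sum>i\<in>I. f i x) x = (\<Sum>i\<in>I. real_cond_exp M G (f i) x)"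
proof -
  interpret G: sigma_finite_subalgebra M G using G by (rule subalgebra_sigma_finite)
  \<comment> \<open>Padding by 0 outside \<open>I\<close> makes every member of the family
    integrable.\<close>
  have "AE x in M. real_cond_exp M G (\<lambda>x. \<Sum>i\<in>I. (if i \<in> I then f i else (\<lambda>_. 0)) x) x
      = (\<Sum>i\<in>I. real_cond_exp M G (if i \<in> I then f i else (\<lambda>_. 0)) x)"
    using f by (intro G.real_cond_exp_sum) (auto simp: Lp_1_iff)
  moreover have "(\<lambda>x. \<Sum>i\<in>I. (if i \<in> I then f i else (\<lambda>_. 0)) x) = (\<lambda>x. \<Sum>i\<in>I. f i x)"
    by (intro ext sum.cong) auto
  moreover have "(\<Sum>i\<in>I. real_cond_exp M G (if i \<in> I then f i else (\<lambda>_. 0)) x) = (\<Sum>i\<in>I. real_cond_exp M G (f i) x)" for x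
    by (intro sum.cong) auto
  ultimately show ?thesis by simp
qed

lemma Lp_imp_Lp_1: "1 \<le> p \<Longrightarrow> f \<in> Lp M p \<Longrightarrow> f \<in> Lp M 1"
  using Lp_norm_1_le(1) by (simp add: Lp_1_iff)

lemma cond_exp_diff_AE:
  assumes "subalgebra M G" "f \<in> Lp M 1" "g \<in> Lp M 1"
  shows "AE x in M. real_cond_exp M G (\<lambda>x. f x - g x) x = real_cond_exp M G f x - real_cond_exp M G g x"
proof -
  interpret G: sigma_finite_subalgebra M G using assms(1) by (rule subalgebra_sigma_finite)
  show ?thesis using assms by (intro G.real_cond_exp_diff) (auto simp: Lp_1_iff)
qed

lemma cond_exp_cmult_AE:
  assumes "subalgebra M G" "f \<in> Lp M 1"
  shows "AE x in M. real_cond_exp M G (\<lambda>x. c * f x) x = c * real_cond_exp M G f x"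
proof -
  interpret G: sigma_finite_subalgebra M G using assms(1) by (rule subalgebra_sigma_finite)
  show ?thesis using assms by (intro G.real_cond_exp_cmult) (auto simp: Lp_1_iff)
qed

lemma cond_exp_AE_cong:
  assumes "subalgebra M G" "f \<in> borel_measurable M" "g \<in> borel_measurable M" "AE x in M. f x = g x"
  shows "AE x in M. real_cond_exp M G f x = real_cond_exp M G g x"
proof -
  interpret G: sigma_finite_subalgebra M G using assms(1) by (rule subalgebra_sigma_finite)
  show ?thesis using assms by (intro G.real_cond_exp_cong)
qed

end

section \<open>Actions with a completely commuting filtration\<close>

text \<open>A set of \<open>G'\<close> is a preimage of some B in \<open>G\<close>, and by
  invariance the integral of h composed with t over it is the integral of h over B. Hence the
  composed conditional expectation has the defining property.\<close>

lemma (in prob_space) real_cond_exp_compose: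
  assumes t: "t \<in> M \<rightarrow>\<^sub>M M" "distr M M t = M" and G: "subalgebra M G"
    and G': "sets G' = {t -` A \<inter> space M |A. A \<in> sets G}" "space G' = space M" and f: "integrable M f"
  shows "AE x in M. real_cond_exp M G' (\<lambda>x. f (t x)) x = real_cond_exp M G f (t x)"
proof -
  have GM: "sets G \<subseteq> sets M" "space G = space M" using G by (auto simp: subalgebra_def)
  have G'M: "subalgebra M G'"
    unfolding subalgebra_def G' using GM measurable_sets[OF t(1)] by auto
  interpret G: sigma_finite_subalgebra M G using G by (rule subalgebra_sigma_finite)
  interpret G': sigma_finite_subalgebra M G' using G'M by (rule subalgebra_sigma_finite)
  have t': "t \<in> G' \<rightarrow>\<^sub>M G"
    using t(1) G' GM(2) by (auto intro!: measurableI simp: measurable_def Pi_iff)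
  have fi: "integrable M (\<lambda>x. h (t x))" and fI: "(\<integral>x. h (t x) \<partial>M) = (\<integral>x. h x \<partial>M)" if "integrable M h" for h :: "'a \<Rightarrow> real"
    using that integrable_distr_eq[OF t(1), of h] integral_distr[OF t(1), of h] t(2) by auto
  show ?thesis
  proof (rule G'.real_cond_exp_charact)
    fix A assume "A \<in> sets G'"
    then obtain B where B: "B \<in> sets G" "A = t -` B \<inter> space M" using G' by auto
    have BM: "B \<in> sets M" using B GM by auto
    have eq: "(\<integral>x\<in>A. h (t x) \<partial>M) = (\<integral>x\<in>B. h x \<partial>M)" if h: "integrable M h" for h :: "'a \<Rightarrow> real"
    proof -
      have "(\<integral>x\<in>A. h (t x) \<partial>M) = (\<integral>x. indicator B (t x) *\<^sub>R h (t x) \<partial>M)"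
        unfolding set_lebesgue_integral_def B(2) by (intro Bochner_Integration.integral_cong) (auto simp: indicator_def)
      also have "\<dots> = (\<integral>x\<in>B. h x \<partial>M)"
        unfolding set_lebesgue_integral_def by (intro fI integrable_mult_indicator BM h)
      finally show ?thesis .
    qed
    show "(\<integral>x\<in>A. f (t x) \<partial>M) = (\<integral>x\<in>A. real_cond_exp M G f (t x) \<partial>M)"
      using eq[OF f] eq[OF G.real_cond_exp_int(1)[OF f]] G.real_cond_exp_intA[OF f B(1)] by simp
  next
    show "integrable M (\<lambda>x. f (t x))" by (rule fi[OF f])
    show "integrable M (\<lambda>x. real_cond_exp M G f (t x))" by (rule fi[OF G.real_cond_exp_int(1)[OF f]])
    show "(\<lambda>x. real_cond_exp M G f (t x)) \<in> borel_measurable G'"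
      by (rule measurable_compose[OF t']) simp
  qed
qed

locale commuting_filtration = prob_space M
  for M :: "'a measure" and T :: "int ^ 'd::{finite,linorder} \<Rightarrow> 'a \<Rightarrow> 'a" and F :: "'a measure" +
  assumes action: "measure_preserving_action M T"
    and filtration: "completely_commuting_filtration M T F"
begin

lemma T_measurable [measurable]: "T i \<in> M \<rightarrow>\<^sub>M M"
  and T_distr: "distr M M (T i) = M"
  and T_0: "x \<in> space M \<Longrightarrow> T 0 x = x"
  and T_add: "x \<in> space M \<Longrightarrow> T (i + j) x = T i (T j x)"
  using action unfolding measure_preserving_action_def by auto

lemma T_space: "x \<in> space M \<Longrightarrow> T i x \<in> space M"
  using measurable_space[OF T_measurable] by blast

lemma T_image:
  assumes "A \<subseteq> space M"
  shows "T (- i) ` A = T i -` A \<inter> space M"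
proof safe
  fix x assume "x \<in> A"
  then have x: "x \<in> space M" using assms by auto
  show "T (- i) x \<in> space M" using T_space[OF x] .
  show "T (- i) x \<in> T i -` A" using T_add[OF x, of i "- i"] T_0[OF x] \<open>x \<in> A\<close> by simp
next
  fix x assume x: "x \<in> space M" and "T i x \<in> A"
  then show "x \<in> T (- i) ` A" using T_add[OF x, of "- i" i] T_0[OF x] by (intro image_eqI[of _ _ "T i x"]) auto
qed

abbreviation Fi :: "int ^ 'd::{finite,linorder} \<Rightarrow> 'a measure" where "Fi \<equiv> filt M T F"
abbreviation Fd :: "'d \<Rightarrow> int \<Rightarrow> 'a measure" where "Fd \<equiv> filt_dir M T F"
abbreviation Ed :: "'d \<Rightarrow> int \<Rightarrow> ('a \<Rightarrow> real) \<Rightarrow> 'a \<Rightarrow> real" where "Ed q l \<equiv> real_cond_exp M (Fd q l)"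

lemma F_subalgebra: "subalgebra M F"
  using filtration by (simp add: completely_commuting_filtration_def)

lemma space_Fi [simp]: "space (Fi i) = space M"
  by (simp add: filt_def space_measure_of_conv)

text \<open>Images under \<open>T (- i)\<close> are preimages under \<open>T i\<close>. In this form
  the generating family is already a sigma-algebra, and translation of the index becomes composition
  of maps.\<close>

lemma sets_Fi: "sets (Fi i) = {T i -` A \<inter> space M |A. A \<in> sets F}"
proof -
  have F: "space F = space M" "sets F \<subseteq> sets M" using F_subalgebra by (auto simp: subalgebra_def)
  have sub: "A \<subseteq> space M" if "A \<in> sets F" for A using that sets.sets_into_space[of A F] F by simp
  have "(\<lambda>A. T (- i) ` A) ` sets F = {T i -` A \<inter> space M |A. A \<in> sets F}"
    unfolding setcompr_eq_image using T_image sub by (intro image_cong) auto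
  then have "filt M T F i = sigma (space M) {T i -` A \<inter> space M |A. A \<in> sets F}"
    by (simp only: filt_def)
  then have "sets (Fi i) = sigma_sets (space M) {T i -` A \<inter> space M |A. A \<in> sets F}"
    by (simp only:) (rule sets_measure_of, auto)
  also have "\<dots> = {T i -` A \<inter> space M |A. A \<in> sigma_sets (space M) (sets F)}"
    by (rule sigma_sets_vimage_commute[symmetric]) (auto intro: T_space)
  also have "sigma_sets (space M) (sets F) = sets F" using sets.sigma_sets_eq[of F] F by simp
  finally show ?thesis .
qed

lemma Fi_subalgebra: "subalgebra M (Fi i)"
  using F_subalgebra measurable_sets[OF T_measurable] by (auto simp: subalgebra_def sets_Fi)

lemma Fi_mono: "i \<le> j \<Longrightarrow> sets (Fi i) \<subseteq> sets (Fi j)"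
  using filtration by (auto simp: completely_commuting_filtration_def)

lemma Fi_shift: "sets (Fi (i + j)) = {T j -` A \<inter> space M |A. A \<in> sets (Fi i)}"
proof -
  have "T (i + j) -` A \<inter> space M = T j -` (T i -` A \<inter> space M) \<inter> space M" for A
    using T_add T_space by auto
  note * = this
  show ?thesis
    unfolding sets_Fi * setcompr_eq_image by (simp add: image_image)
qed

lemma space_Fd [simp]: "space (Fd q l) = space M"
  by (simp add: filt_dir_def space_measure_of_conv)

lemma Fi_sets_space: "A \<in> sets (Fi i) \<Longrightarrow> A \<subseteq> space M"
  using sets.sets_into_space[of A "Fi i"] by simp

lemma sets_Fd: "sets (Fd q l) = sigma_sets (space M) (\<Union>i\<in>{i. i $ q \<le> l}. sets (Fi i))"
  unfolding filt_dir_def using Fi_sets_space by (intro sets_measure_of) blast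

lemma Fd_subalgebra: "subalgebra M (Fd q l)"
  unfolding subalgebra_def sets_Fd using Fi_subalgebra
  by (auto intro!: sets.sigma_sets_subset simp: subalgebra_def)

lemma Fd_mono: "l \<le> k \<Longrightarrow> sets (Fd q l) \<subseteq> sets (Fd q k)"
  unfolding sets_Fd by (intro sigma_sets_mono') force

lemma Fd_shift: "sets (Fd q (l + j $ q)) = {T j -` A \<inter> space M |A. A \<in> sets (Fd q l)}"
proof -
  have "(\<Union>i\<in>{i. i $ q \<le> l + j $ q}. sets (Fi i)) = (\<Union>i\<in>{i. i $ q \<le> l}. sets (Fi (i + j)))"
  proof -
    have "{i. i $ q \<le> l + j $ q} = (\<lambda>i. i + j) ` {i. i $ q \<le> l}"
    proof safe
      fix i :: "int ^ 'd::{finite,linorder}" assume "i $ q \<le> l + j $ q"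
      then show "i \<in> (\<lambda>i. i + j) ` {i. i $ q \<le> l}" by (intro image_eqI[of _ _ "i - j"]) auto
    qed simp
    then show ?thesis by simp
  qed
  also have "\<dots> = {T j -` A \<inter> space M |A. A \<in> (\<Union>i\<in>{i. i $ q \<le> l}. sets (Fi i))}"
    unfolding Fi_shift by blast
  finally have "sets (Fd q (l + j $ q)) = sigma_sets (space M) {T j -` A \<inter> space M |A. A \<in> (\<Union>i\<in>{i. i $ q \<le> l}. sets (Fi i))}"
    by (simp add: sets_Fd)
  also have "\<dots> = {T j -` A \<inter> space M |A. A \<in> sets (Fd q l)}"
    unfolding sets_Fd by (rule sigma_sets_vimage_commute[symmetric]) (auto intro: T_space)
  finally show ?thesis .
qed

lemma Ed_compose:
  assumes "integrable M f"
  shows "AE x in M. Ed q (l + j $ q) (\<lambda>x. f (T j x)) x = Ed q l f (T j x)"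
  by (rule real_cond_exp_compose[OF T_measurable T_distr Fd_subalgebra Fd_shift _ assms]) simp

text \<open>The generators are indexed by a directed set, while the upward theorem concerns
  sequences. Indices with q-th coordinate l and all others n are cofinal, since only finitely many
  coordinates have to be dominated.\<close>

lemma sets_Fd_cofinal:
  "sets (Fd q l) = sigma_sets (space M) (\<Union>n. sets (Fi (\<chi> r. if r = q then l else int n)))"
proof -
  let ?v = "\<lambda>n. (\<chi> r. if r = q then l else int n) :: int ^ 'd::{finite,linorder}"
  have "(\<Union>i\<in>{i. i $ q \<le> l}. sets (Fi i)) = (\<Union>n. sets (Fi (?v n)))"
  proof safe
    fix i :: "int ^ 'd::{finite,linorder}" and A assume i: "i $ q \<le> l" and A: "A \<in> sets (Fi i)"
    define n where "n = nat (Max (range (($) i)))"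
    have "i $ r \<le> int n" for r
    proof -
      have "i $ r \<le> Max (range (($) i))" by (rule Max_ge) auto
      then show ?thesis unfolding n_def by linarith
    qed
    then have "i \<le> ?v n" using i by (auto simp: less_eq_vec_def)
    then show "A \<in> (\<Union>n. sets (Fi (?v n)))" using Fi_mono A by blast
  next
    fix n A assume "A \<in> sets (Fi (?v n))"
    then show "A \<in> (\<Union>i\<in>{i. i $ q \<le> l}. sets (Fi i))" by (intro UN_I[of "?v n"]) auto
  qed
  then show ?thesis by (simp add: sets_Fd)
qed

lemma cofinal_mono:
  "m \<le> n \<Longrightarrow> sets (Fi (\<chi> r. if r = q then l else int m)) \<subseteq> sets (Fi (\<chi> r. if r = q then l else int n))"
  by (intro Fi_mono) (simp add: less_eq_vec_def)

lemma Fi_commute: "cond_exp_commute (Fi i) (Fi j)"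
  unfolding cond_exp_commute_def
proof
  fix f assume "f \<in> Lp M 1"
  then have f: "integrable M f" by (simp add: Lp_1_iff)
  have min: "AE x in M. real_cond_exp M (Fi b) (real_cond_exp M (Fi a) f) x =
      real_cond_exp M (Fi (\<chi> q. min (a $ q) (b $ q))) f x" for a b
    using filtration f by (simp add: completely_commuting_filtration_def)
  have eq: "(\<chi> q. min (j $ q) (i $ q)) = (\<chi> q. min (i $ q) (j $ q))" by (simp add: min.commute)
  show "AE x in M. real_cond_exp M (Fi i) (real_cond_exp M (Fi j) f) x = real_cond_exp M (Fi j) (real_cond_exp M (Fi i) f) x"
    using min[of i j] min[of j i] unfolding eq by eventually_elim simp
qed

text \<open>Commutation for the F_i is symmetry of the coordinatewise minimum; it is carried to the
  directional sigma-algebras by one upward limit in each of the two arguments.\<close>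

lemma Fd_commute: "cond_exp_commute (Fd q l) (Fd r k)"
proof -
  have 1: "cond_exp_commute (Fd q l) (Fi j)" for j
    by (rule cond_exp_commute_upward[OF Fi_subalgebra cofinal_mono sets_Fd_cofinal space_Fd Fi_subalgebra Fi_commute])
  show ?thesis
    by (rule cond_exp_commute_sym, rule cond_exp_commute_upward[OF Fi_subalgebra cofinal_mono sets_Fd_cofinal space_Fd Fd_subalgebra])
       (assumption, rule cond_exp_commute_sym[OF 1])
qed

lemma Ed_commute: "f \<in> Lp M 1 \<Longrightarrow> AE x in M. Ed q l (Ed r k f) x = Ed r k (Ed q l f) x"
  using Fd_commute by (simp add: cond_exp_commute_def)

section \<open>Martingale differences in one direction\<close>

text \<open>Measurability for the sigma-algebra at l is expressed by a fixed-point equation, which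
  passes to linear combinations, compositions with the action and limits in L^p. For l = 0 this
  gives the spaces of the conclusion.\<close>

definition mdiff :: "real \<Rightarrow> 'd::{finite,linorder} \<Rightarrow> int \<Rightarrow> ('a \<Rightarrow> real) set" where
  "mdiff p q l = {h \<in> Lp M p. (AE x in M. Ed q l h x = h x) \<and> (AE x in M. Ed q (l - 1) h x = 0)}"

lemma Ed_Lp: "1 \<le> p \<Longrightarrow> f \<in> Lp M p \<Longrightarrow> Ed q l f \<in> Lp M p"
  using Lp_cond_exp(1)[OF _ Fd_subalgebra] .

lemma Ed_Ed:
  assumes f: "f \<in> Lp M 1"
  shows "AE x in M. Ed q k (Ed q l f) x = Ed q (min k l) f x"
proof -
  interpret G: sigma_finite_subalgebra M "Fd q k" using Fd_subalgebra by (rule subalgebra_sigma_finite)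
  show ?thesis
  proof (cases "k \<le> l")
    case True
    then have "subalgebra (Fd q l) (Fd q k)" using Fd_mono by (auto simp: subalgebra_def)
    from G.real_cond_exp_nested_subalg[OF Fd_subalgebra this] show ?thesis
      using f True by (simp add: Lp_1_iff)
  next
    case False
    then have "subalgebra (Fd q k) (Fd q l)" using Fd_mono by (auto simp: subalgebra_def)
    then have "Ed q l f \<in> borel_measurable (Fd q k)"
      by (rule measurable_from_subalg) simp
    from G.real_cond_exp_F_meas[OF _ this] show ?thesis
      using Ed_Lp[OF _ f, of q l] False by (simp add: Lp_1_iff)
  qed
qed

lemma mdiff_Lp: "h \<in> mdiff p q l \<Longrightarrow> h \<in> Lp M p"
  by (simp add: mdiff_def)

lemma mdiff_Ed_above:
  assumes p: "1 \<le> p" and h: "h \<in> mdiff p q l" and k: "l \<le> k"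
  shows "AE x in M. Ed q k h x = h x"
proof -
  have h1: "h \<in> Lp M 1" and eq: "AE x in M. Ed q l h x = h x"
    using Lp_imp_Lp_1[OF p] h by (auto simp: mdiff_def)
  have "AE x in M. Ed q k (Ed q l h) x = Ed q k h x"
    using eq LpD(1)[OF h1] by (intro cond_exp_AE_cong[OF Fd_subalgebra]) auto
  moreover have "AE x in M. Ed q k (Ed q l h) x = Ed q l h x"
    using Ed_Ed[OF h1, of q k l] k by (simp add: min_def split: if_splits)
  ultimately show ?thesis using eq by eventually_elim simp
qed

lemma Ed_zero: "AE x in M. Ed q k (\<lambda>_. 0) x = 0"
  using cond_exp_cmult_AE[OF Fd_subalgebra, of "\<lambda>_. 0" q k 0] by simp

lemma mdiff_sum:
  assumes p: "1 \<le> p" and h: "\<And>i. i \<in> I \<Longrightarrow> h i \<in> mdiff p q l"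
  shows "(\<lambda>x. \<Sum>i\<in>I. h i x) \<in> mdiff p q l"
proof (cases "finite I")
  case True
  have L: "h i \<in> Lp M p" "h i \<in> Lp M 1" if "i \<in> I" for i
    using h[OF that] Lp_imp_Lp_1[OF p] by (auto simp: mdiff_def)
  have "AE x in M. \<forall>i\<in>I. Ed q l (h i) x = h i x \<and> Ed q (l - 1) (h i) x = 0"
    using h True by (intro AE_finite_allI) (auto simp: mdiff_def)
  then have "AE x in M. (\<Sum>i\<in>I. Ed q l (h i) x) = (\<Sum>i\<in>I. h i x) \<and> (\<Sum>i\<in>I. Ed q (l - 1) (h i) x) = 0"
    by eventually_elim simp
  moreover have "AE x in M. Ed q k (\<lambda>x. \<Sum>i\<in>I. h i x) x = (\<Sum>i\<in>I. Ed q k (h i) x)" for k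
    by (rule cond_exp_sum_AE[OF Fd_subalgebra L(2)])
  note this[of l] this[of "l - 1"]
  ultimately have "AE x in M. Ed q l (\<lambda>x. \<Sum>i\<in>I. h i x) x = (\<Sum>i\<in>I. h i x)"
    "AE x in M. Ed q (l - 1) (\<lambda>x. \<Sum>i\<in>I. h i x) x = 0"
    by (eventually_elim, simp)+
  then show ?thesis using Lp_sum[OF p L(1)] by (simp add: mdiff_def)
next
  case False
  then show ?thesis using Ed_zero by (simp add: mdiff_def)
qed

lemma mdiff_cmult:
  assumes p: "1 \<le> p" and h: "h \<in> mdiff p q l"
  shows "(\<lambda>x. c * h x) \<in> mdiff p q l"
proof -
  have L: "h \<in> Lp M p" "h \<in> Lp M 1" using h Lp_imp_Lp_1[OF p] by (auto simp: mdiff_def)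
  have "AE x in M. Ed q k (\<lambda>x. c * h x) x = c * Ed q k h x" for k
    by (rule cond_exp_cmult_AE[OF Fd_subalgebra L(2)])
  note this[of l] this[of "l - 1"]
  moreover have "AE x in M. Ed q l h x = h x" "AE x in M. Ed q (l - 1) h x = 0"
    using h by (auto simp: mdiff_def)
  ultimately have "AE x in M. Ed q l (\<lambda>x. c * h x) x = c * h x"
    "AE x in M. Ed q (l - 1) (\<lambda>x. c * h x) x = 0"
    by (eventually_elim, simp)+
  then show ?thesis using Lp_cmult[OF L(1)] by (simp add: mdiff_def)
qed

lemma mdiff_closed:
  assumes p: "1 \<le> p" and u: "\<And>n. u n \<in> mdiff p q l" and v: "v \<in> Lp M p" and lim: "Lp_lim M p u v"
  shows "v \<in> mdiff p q l"
proof -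
  have L: "u n \<in> Lp M p" for n using u by (auto simp: mdiff_def)
  have E: "Lp_lim M p (\<lambda>n. Ed q k (u n)) (Ed q k v)" for k
    by (rule Lp_lim_cond_exp[OF p Fd_subalgebra L v lim])
  have "Lp_lim M p u (Ed q l v)"
    by (rule Lp_lim_AE_cong[OF _ _ _ _ _ _ E[of l]])
       (use u LpD(1)[OF L] in \<open>auto simp: mdiff_def\<close>)
  from Lp_lim_unique[OF p L Ed_Lp[OF p v] v this lim] have 1: "AE x in M. Ed q l v x = v x" .
  have "Lp_lim M p (\<lambda>n _. 0) (Ed q (l - 1) v)"
    by (rule Lp_lim_AE_cong[OF _ _ _ _ _ _ E[of "l - 1"]]) (use u in \<open>auto simp: mdiff_def\<close>)
  from Lp_lim_unique[OF p _ Ed_Lp[OF p v] _ this Lp_lim_const] have "AE x in M. Ed q (l - 1) v x = 0" by simp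
  with 1 v show ?thesis by (simp add: mdiff_def)
qed

lemma Lp_compose:
  assumes "f \<in> Lp M p"
  shows "(\<lambda>x. f (T j x)) \<in> Lp M p" "Lp_norm M p (\<lambda>x. f (T j x)) = Lp_norm M p f"
proof -
  have [measurable]: "f \<in> borel_measurable M" and i: "integrable M (\<lambda>x. \<bar>f x\<bar> powr p)"
    using LpD[OF assms] by auto
  have "integrable M (\<lambda>x. \<bar>f (T j x)\<bar> powr p)"
    using integrable_distr_eq[OF T_measurable[of j], of "\<lambda>x. \<bar>f x\<bar> powr p"] i by (simp add: T_distr)
  then show "(\<lambda>x. f (T j x)) \<in> Lp M p" by (simp add: Lp_def)
  have "(\<integral>x. \<bar>f (T j x)\<bar> powr p \<partial>M) = (\<integral>x. \<bar>f x\<bar> powr p \<partial>M)"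
    using integral_distr[OF T_measurable[of j], of "\<lambda>x. \<bar>f x\<bar> powr p"] by (simp add: T_distr)
  then show "Lp_norm M p (\<lambda>x. f (T j x)) = Lp_norm M p f" by (simp add: Lp_norm_def)
qed

lemma AE_compose:
  assumes "AE x in M. P x"
  shows "AE x in M. P (T j x)"
proof -
  obtain N where N: "{x \<in> space M. \<not> P x} \<subseteq> N" "N \<in> null_sets M"
    using assms by (auto elim: AE_E2 AE_E simp: null_sets_def)
  have "AE x in distr M M (T j). x \<notin> N" using N(2) AE_not_in[of N M] unfolding T_distr by simp
  then have "AE x in M. T j x \<notin> N" using N(2) by (subst (asm) AE_distr_iff) auto
  then show ?thesis
    by (rule AE_mp) (use N(1) T_space in \<open>auto intro!: AE_I2\<close>)
qed

lemma mdiff_compose: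
  assumes p: "1 \<le> p" and h: "h \<in> mdiff p q l"
  shows "(\<lambda>x. h (T j x)) \<in> mdiff p q (l + j $ q)"
proof -
  have L: "h \<in> Lp M p" "integrable M h" using h Lp_imp_Lp_1[OF p] by (auto simp: mdiff_def Lp_1_iff)
  have "AE x in M. Ed q l h (T j x) = h (T j x)"
    by (rule AE_compose[where P = "\<lambda>x. Ed q l h x = h x"]) (use h in \<open>simp add: mdiff_def\<close>)
  moreover have "AE x in M. Ed q (l - 1) h (T j x) = 0"
    by (rule AE_compose[where P = "\<lambda>x. Ed q (l - 1) h x = 0"]) (use h in \<open>simp add: mdiff_def\<close>)
  moreover note Ed_compose[OF L(2), of q l j] Ed_compose[OF L(2), of q "l - 1" j]
  ultimately have "AE x in M. Ed q (l + j $ q) (\<lambda>x. h (T j x)) x = h (T j x)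
      \<and> Ed q (l - 1 + j $ q) (\<lambda>x. h (T j x)) x = 0"
    by eventually_elim simp
  moreover have "l - 1 + j $ q = l + j $ q - 1" by simp
  ultimately have "AE x in M. Ed q (l + j $ q) (\<lambda>x. h (T j x)) x = h (T j x)"
    "AE x in M. Ed q (l + j $ q - 1) (\<lambda>x. h (T j x)) x = 0"
    by auto
  then show ?thesis using Lp_compose(1)[OF L(1)] by (simp add: mdiff_def)
qed

lemma mdiff_0_Lp_ominus:
  assumes "h \<in> mdiff p q 0"
  shows "h \<in> Lp_ominus M p (Fd q 0) (Fd q (- 1))"
proof -
  have "ae_measurable_wrt M (Fd q 0) h"
    using assms unfolding ae_measurable_wrt_def mdiff_def
    by (intro bexI[of _ "Ed q 0 h"]) (auto intro: AE_symmetric)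
  then show ?thesis using assms by (simp add: Lp_ominus_def Lp_sub_def mdiff_def)
qed

text \<open>Induction removes the largest index b. All other summands have indices at most b - 1, so
  their sum is fixed by \<open>Ed q (b - 1)\<close>, which annihilates \<open>y b\<close>: exactly
  the situation of \<open>Lp_norm_martingale_step\<close>.\<close>

lemma Lp_norm_mdiff_sum:
  assumes p: "2 \<le> p" and L: "finite L" and y: "\<And>l. l \<in> L \<Longrightarrow> y l \<in> mdiff p q l"
  shows "(Lp_norm M p (\<lambda>x. \<Sum>l\<in>L. y l x))\<^sup>2 \<le> 4 * ((p + 1) powr p + p\<^sup>2) * (\<Sum>l\<in>L. (Lp_norm M p (y l))\<^sup>2)"
  using L y
proof (induction L rule: finite_linorder_max_induct)
  case (insert b A)
  have p1: "1 \<le> p" using p by simp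
  let ?X = "\<lambda>x. \<Sum>l\<in>A. y l x"
  have X: "?X \<in> Lp M p" using insert.prems by (intro Lp_sum[OF p1]) (auto simp: mdiff_def)
  have y1: "y l \<in> Lp M 1" if "l \<in> A" for l
    using insert.prems that Lp_imp_Lp_1[OF p1] by (auto simp: mdiff_def)
  have "AE x in M. \<forall>l\<in>A. Ed q (b - 1) (y l) x = y l x"
    using insert by (intro AE_finite_allI mdiff_Ed_above[OF p1]) auto
  moreover have "AE x in M. Ed q (b - 1) ?X x = (\<Sum>l\<in>A. Ed q (b - 1) (y l) x)"
    by (rule cond_exp_sum_AE[OF Fd_subalgebra y1])
  ultimately have "AE x in M. Ed q (b - 1) ?X x = ?X x" by eventually_elim simp
  moreover have "y b \<in> Lp M p" "AE x in M. Ed q (b - 1) (y b) x = 0"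
    using insert.prems by (auto simp: mdiff_def)
  ultimately have "(Lp_norm M p (\<lambda>x. ?X x + y b x))\<^sup>2 \<le>
      (Lp_norm M p ?X)\<^sup>2 + 4 * ((p + 1) powr p + p\<^sup>2) * (Lp_norm M p (y b))\<^sup>2"
    by (intro Lp_norm_martingale_step[OF p Fd_subalgebra X])
  moreover have "b \<notin> A" using insert by auto
  ultimately show ?case using insert by (simp add: algebra_simps)
qed simp

text \<open>Indices are grouped by their q-th coordinate; the group sums are martingale differences
  in direction q, and each group is treated by induction in the other directions. The assumption
  \<open>inj\<close> makes the induction start: without directions left, at most one index
  remains.\<close>

lemma Lp_norm_multi_mdiff_sum_aux:
  assumes p: "2 \<le> p" and Q: "finite Q" and L: "finite (L :: (int ^ 'd::{finite,linorder}) set)"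
    and inj: "\<And>l m. l \<in> L \<Longrightarrow> m \<in> L \<Longrightarrow> (\<And>q. q \<in> Q \<Longrightarrow> l $ q = m $ q) \<Longrightarrow> l = m"
    and y: "\<And>l. l \<in> L \<Longrightarrow> y l \<in> Lp M p" "\<And>l q. l \<in> L \<Longrightarrow> q \<in> Q \<Longrightarrow> y l \<in> mdiff p q (l $ q)"
  shows "(Lp_norm M p (\<lambda>x. \<Sum>l\<in>L. y l x))\<^sup>2 \<le>
    (4 * ((p + 1) powr p + p\<^sup>2)) ^ card Q * (\<Sum>l\<in>L. (Lp_norm M p (y l))\<^sup>2)"
  using Q L inj y
proof (induction Q arbitrary: L rule: finite_induct)
  case empty
  then have "L = {} \<or> (\<exists>l. L = {l})" by blast
  then show ?case by auto
next
  case (insert q Q)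
  have p1: "1 \<le> p" using p by simp
  let ?C = "4 * ((p + 1) powr p + p\<^sup>2)"
  have C: "0 \<le> ?C" by simp
  define K where "K = (\<lambda>l. l $ q) ` L"
  define Lk where "Lk k = {l \<in> L. l $ q = k}" for k
  have fin: "finite K" "finite (Lk k)" for k using insert.prems(1) by (auto simp: K_def Lk_def)
  have group: "(\<Sum>l\<in>L. g l) = (\<Sum>k\<in>K. \<Sum>l\<in>Lk k. g l)" for g :: "_ \<Rightarrow> real"
    unfolding K_def Lk_def by (rule sum.image_gen[OF insert.prems(1)])
  have IH: "(Lp_norm M p (\<lambda>x. \<Sum>l\<in>Lk k. y l x))\<^sup>2 \<le> ?C ^ card Q * (\<Sum>l\<in>Lk k. (Lp_norm M p (y l))\<^sup>2)" for k
  proof (rule insert.IH[OF fin(2)])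
    fix l m assume "l \<in> Lk k" "m \<in> Lk k" "\<And>r. r \<in> Q \<Longrightarrow> l $ r = m $ r"
    then show "l = m" by (intro insert.prems(2)) (auto simp: Lk_def)
  qed (use insert.prems in \<open>auto simp: Lk_def\<close>)
  have "(Lp_norm M p (\<lambda>x. \<Sum>l\<in>L. y l x))\<^sup>2 = (Lp_norm M p (\<lambda>x. \<Sum>k\<in>K. \<Sum>l\<in>Lk k. y l x))\<^sup>2"
    by (simp add: group)
  also have "\<dots> \<le> ?C * (\<Sum>k\<in>K. (Lp_norm M p (\<lambda>x. \<Sum>l\<in>Lk k. y l x))\<^sup>2)"
  proof (rule Lp_norm_mdiff_sum[OF p fin(1), where q = q])
    fix k show "(\<lambda>x. \<Sum>l\<in>Lk k. y l x) \<in> mdiff p q k"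
      using insert.prems(4)[of _ q] by (intro mdiff_sum[OF p1]) (auto simp: Lk_def)
  qed
  also have "\<dots> \<le> ?C * (\<Sum>k\<in>K. ?C ^ card Q * (\<Sum>l\<in>Lk k. (Lp_norm M p (y l))\<^sup>2))"
    by (intro mult_left_mono[OF _ C] sum_mono IH)
  also have "\<dots> = ?C ^ card (insert q Q) * (\<Sum>l\<in>L. (Lp_norm M p (y l))\<^sup>2)"
    using insert.hyps by (simp add: group sum_distrib_left mult.assoc)
  finally show ?case .
qed

lemma Lp_norm_multi_mdiff_sum:
  assumes p: "2 \<le> p" and L: "finite (L :: (int ^ 'd::{finite,linorder}) set)"
    and y: "\<And>l q. l \<in> L \<Longrightarrow> y l \<in> mdiff p q (l $ q)"
  shows "(Lp_norm M p (\<lambda>x. \<Sum>l\<in>L. y l x))\<^sup>2 \<le>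
    (4 * ((p + 1) powr p + p\<^sup>2)) ^ CARD('d) * (\<Sum>l\<in>L. (Lp_norm M p (y l))\<^sup>2)"
  using y by (intro Lp_norm_multi_mdiff_sum_aux[OF p _ L]) (auto simp: vec_eq_iff intro: mdiff_Lp)

section \<open>The operators \<open>P\<^sub>j\<close>\<close>

lemma proj_dir_Lp: "1 \<le> p \<Longrightarrow> f \<in> Lp M p \<Longrightarrow> proj_dir M T F q l f \<in> Lp M p"
  unfolding proj_dir_def by (intro Lp_diff Ed_Lp)

lemma Ed_proj_dir:
  assumes f: "f \<in> Lp M 1"
  shows "AE x in M. Ed r k (proj_dir M T F q l f) x = Ed r k (Ed q l f) x - Ed r k (Ed q (l - 1) f) x"
  unfolding proj_dir_def by (intro cond_exp_diff_AE Fd_subalgebra Ed_Lp f) auto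

lemma proj_dir_mdiff:
  assumes p: "1 \<le> p" and f: "f \<in> Lp M p"
  shows "proj_dir M T F q l f \<in> mdiff p q l"
proof -
  have f1: "f \<in> Lp M 1" using Lp_imp_Lp_1[OF p f] .
  have "AE x in M. Ed q l (proj_dir M T F q l f) x = proj_dir M T F q l f x"
    using Ed_proj_dir[OF f1, of q l q l] Ed_Ed[OF f1, of q l l] Ed_Ed[OF f1, of q l "l - 1"]
    by eventually_elim (simp add: proj_dir_def)
  moreover have "AE x in M. Ed q (l - 1) (proj_dir M T F q l f) x = 0"
    using Ed_proj_dir[OF f1, of q "l - 1" q l] Ed_Ed[OF f1, of q "l - 1" l] Ed_Ed[OF f1, of q "l - 1" "l - 1"]
    by eventually_elim simp
  ultimately show ?thesis using proj_dir_Lp[OF p f] by (simp add: mdiff_def)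
qed

lemma proj_dir_AE_cong:
  assumes "f \<in> borel_measurable M" "g \<in> borel_measurable M" "AE x in M. f x = g x"
  shows "AE x in M. proj_dir M T F q l f x = proj_dir M T F q l g x"
  using cond_exp_AE_cong[OF Fd_subalgebra assms, of q l] cond_exp_AE_cong[OF Fd_subalgebra assms, of q "l - 1"]
  by eventually_elim (simp add: proj_dir_def)

lemma Ed_proj_dir_commute:
  assumes f: "f \<in> Lp M 1"
  shows "AE x in M. Ed r k (proj_dir M T F q l f) x = proj_dir M T F q l (Ed r k f) x"
  using Ed_proj_dir[OF f, of r k q l] Ed_commute[OF f, of r k q l] Ed_commute[OF f, of r k q "l - 1"]
  by eventually_elim (simp add: proj_dir_def)

lemma proj_dir_preserves_mdiff:
  assumes p: "1 \<le> p" and h: "h \<in> mdiff p q l"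
  shows "proj_dir M T F r k h \<in> mdiff p q l"
proof -
  have L: "h \<in> Lp M p" "h \<in> Lp M 1" using h Lp_imp_Lp_1[OF p] by (auto simp: mdiff_def)
  have "AE x in M. proj_dir M T F r k (Ed q l h) x = proj_dir M T F r k h x"
    using h LpD(1)[OF L(1)] by (intro proj_dir_AE_cong) (auto simp: mdiff_def)
  then have 1: "AE x in M. Ed q l (proj_dir M T F r k h) x = proj_dir M T F r k h x"
    using Ed_proj_dir_commute[OF L(2), of q l r k] by eventually_elim simp
  have "AE x in M. proj_dir M T F r k (Ed q (l - 1) h) x = proj_dir M T F r k (\<lambda>_. 0) x"
    using h by (intro proj_dir_AE_cong) (auto simp: mdiff_def)
  moreover have "AE x in M. proj_dir M T F r k (\<lambda>_. 0) x = 0"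
    using Ed_zero[of r k] Ed_zero[of r "k - 1"] by eventually_elim (simp add: proj_dir_def)
  ultimately have 2: "AE x in M. Ed q (l - 1) (proj_dir M T F r k h) x = 0"
    using Ed_proj_dir_commute[OF L(2), of q "l - 1" r k] by eventually_elim simp
  show ?thesis using 1 2 proj_dir_Lp[OF p L(1)] by (simp add: mdiff_def)
qed

text \<open>Each factor creates the martingale difference property in its own direction, and the
  factors applied after it preserve that property because they commute with all \<open>Ed\<close>.
  Arbitrary lists keep the induction free of the ordering of directions.\<close>

lemma foldr_proj_dir:
  assumes p: "1 \<le> p" and f: "f \<in> Lp M p"
  shows "foldr (\<lambda>q. proj_dir M T F q (j q)) qs f \<in> Lp M p"
    "q \<in> set qs \<Longrightarrow> foldr (\<lambda>q. proj_dir M T F q (j q)) qs f \<in> mdiff p q (j q)"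
proof (induction qs)
  case (Cons r qs)
  {
    case 1
    show ?case using proj_dir_Lp[OF p] Cons.IH(1) by simp
  next
    case 2
    then show ?case
      using proj_dir_mdiff[OF p Cons.IH(1)] proj_dir_preserves_mdiff[OF p] Cons.IH(2) by auto
  }
qed (use f in auto)

lemma proj_mdiff:
  assumes "1 \<le> p" "f \<in> Lp M p"
  shows "proj M T F j f \<in> mdiff p q (j $ q)"
  unfolding proj_def op_prod_def by (rule foldr_proj_dir(2)[OF assms]) simp

end

section \<open>Sums over cubes\<close>

definition cube :: "nat \<Rightarrow> (int ^ 'd::finite) set" where
  "cube N = {i. \<forall>q. \<bar>i $ q\<bar> \<le> int N}"

lemma bij_betw_cube: "bij_betw vec_lambda (PiE UNIV (\<lambda>_::'d::finite. {- int N..int N})) (cube N)"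
  by (rule bij_betw_byWitness[where f' = "($)"]) (auto simp: cube_def abs_le_iff PiE_iff minus_le_iff)

lemma finite_cube [simp]: "finite (cube N :: (int ^ 'd::finite) set)"
proof -
  have "finite (PiE UNIV (\<lambda>_::'d. {- int N..int N}))" by (intro finite_PiE) auto
  then show ?thesis using bij_betw_finite[OF bij_betw_cube] by blast
qed

lemma sum_cube: "(\<Sum>i\<in>cube N. g i) = (\<Sum>h\<in>PiE UNIV (\<lambda>_::'d::finite. {- int N..int N}). g (vec_lambda h))"
  by (rule sum.reindex_bij_betw[OF bij_betw_cube, symmetric])

lemma prod_sum_cube:
  fixes \<phi> :: "'d::finite \<Rightarrow> int \<Rightarrow> real"
  shows "(\<Sum>i\<in>cube N. \<Prod>q\<in>UNIV. \<phi> q (i $ q)) = (\<Prod>q\<in>UNIV. \<Sum>k=- int N..int N. \<phi> q k)"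
  by (subst prod_sum_PiE) (auto simp: sum_cube)

lemma sum_int_telescope:
  fixes a :: "int \<Rightarrow> real"
  shows "(\<Sum>k=- int N..int N. a k - a (k - 1)) = a (int N) - a (- int N - 1)"
proof (induction N)
  case (Suc N)
  have "{- int (Suc N)..int (Suc N)} = insert (- int (Suc N)) (insert (int (Suc N)) {- int N..int N})"
    by auto
  moreover have "a (- 1 - int N) = a (- int N - 1)" by (rule arg_cong) simp
  ultimately show ?case using Suc by simp
qed simp

lemma sum_PiE_insert:
  assumes "q \<notin> S" "finite S" "finite B"
  shows "(\<Sum>h\<in>PiE (insert q S) (\<lambda>_. B). g h) = (\<Sum>k\<in>B. \<Sum>h\<in>PiE S (\<lambda>_. B). g (h(q := k)))"
proof -
  have "(\<Sum>h\<in>PiE (insert q S) (\<lambda>_. B). g h) = (\<Sum>(k, h)\<in>B \<times> PiE S (\<lambda>_. B). g (h(q := k)))"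
    unfolding PiE_insert_eq using inj_combinator[OF assms(1), of "\<lambda>_. B"]
    by (subst sum.reindex) (auto simp: case_prod_beta o_def)
  then show ?thesis using assms by (simp add: sum.cartesian_product)
qed

lemma (in prob_space) Lp_mono:
  assumes "0 < r" "r \<le> p" "f \<in> Lp M p"
  shows "f \<in> Lp M r"
proof (rule Lp_dominated)
  show "integrable M (\<lambda>x. 1 + \<bar>f x\<bar> powr p)" using LpD[OF assms(3)] by simp
  have "\<bar>f x\<bar> powr r \<le> 1 + \<bar>f x\<bar> powr p" for x
  proof (cases "\<bar>f x\<bar> \<le> 1")
    case True
    then have "\<bar>f x\<bar> powr r \<le> 1" using assms by (simp add: powr_le1)
    then show ?thesis by (simp add: add_increasing2)
  next
    case False
    then have "\<bar>f x\<bar> powr r \<le> \<bar>f x\<bar> powr p" using assms by (intro powr_mono) auto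
    then show ?thesis by simp
  qed
  then show "AE x in M. \<bar>f x\<bar> powr r \<le> 1 + \<bar>f x\<bar> powr p" by simp
qed (use LpD[OF assms(3)] in simp)

section \<open>Convergence of the cube sums of the P_i f\<close>

context commuting_filtration
begin

text \<open>The telescoped sum of \<open>proj_dir M T F q k\<close> over |k| <= N; the term k = -N
  accounts for the lower index -N - 1.\<close>

definition band :: "nat \<Rightarrow> 'd::{finite,linorder} \<Rightarrow> ('a \<Rightarrow> real) \<Rightarrow> 'a \<Rightarrow> real" where
  "band N q f = (\<lambda>x. Ed q (int N) f x - Ed q (- int N - 1) f x)"

lemma band_Lp: "1 \<le> p \<Longrightarrow> f \<in> Lp M p \<Longrightarrow> band N q f \<in> Lp M p"
  unfolding band_def by (intro Lp_diff Ed_Lp)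

lemma foldr_band_Lp: "1 \<le> p \<Longrightarrow> f \<in> Lp M p \<Longrightarrow> foldr (band N) qs f \<in> Lp M p"
  by (induction qs) (auto intro: band_Lp)

lemma proj_dir_sum_AE:
  assumes "\<And>i. i \<in> I \<Longrightarrow> f i \<in> Lp M 1"
  shows "AE x in M. proj_dir M T F q l (\<lambda>x. \<Sum>i\<in>I. f i x) x = (\<Sum>i\<in>I. proj_dir M T F q l (f i) x)"
proof -
  have "AE x in M. Ed q k (\<lambda>x. \<Sum>i\<in>I. f i x) x = (\<Sum>i\<in>I. Ed q k (f i) x)" for k
    by (rule cond_exp_sum_AE[OF Fd_subalgebra assms])
  from this[of l] this[of "l - 1"] show ?thesis
    by eventually_elim (simp add: proj_dir_def sum_subtractf)
qed

text \<open>A sum over a product of ranges of a product of operators is the product of the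
  one-directional sums, each of which telescopes to a \<open>band\<close>. The operators are linear
  only almost everywhere, so one exceptional set is collected for the finitely many k.\<close>

lemma sum_foldr_proj_dir:
  assumes f: "f \<in> Lp M 1" and qs: "distinct qs"
  shows "AE x in M. (\<Sum>h\<in>PiE (set qs) (\<lambda>_. {- int N..int N}). foldr (\<lambda>q. proj_dir M T F q (h q)) qs f x)
    = foldr (band N) qs f x"
  using qs
proof (induction qs)
  case (Cons q qs)
  let ?I = "{- int N..int N}"
  let ?P = "PiE (set qs) (\<lambda>_. ?I)"
  let ?Y = "\<lambda>h. foldr (\<lambda>q. proj_dir M T F q (h q)) qs f"
  let ?D = "foldr (band N) qs f"
  have Y: "?Y h \<in> Lp M 1" for h using foldr_proj_dir(1)[OF _ f] by simp
  have IH: "AE x in M. (\<Sum>h\<in>?P. ?Y h x) = ?D x" using Cons by simp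
  have "AE x in M. (\<Sum>h\<in>?P. proj_dir M T F q k (?Y h) x) = proj_dir M T F q k ?D x" for k
  proof -
    have "AE x in M. proj_dir M T F q k (\<lambda>x. \<Sum>h\<in>?P. ?Y h x) x = proj_dir M T F q k ?D x"
      using LpD(1)[OF Y] LpD(1)[OF foldr_band_Lp[OF _ f]] IH by (intro proj_dir_AE_cong borel_measurable_sum) auto
    moreover have "AE x in M. proj_dir M T F q k (\<lambda>x. \<Sum>h\<in>?P. ?Y h x) x = (\<Sum>h\<in>?P. proj_dir M T F q k (?Y h) x)"
      by (rule proj_dir_sum_AE[OF Y])
    ultimately show ?thesis by eventually_elim simp
  qed
  then have ae: "AE x in M. \<forall>k\<in>?I. (\<Sum>h\<in>?P. proj_dir M T F q k (?Y h) x) = proj_dir M T F q k ?D x"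
    by (intro AE_finite_allI) auto
  \<comment> \<open>The direction q does not occur in \<open>qs\<close>, so the value chosen for q
    does not affect the inner operators.\<close>
  have upd: "foldr (\<lambda>r. proj_dir M T F r ((h(q := k)) r)) qs f = ?Y h" for h k
    using Cons.prems by (intro foldr_cong) auto
  have q: "q \<notin> set qs" using Cons.prems by simp
  have lhs: "(\<Sum>h\<in>PiE (set (q # qs)) (\<lambda>_. ?I). foldr (\<lambda>q. proj_dir M T F q (h q)) (q # qs) f x)
      = (\<Sum>k\<in>?I. \<Sum>h\<in>?P. proj_dir M T F q k (?Y h) x)" for x
    using sum_PiE_insert[OF q, of ?I "\<lambda>h. foldr (\<lambda>q. proj_dir M T F q (h q)) (q # qs) f x"]
    by (simp add: upd del: fun_upd_apply) (simp only: upd fun_upd_same)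
  have rhs: "(\<Sum>k\<in>?I. proj_dir M T F q k ?D x) = foldr (band N) (q # qs) f x" for x
    using sum_int_telescope[of "\<lambda>k. Ed q k ?D x" N] by (simp add: band_def proj_dir_def)
  show ?case unfolding lhs rhs[symmetric] using ae by eventually_elim simp
qed simp

lemma sum_proj_cube:
  assumes f: "f \<in> Lp M 1"
  shows "AE x in M. (\<Sum>i\<in>cube N. proj M T F i f x) = foldr (band N) (sorted_list_of_set UNIV) f x"
  using sum_foldr_proj_dir[OF f, of "sorted_list_of_set UNIV" N]
  by (simp add: sum_cube proj_def op_prod_def)

text \<open>A single direction already exhausts the whole filtration, so the upward theorem can be
  applied in each direction separately.\<close>

lemma filt_inf_upward:
  "sets (filt_inf M T F) = sigma_sets (space M) (\<Union>n. sets (Fd q (int n)))"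
proof -
  have "sets (filt_inf M T F) = sigma_sets (space M) (\<Union>i. sets (Fi i))"
    unfolding filt_inf_def using Fi_sets_space by (intro sets_measure_of) blast
  also have "\<dots> = sigma_sets (space M) (\<Union>n. sets (Fd q (int n)))"
  proof (rule sigma_sets_eqI)
    fix A assume "A \<in> (\<Union>i. sets (Fi i))"
    then obtain i where "A \<in> sets (Fi i)" by blast
    then have "A \<in> sets (Fd q (int (nat (i $ q))))"
      unfolding sets_Fd by (intro sigma_sets.Basic UN_I[of i]) auto
    then show "A \<in> sigma_sets (space M) (\<Union>n. sets (Fd q (int n)))" by blast
  next
    fix A assume "A \<in> (\<Union>n. sets (Fd q (int n)))"
    then obtain n where A: "A \<in> sets (Fd q (int n))" by blast
    have "sets (Fd q (int n)) \<subseteq> sigma_sets (space M) (\<Union>i. sets (Fi i))"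
      unfolding sets_Fd by (intro sigma_sets_mono') auto
    then show "A \<in> sigma_sets (space M) (\<Union>i. sets (Fi i))" using A by blast
  qed
  finally show ?thesis .
qed

text \<open>The intersection is already a sigma-algebra; the indices -n - 1 are cofinal and match
  the lower end of \<open>band\<close>.\<close>

lemma sets_filt_dir_minf:
  "sets (filt_dir_minf M T F q) = (\<Inter>n. sets (Fd q (- int n - 1)))"
proof -
  let ?I = "\<Inter>k::int. sets (Fd q (- k))"
  have "?I \<subseteq> sets (Fd q (- 0))" by blast
  then have sub: "?I \<subseteq> Pow (space M)" using sets.space_closed[of "Fd q 0"] by simp
  have "sigma_sets (space M) ?I \<subseteq> sets (Fd q (- k))" for k
    using sets.sigma_sets_subset[of ?I "Fd q (- k)"] by auto
  then have "sigma_sets (space M) ?I = ?I" using sigma_sets_superset_generator[of ?I] by blast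
  then have "sets (filt_dir_minf M T F q) = ?I"
    unfolding filt_dir_minf_def using sub by (simp add: sets_measure_of)
  also have "\<dots> = (\<Inter>n. sets (Fd q (- int n - 1)))"
  proof
    show "?I \<subseteq> (\<Inter>n. sets (Fd q (- int n - 1)))"
    proof (rule INT_greatest)
      fix n
      have "?I \<subseteq> sets (Fd q (- (int n + 1)))" by blast
      then show "?I \<subseteq> sets (Fd q (- int n - 1))" by simp
    qed
    show "(\<Inter>n. sets (Fd q (- int n - 1))) \<subseteq> ?I"
    proof (rule INT_greatest)
      fix k :: int
      have "sets (Fd q (- int (nat k) - 1)) \<subseteq> sets (Fd q (- k))" by (intro Fd_mono) auto
      then show "(\<Inter>n. sets (Fd q (- int n - 1))) \<subseteq> sets (Fd q (- k))" by blast
    qed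
  qed
  finally show ?thesis .
qed

lemma band_lim:
  assumes f: "f \<in> Lp M 2" and reg: "regular M T F f"
  shows "Lp_lim M 1 (\<lambda>N. band N q f) f"
proof -
  have f1: "f \<in> Lp M 1" using Lp_imp_Lp_1[OF _ f] by simp
  have GM: "sets (Fd q l) \<subseteq> sets M" for l using Fd_subalgebra[of q l] by (simp add: subalgebra_def)
  let ?H = "filt_inf M T F"
  have sp: "space ?H = space M" "space (filt_dir_minf M T F q) = space M"
    by (simp_all add: filt_inf_def filt_dir_minf_def space_measure_of_conv)
  have HM: "subalgebra M ?H"
    unfolding subalgebra_def filt_inf_upward[of q] sp using GM by (auto intro!: sets.sigma_sets_subset)
  interpret H: sigma_finite_subalgebra M ?H using HM by (rule subalgebra_sigma_finite)
  obtain g where g: "g \<in> borel_measurable ?H" "AE x in M. f x = g x"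
    using reg by (auto simp: regular_def ae_measurable_wrt_def)
  have gM: "g \<in> borel_measurable M" using measurable_from_subalg[OF HM g(1)] .
  have "integrable M g" using Lp_AE_cong(1)[OF f1 gM g(2)] by (simp add: Lp_1_iff)
  then have "AE x in M. real_cond_exp M ?H g x = g x" using g(1) by (rule H.real_cond_exp_F_meas)
  moreover have "AE x in M. real_cond_exp M ?H f x = real_cond_exp M ?H g x"
    using LpD(1)[OF f] gM g(2) by (intro H.real_cond_exp_cong)
  ultimately have fH: "AE x in M. real_cond_exp M ?H f x = f x"
    using g(2) by eventually_elim simp
  have "Lp_lim M 1 (\<lambda>n. Ed q (int n) f) (real_cond_exp M ?H f)"
    using sp by (intro cond_exp_upward Fd_subalgebra Fd_mono filt_inf_upward f1) auto
  then have up: "Lp_lim M 1 (\<lambda>n. Ed q (int n) f) f"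
    by (rule Lp_lim_AE_cong[OF _ _ _ _ _ fH, rotated -1]) (use LpD(1)[OF f] in auto)
  have down: "Lp_lim M 1 (\<lambda>n. Ed q (- int n - 1) f) (\<lambda>_. 0)"
  proof (rule cond_exp_downward_zero[OF Fd_subalgebra _ sets_filt_dir_minf sp(2) f])
    show "sets (Fd q (- int n - 1)) \<subseteq> sets (Fd q (- int m - 1))" if "m \<le> n" for m n
      using that by (intro Fd_mono) simp
  qed (use reg in \<open>simp add: regular_def\<close>)
  have "Lp_lim M 1 (\<lambda>n x. Ed q (int n) f x - Ed q (- int n - 1) f x) (\<lambda>x. f x - 0)"
    by (rule Lp_lim_diff[OF _ _ f1 _ _ up down]) (auto intro: Ed_Lp f1)
  then show ?thesis by (simp add: band_def)
qed

text \<open>On L^1 the operator \<open>band N q\<close> has norm at most 2 uniformly in N. Hence the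
  error of the inner product is at most doubled, and the outer factor is then compared with f on f
  itself, where \<open>band_lim\<close> applies.\<close>

lemma foldr_band_lim:
  assumes f: "f \<in> Lp M 2" and reg: "regular M T F f"
  shows "Lp_lim M 1 (\<lambda>N. foldr (band N) qs f) f"
proof (induction qs)
  case (Cons q qs)
  have f1: "f \<in> Lp M 1" using Lp_imp_Lp_1[OF _ f] by simp
  let ?g = "\<lambda>N. foldr (band N) qs f"
  have g: "?g N \<in> Lp M 1" for N using foldr_band_Lp[OF _ f1] by simp
  have D: "band N q h \<in> Lp M 1" if "h \<in> Lp M 1" for N h using band_Lp[OF _ that] by simp
  have contr: "Lp_norm M 1 (\<lambda>x. band N q (?g N) x - band N q f x) \<le> 2 * Lp_norm M 1 (\<lambda>x. ?g N x - f x)" for N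
  proof -
    have E: "(\<lambda>x. Ed q k (?g N) x - Ed q k f x) \<in> Lp M 1" for k
      by (intro Lp_diff Ed_Lp g f1) auto
    have n: "Lp_norm M 1 (\<lambda>x. Ed q k (?g N) x - Ed q k f x) \<le> Lp_norm M 1 (\<lambda>x. ?g N x - f x)" for k
      by (rule Lp_norm_cond_exp_diff[OF _ Fd_subalgebra g f1]) simp
    have "Lp_norm M 1 (\<lambda>x. band N q (?g N) x - band N q f x)
        = Lp_norm M 1 (\<lambda>x. (Ed q (int N) (?g N) x - Ed q (int N) f x) - (Ed q (- int N - 1) (?g N) x - Ed q (- int N - 1) f x))"
      by (simp add: band_def algebra_simps)
    also have "\<dots> \<le> Lp_norm M 1 (\<lambda>x. Ed q (int N) (?g N) x - Ed q (int N) f x)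
        + Lp_norm M 1 (\<lambda>x. Ed q (- int N - 1) (?g N) x - Ed q (- int N - 1) f x)"
      by (rule Lp_norm_diff[OF _ E E]) simp
    finally show ?thesis using n[of "int N"] n[of "- int N - 1"] by linarith
  qed
  have "Lp_lim M 1 (\<lambda>N. band N q (?g N)) f"
  proof (rule Lp_limI_bound)
    show "Lp_norm M 1 (\<lambda>x. band N q (?g N) x - f x) \<le>
        2 * Lp_norm M 1 (\<lambda>x. ?g N x - f x) + Lp_norm M 1 (\<lambda>x. band N q f x - f x)" for N
      using Lp_norm_triangle[OF _ D[OF g, of N N] D[OF f1, of N] f1] contr[of N] by simp
    show "(\<lambda>N. 2 * Lp_norm M 1 (\<lambda>x. ?g N x - f x) + Lp_norm M 1 (\<lambda>x. band N q f x - f x)) \<longlonglongrightarrow> 0"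
      using tendsto_add[OF tendsto_mult[OF tendsto_const[of 2] Cons.IH[unfolded Lp_lim_def]]
          band_lim[OF f reg, of q, unfolded Lp_lim_def]] by simp
  qed
  then show ?case by simp
qed (simp add: Lp_lim_const)

lemma sum_proj_cube_lim:
  assumes p: "2 \<le> p" and f: "f \<in> Lp M p" and reg: "regular M T F f"
  shows "Lp_lim M 1 (\<lambda>N x. \<Sum>i\<in>cube N. proj M T F i f x) f"
proof -
  have f2: "f \<in> Lp M 2" using Lp_mono[OF _ p f] by simp
  have f1: "f \<in> Lp M 1" using Lp_imp_Lp_1[OF _ f] p by simp
  have P: "proj M T F i f \<in> Lp M 1" for i
    unfolding proj_def op_prod_def by (rule foldr_proj_dir(1)[OF _ f1]) simp
  show ?thesis
    by (rule Lp_lim_AE_cong[OF _ _ _ _ AE_symmetric[OF sum_proj_cube[OF f1]] _ foldr_band_lim[OF f2 reg]])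
       (use LpD(1)[OF foldr_band_Lp[OF _ f1]] LpD(1)[OF P] LpD(1)[OF f1] in \<open>auto intro!: borel_measurable_sum\<close>)
qed

end

section \<open>A discrete Hardy inequality\<close>

text \<open>A telescoping majorant for the tail of the series of n^(-3/2). With a, b the two roots,
  the difference is 4 / (a b (a + b)), and b (a + b) <= 4 a^2 since x >= 1.\<close>

lemma inverse_sqrt_diff_ge:
  assumes "1 \<le> (x::real)"
  shows "1 / (x * sqrt x) \<le> 4 / sqrt x - 4 / sqrt (x + 1)"
proof -
  define a where "a = sqrt x"
  define b where "b = sqrt (x + 1)"
  have ab: "0 < a" "0 < b" "a * a = x" "b * b = x + 1" using assms by (auto simp: a_def b_def)
  have b2: "b \<le> 2 * a" unfolding a_def b_def
    using assms by (intro real_le_lsqrt) (auto simp: power_mult_distrib)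
  have d: "(b - a) * (b + a) = 1" using ab by (simp add: algebra_simps)
  have "a * b \<le> a * (2 * a)" using ab b2 by (intro mult_left_mono) auto
  also have "\<dots> = 2 * (a * a)" by simp
  finally have "b * b + a * b \<le> 4 * (a * a)" using ab(3,4) assms by linarith
  then have "b * (b + a) \<le> 4 * (a * a)" by (simp add: algebra_simps)
  then have "a * (b * (b + a)) \<le> a * (4 * (a * a))" using ab by (intro mult_left_mono) auto
  then have "4 / (a * (4 * (a * a))) \<le> 4 / (a * (b * (b + a)))"
    using ab by (intro divide_left_mono) auto
  also have "\<dots> = 4 * ((b - a) * (b + a)) / (a * (b * (b + a)))" by (simp only: d)
  also have "\<dots> = 4 * (b - a) / (a * b)" using ab(1,2) by simp
  also have "\<dots> = 4 / a - 4 / b" using ab(1,2) by (simp add: field_simps)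
  finally show ?thesis using ab(1,3) by (simp add: a_def b_def mult.commute)
qed

text \<open>The companion estimate for partial sums of n^(-1/2).\<close>

lemma sqrt_diff_ge:
  assumes "1 \<le> (x::real)"
  shows "1 / sqrt x \<le> 2 * sqrt x - 2 * sqrt (x - 1)"
proof -
  define a where "a = sqrt x"
  define b where "b = sqrt (x - 1)"
  have ab: "0 < a" "0 \<le> b" "a * a = x" "b * b = x - 1" "b \<le> a" using assms by (auto simp: a_def b_def)
  have "(a - b) * (a + b) = 1" using ab by (simp add: algebra_simps)
  moreover have "(a - b) * (a + b) \<le> (a - b) * (2 * a)" using ab by (intro mult_left_mono) auto
  ultimately have "1 \<le> (2 * a - 2 * b) * a" by (simp add: algebra_simps)
  then have "1 / a \<le> 2 * a - 2 * b" using ab by (simp add: divide_le_eq)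
  then show ?thesis by (simp add: a_def b_def)
qed

text \<open>Every n >= 1 is the value at exactly two integers, n - 1 and -n, so sums over the
  integers become twice sums over the positive integers and no weight vanishes.\<close>

definition abs_bar :: "int \<Rightarrow> nat" where "abs_bar i = nat \<bar>bar i\<bar>"

lemma abs_bar_pos: "1 \<le> abs_bar i"
  by (auto simp: abs_bar_def bar_def)

lemma abs_bar_of_nat: "abs_bar (int n) = Suc n" "abs_bar (- int (Suc n)) = Suc n"
  by (auto simp: abs_bar_def bar_def)

text \<open>The nonnegative k contribute the values 1, ..., N + 1 and the negative ones 1, ...,
  N.\<close>

lemma sum_abs_bar_le:
  fixes g :: "nat \<Rightarrow> real"
  assumes "\<And>n. 0 \<le> g n"
  shows "(\<Sum>k=- int N..int N. g (abs_bar k)) \<le> 2 * (\<Sum>n\<le>N. g (Suc n))"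
proof -
  have "(\<Sum>k=- int N..int N. g (abs_bar k)) = (\<Sum>n\<le>N. g (Suc n)) + (\<Sum>n<N. g (Suc n))"
  proof (induction N)
    case 0
    then show ?case using abs_bar_of_nat(1)[of 0] by simp
  next
    case (Suc N)
    have "{- int (Suc N)..int (Suc N)} = insert (- int (Suc N)) (insert (int (Suc N)) {- int N..int N})"
      by auto
    then have "(\<Sum>k=- int (Suc N)..int (Suc N). g (abs_bar k))
        = g (abs_bar (- int (Suc N))) + (g (abs_bar (int (Suc N))) + (\<Sum>k=- int N..int N. g (abs_bar k)))"
      by (simp del: of_nat_Suc)
    then show ?case by (simp only: abs_bar_of_nat Suc) simp
  qed
  also have "(\<Sum>n<N. g (Suc n)) \<le> (\<Sum>n\<le>N. g (Suc n))"
    using assms by (intro sum_mono2) auto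
  finally show ?thesis by simp
qed

lemma sum_tail_le:
  assumes "1 \<le> m"
  shows "(\<Sum>n\<le>N. (if m \<le> Suc n then 1 else 0) / (real (Suc n) * sqrt (real (Suc n)))) \<le> 4 / sqrt (real m)"
proof -
  \<comment> \<open>The induction needs the telescoped remainder on the right; as long as m exceeds
    N + 1, both sides are 0.\<close>
  have "(\<Sum>n\<le>N. (if m \<le> Suc n then 1 else 0) / (real (Suc n) * sqrt (real (Suc n))))
      \<le> (if m \<le> Suc N then 4 / sqrt (real m) - 4 / sqrt (real (Suc N) + 1) else 0)"
  proof (induction N)
    case 0
    show ?case using assms inverse_sqrt_diff_ge[of 1] by (cases "m = 1") auto
  next
    case (Suc N)
    have step: "1 / (real (Suc (Suc N)) * sqrt (real (Suc (Suc N))))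
        \<le> 4 / sqrt (real (Suc (Suc N))) - 4 / sqrt (real (Suc (Suc N)) + 1)"
      by (rule inverse_sqrt_diff_ge) simp
    consider "m \<le> Suc N" | "m = Suc (Suc N)" | "m > Suc (Suc N)" by linarith
    then show ?case
    proof cases
      case 1
      then show ?thesis using Suc step by (simp add: add.commute add.left_commute)
    next
      case 2
      then show ?thesis using Suc step by simp
    next
      case 3
      then show ?thesis using Suc by simp
    qed
  qed
  also have "\<dots> \<le> 4 / sqrt (real m)" by simp
  finally show ?thesis .
qed

text \<open>The bound proved by induction has min m (N + 1) under the root: it grows by at least the
  new term while terms are still added and stays constant afterwards.\<close>

lemma sum_head_le:
  "(\<Sum>n\<le>N. (if Suc n \<le> m then 1 else 0) / sqrt (real (Suc n))) \<le> 2 * sqrt (real m)"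
proof -
  have "(\<Sum>n\<le>N. (if Suc n \<le> m then 1 else 0) / sqrt (real (Suc n))) \<le> 2 * sqrt (real (min m (Suc N)))"
  proof (induction N)
    case 0
    show ?case using sqrt_diff_ge[of 1] by (cases "m = 0") (auto simp: min_absorb2 Suc_le_eq)
  next
    case (Suc N)
    have step: "1 / sqrt (real (Suc (Suc N))) \<le> 2 * sqrt (real (Suc (Suc N))) - 2 * sqrt (real (Suc N))"
      using sqrt_diff_ge[of "real (Suc (Suc N))"] by simp
    show ?case
    proof (cases "Suc (Suc N) \<le> m")
      case True
      then show ?thesis using Suc step by (simp add: min_def)
    next
      case False
      then show ?thesis using Suc by (simp add: min_def split: if_splits)
    qed
  qed
  also have "\<dots> \<le> 2 * sqrt (real m)" by simp
  finally show ?thesis .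
qed

text \<open>The kernel of the dual Hardy operator, the indicator that l is dominated by i in every
  direction. The product form lets sums over cubes factor into one-dimensional sums.\<close>

definition kern :: "int ^ 'd::finite \<Rightarrow> int ^ 'd \<Rightarrow> real" where
  "kern l i = (\<Prod>q\<in>UNIV. if abs_bar (l $ q) \<le> abs_bar (i $ q) then 1 else 0)"

lemma kern_range: "kern l i = 0 \<or> kern l i = 1"
  by (auto simp: kern_def intro!: prod.neutral prod_zero)

text \<open>Schur's test with the weights \<open>n powr (3/2)\<close> and \<open>n powr (-1/2)\<close>, where \<open>n = abs_bar k\<close>.\<close>

lemma multi_hardy:
  fixes a :: "int ^ 'd::finite \<Rightarrow> real"
  assumes J: "J \<subseteq> cube N"
  shows "(\<Sum>l\<in>cube N. (\<Sum>i\<in>J. kern l i * a i)\<^sup>2)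
    \<le> 32 ^ CARD('d) * (\<Sum>i\<in>J. (\<Prod>q\<in>UNIV. (real (abs_bar (i $ q)))\<^sup>2) * (a i)\<^sup>2)"
proof -
  have fin: "finite J" using J finite_cube finite_subset by blast
  define w where "w k = real (abs_bar k) * sqrt (real (abs_bar k))" for k
  define v where "v k = 1 / sqrt (real (abs_bar k))" for k
  define W where "W i = (\<Prod>q\<in>UNIV. w (i $ q))" for i :: "int ^ 'd"
  define V where "V l = (\<Prod>q\<in>UNIV. v (l $ q))" for l :: "int ^ 'd"
  have n0: "0 < real (abs_bar k)" for k using abs_bar_pos[of k] by simp
  have wv: "0 < w k" "0 < v k" for k using n0[of k] by (auto simp: w_def v_def)
  have WV: "0 < W i" "0 < V i" for i using wv by (auto simp: W_def V_def intro!: prod_pos)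
  let ?\<kappa> = "\<lambda>l i. (if abs_bar l \<le> abs_bar i then 1 else 0) :: real"
  \<comment> \<open>Here 8 = 2 * 4: two signs of k, and the tail bound for n^(-3/2).\<close>
  have A1: "(\<Sum>k=- int N..int N. ?\<kappa> l k / w k) \<le> 8 * v l" for l
  proof -
    have "(\<Sum>k=- int N..int N. ?\<kappa> l k / w k)
        \<le> 2 * (\<Sum>n\<le>N. (if abs_bar l \<le> Suc n then 1 else 0) / (real (Suc n) * sqrt (real (Suc n))))"
      unfolding w_def by (rule sum_abs_bar_le[where g = "\<lambda>n. (if abs_bar l \<le> n then 1 else 0) / (real n * sqrt (real n))"]) simp
    then show ?thesis using sum_tail_le[OF abs_bar_pos[of l], of N] by (simp add: v_def)
  qed
  \<comment> \<open>Here 4 = 2 * 2: two signs of k, and the bound for partial sums of n^(-1/2). The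
    resulting n^(1/2), times n^(3/2) from \<open>w\<close>, is the weight n^2 of the
    hypothesis.\<close>
  have B1: "(\<Sum>k=- int N..int N. ?\<kappa> k i * v k) * w i \<le> 4 * (real (abs_bar i))\<^sup>2" for i
  proof -
    have "(\<Sum>k=- int N..int N. ?\<kappa> k i * v k)
        \<le> 2 * (\<Sum>n\<le>N. (if Suc n \<le> abs_bar i then 1 else 0) / sqrt (real (Suc n)))"
      using sum_abs_bar_le[where g = "\<lambda>n. (if n \<le> abs_bar i then 1 else 0) / sqrt (real n)" and N = N]
      by (simp add: v_def)
    also have "\<dots> \<le> 4 * sqrt (real (abs_bar i))" using sum_head_le[of "abs_bar i" N] by simp
    finally have "(\<Sum>k=- int N..int N. ?\<kappa> k i * v k) * w i \<le> 4 * sqrt (real (abs_bar i)) * w i"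
      using wv(1)[of i] by (intro mult_right_mono) auto
    also have "\<dots> = 4 * (real (abs_bar i))\<^sup>2" by (simp add: w_def power2_eq_square mult.left_commute)
    finally show ?thesis .
  qed
  have A: "(\<Sum>i\<in>J. kern l i / W i) \<le> 8 ^ CARD('d) * V l" for l
  proof -
    have "(\<Sum>i\<in>J. kern l i / W i) \<le> (\<Sum>i\<in>cube N. kern l i / W i)"
    proof (rule sum_mono2[OF finite_cube J])
      show "0 \<le> kern l i / W i" for i using kern_range[of l i] WV(1)[of i] by auto
    qed
    also have "\<dots> = (\<Prod>q\<in>UNIV. \<Sum>k=- int N..int N. ?\<kappa> (l $ q) k / w k)"
      unfolding prod_sum_cube[symmetric] kern_def W_def by (simp only: prod_dividef)
    also have "\<dots> \<le> (\<Prod>q\<in>(UNIV :: 'd set). 8 * v (l $ q))"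
      using A1 wv by (intro prod_mono) (auto intro!: sum_nonneg simp: less_imp_le)
    also have "\<dots> = 8 ^ CARD('d) * V l" by (simp add: V_def prod.distrib)
    finally show ?thesis .
  qed
  have B: "(\<Sum>l\<in>cube N. kern l i * V l) * W i \<le> 4 ^ CARD('d) * (\<Prod>q\<in>UNIV. (real (abs_bar (i $ q)))\<^sup>2)" for i
  proof -
    have "(\<Sum>l\<in>cube N. kern l i * V l) * W i = (\<Prod>q\<in>UNIV. (\<Sum>k=- int N..int N. ?\<kappa> k (i $ q) * v k) * w (i $ q))"
      unfolding prod.distrib prod_sum_cube[symmetric] kern_def W_def V_def by (simp only: prod.distrib)
    also have "\<dots> \<le> (\<Prod>q\<in>(UNIV :: 'd set). 4 * (real (abs_bar (i $ q)))\<^sup>2)"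
      using B1 wv by (intro prod_mono) (auto intro!: sum_nonneg mult_nonneg_nonneg simp: less_imp_le)
    also have "\<dots> = 4 ^ CARD('d) * (\<Prod>q\<in>UNIV. (real (abs_bar (i $ q)))\<^sup>2)" by (simp add: prod.distrib)
    finally show ?thesis .
  qed
  \<comment> \<open>Cauchy-Schwarz with the weight W split evenly between the factors. The kernel
    takes only the values 0 and 1, so it equals its square and can be put into both factors.\<close>
  have CS: "(\<Sum>i\<in>J. kern l i * a i)\<^sup>2 \<le> (8 ^ CARD('d) * V l) * (\<Sum>i\<in>J. kern l i * (W i * (a i)\<^sup>2))" for l
  proof -
    have kk: "(kern l i)\<^sup>2 = kern l i" for i using kern_range[of l i] by auto
    have "(\<Sum>i\<in>J. kern l i * a i) = (\<Sum>i\<in>J. (kern l i / sqrt (W i)) * (kern l i * sqrt (W i) * a i))"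
    proof (intro sum.cong refl)
      fix i show "kern l i * a i = (kern l i / sqrt (W i)) * (kern l i * sqrt (W i) * a i)"
        using kern_range[of l i] WV(1)[of i] by auto
    qed
    then have "(\<Sum>i\<in>J. kern l i * a i)\<^sup>2 \<le> (\<Sum>i\<in>J. (kern l i / sqrt (W i))\<^sup>2) * (\<Sum>i\<in>J. (kern l i * sqrt (W i) * a i)\<^sup>2)"
      using Cauchy_Schwarz_ineq_sum[of "\<lambda>i. kern l i / sqrt (W i)" "\<lambda>i. kern l i * sqrt (W i) * a i" J] by simp
    also have "\<dots> = (\<Sum>i\<in>J. kern l i / W i) * (\<Sum>i\<in>J. kern l i * (W i * (a i)\<^sup>2))"
      using WV(1) by (simp add: power_divide power_mult_distrib kk less_imp_le mult.assoc)
    also have "\<dots> \<le> (8 ^ CARD('d) * V l) * (\<Sum>i\<in>J. kern l i * (W i * (a i)\<^sup>2))"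
    proof (rule mult_right_mono[OF A])
      show "0 \<le> (\<Sum>i\<in>J. kern l i * (W i * (a i)\<^sup>2))"
      proof (rule sum_nonneg)
        fix i show "0 \<le> kern l i * (W i * (a i)\<^sup>2)" using kern_range[of l i] WV(1)[of i] by auto
      qed
    qed
    finally show ?thesis .
  qed
  have "(\<Sum>l\<in>cube N. (\<Sum>i\<in>J. kern l i * a i)\<^sup>2)
      \<le> (\<Sum>l\<in>cube N. (8 ^ CARD('d) * V l) * (\<Sum>i\<in>J. kern l i * (W i * (a i)\<^sup>2)))"
    by (intro sum_mono CS)
  also have "\<dots> = 8 ^ CARD('d) * (\<Sum>i\<in>J. \<Sum>l\<in>cube N. V l * (kern l i * (W i * (a i)\<^sup>2)))"
    by (subst sum.swap) (simp add: sum_distrib_left mult.assoc)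
  also have "\<dots> = 8 ^ CARD('d) * (\<Sum>i\<in>J. ((\<Sum>l\<in>cube N. kern l i * V l) * W i) * (a i)\<^sup>2)"
    by (simp add: sum_distrib_right sum_distrib_left mult.commute mult.left_commute mult.assoc)
  also have "\<dots> \<le> 8 ^ CARD('d) * (\<Sum>i\<in>J. (4 ^ CARD('d) * (\<Prod>q\<in>UNIV. (real (abs_bar (i $ q)))\<^sup>2)) * (a i)\<^sup>2)"
    by (intro mult_left_mono sum_mono mult_right_mono B) auto
  also have "\<dots> = 32 ^ CARD('d) * (\<Sum>i\<in>J. (\<Prod>q\<in>UNIV. (real (abs_bar (i $ q)))\<^sup>2) * (a i)\<^sup>2)"
  proof -
    have "(32::real) ^ CARD('d) = 8 ^ CARD('d) * 4 ^ CARD('d)" by (simp flip: power_mult_distrib)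
    then show ?thesis by (simp add: sum_distrib_left mult.assoc)
  qed
  finally show ?thesis .
qed

section \<open>The decomposition for a finite sum\<close>

definition ind :: "'d::finite set \<Rightarrow> int ^ 'd" where
  "ind B = (\<chi> q. if q \<in> B then 1 else 0)"

lemma ind_insert: "q \<notin> B \<Longrightarrow> ind (insert q B) = ind B + axis q 1"
  by (auto simp: ind_def axis_def vec_eq_iff)

lemma sum_Pow_insert:
  assumes "q \<notin> S" "finite S"
  shows "(\<Sum>B\<in>Pow (insert q S). g B) = (\<Sum>B\<in>Pow S. g B) + (\<Sum>B\<in>Pow S. g (insert q B))"
proof -
  have "(\<Sum>B\<in>Pow (insert q S). g B) = (\<Sum>B\<in>Pow S. g B) + (\<Sum>B\<in>insert q ` Pow S. g B)"
    unfolding Pow_insert using assms by (intro sum.union_disjoint) auto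
  moreover have "inj_on (insert q) (Pow S)"
    using assms(1) by (auto simp: inj_on_def)
  ultimately show ?thesis by (simp add: sum.reindex)
qed

definition tau :: "int \<Rightarrow> int \<Rightarrow> real" where
  "tau l i = (if 0 \<le> l \<and> l < i then - 1 else if i \<le> l \<and> l \<le> - 1 then 1 else 0)"

text \<open>With \<open>u k\<close> in the role of \<open>U\<^sup>k h\<close>, \<open>tau\<close> solves
  \<open>u i = u 0 + (\<Sum>l. tau l i * (u l - u (l + 1)))\<close>.\<close>

lemma tau_identity:
  "(if m = 0 then 1 else 0) + (- tau (m - 1) i + tau m i) = (if m = i then 1 else 0)"
  by (auto simp: tau_def)

text \<open>The coefficient in g_S of U^l applied to U^(-i) P_i f: a direction in S takes the term
  U^0 of the one-dimensional identity, a direction outside S the coefficient of U^l in G_i.\<close>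

definition coef :: "'d::finite set \<Rightarrow> int ^ 'd \<Rightarrow> int ^ 'd \<Rightarrow> real" where
  "coef S l i = (\<Prod>q\<in>UNIV. if q \<in> S then (if l $ q = 0 then 1 else 0) else tau (l $ q) (i $ q))"

text \<open>The shift in \<open>bar\<close> fits both factors: \<open>tau l i\<close> is nonzero
  only if l lies between 0 and i on the same side, which gives
  \<open>abs_bar l \<le> abs_bar i\<close>, and l = 0 has the least possible value 1.\<close>

lemma abs_coef_le: "\<bar>coef S l i\<bar> \<le> kern l i"
  unfolding coef_def kern_def abs_prod
  by (intro prod_mono) (auto simp: tau_def abs_bar_def bar_def)

lemma coef_support:
  assumes "coef S l i \<noteq> 0"
  shows "\<bar>l $ q\<bar> \<le> \<bar>i $ q\<bar>" "q \<in> S \<Longrightarrow> l $ q = 0"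
proof -
  have "(if q \<in> S then (if l $ q = 0 then 1 else 0) else tau (l $ q) (i $ q)) \<noteq> 0"
    using assms unfolding coef_def by (simp only: prod_zero_iff finite) blast
  then show "\<bar>l $ q\<bar> \<le> \<bar>i $ q\<bar>" "q \<in> S \<Longrightarrow> l $ q = 0"
    by (auto simp: tau_def split: if_splits)
qed

lemma coef_outside_cube:
  assumes "i \<in> cube N" "l \<notin> cube N"
  shows "coef S l i = 0"
proof (rule ccontr)
  assume "coef S l i \<noteq> 0"
  then have "\<bar>l $ q\<bar> \<le> int N" for q
    using coef_support(1)[of S l i q] assms(1) by (auto simp: cube_def intro: order_trans)
  then show False using assms(2) by (simp add: cube_def)
qed

text \<open>The total coefficient of U^m after all coboundary operators are expanded. With the sign
  of B absorbed into \<alpha>, the sums over S and B expand the product over q of \<delta> +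
  (\<alpha> + \<beta>), and \<open>tau_identity\<close> evaluates each factor.\<close>

lemma coef_identity:
  fixes m i :: "int ^ 'd::finite"
  shows "(\<Sum>S\<in>UNIV. \<Sum>B\<in>Pow (- S). (- 1) ^ card B * coef S (m - ind B) i) = (if m = i then 1 else 0)"
proof -
  define \<delta> where "\<delta> q = (if m $ q = 0 then 1 else 0 :: real)" for q
  define \<alpha> where "\<alpha> q = - tau (m $ q - 1) (i $ q)" for q
  define \<beta> where "\<beta> q = tau (m $ q) (i $ q)" for q
  have "(- 1) ^ card B * coef S (m - ind B) i = (\<Prod>q\<in>S. \<delta> q) * ((\<Prod>q\<in>B. \<alpha> q) * (\<Prod>q\<in>- S - B. \<beta> q))"
    if B: "B \<in> Pow (- S)" for S B
  proof -
    have "coef S (m - ind B) i = (\<Prod>q\<in>UNIV. if q \<in> S then \<delta> q else if q \<in> B then - \<alpha> q else \<beta> q)"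
      unfolding coef_def using B by (intro prod.cong) (auto simp: ind_def \<delta>_def \<alpha>_def \<beta>_def)
    also have "\<dots> = (\<Prod>q\<in>S. \<delta> q) * (\<Prod>q\<in>- S. if q \<in> B then - \<alpha> q else \<beta> q)"
      by (subst prod.If_cases) auto
    also have "(\<Prod>q\<in>- S. if q \<in> B then - \<alpha> q else \<beta> q) = (\<Prod>q\<in>B. - \<alpha> q) * (\<Prod>q\<in>- S - B. \<beta> q)"
    proof -
      have "- S \<inter> {q. q \<in> B} = B" "- S \<inter> - {q. q \<in> B} = - S - B" using B by auto
      then show ?thesis by (subst prod.If_cases) auto
    qed
    finally show ?thesis by (simp add: prod_uminus)
  qed
  then have "(\<Sum>S\<in>UNIV. \<Sum>B\<in>Pow (- S). (- 1) ^ card B * coef S (m - ind B) i)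
      = (\<Sum>S\<in>UNIV. \<Sum>B\<in>Pow (- S). (\<Prod>q\<in>S. \<delta> q) * ((\<Prod>q\<in>B. \<alpha> q) * (\<Prod>q\<in>- S - B. \<beta> q)))"
    by (intro sum.cong refl) auto
  also have "\<dots> = (\<Sum>S\<in>UNIV. (\<Prod>q\<in>S. \<delta> q) * (\<Prod>q\<in>- S. \<alpha> q + \<beta> q))"
    by (simp add: prod_add sum_distrib_left)
  also have "\<dots> = (\<Prod>q\<in>UNIV. \<delta> q + (\<alpha> q + \<beta> q))"
    by (simp add: prod_add Compl_eq_Diff_UNIV)
  also have "\<dots> = (\<Prod>q\<in>UNIV. if m $ q = i $ q then 1 else 0)"
    unfolding \<delta>_def \<alpha>_def \<beta>_def tau_identity ..
  also have "\<dots> = (if m = i then 1 else 0)"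
    by (auto simp: vec_eq_iff intro!: prod.neutral prod_zero)
  finally show ?thesis .
qed

lemma finite_decomposition:
  fixes u :: "int ^ 'd::finite \<Rightarrow> real"
  assumes i: "i \<in> cube N"
  shows "(\<Sum>S\<in>UNIV. \<Sum>B\<in>Pow (- S). (- 1) ^ card B * (\<Sum>l\<in>cube N. coef S l i * u (l + ind B))) = u i"
proof -
  have shift: "(\<Sum>l\<in>cube N. coef S l i * u (l + ind B)) = (\<Sum>m\<in>cube (Suc N). coef S (m - ind B) i * u m)"
    \<comment> \<open>Since \<open>ind B\<close> raises each coordinate by at most 1, m = l + ind B
      stays in the next larger cube; the indices m added there have l outside the cube, where
      \<open>coef\<close> vanishes.\<close>
    for S B
  proof -
    have "(\<Sum>l\<in>cube N. coef S l i * u (l + ind B)) = (\<Sum>m\<in>(\<lambda>l. l + ind B) ` cube N. coef S (m - ind B) i * u m)"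
      by (subst sum.reindex) (auto simp: inj_on_def)
    also have "\<dots> = (\<Sum>m\<in>cube (Suc N). coef S (m - ind B) i * u m)"
    proof (rule sum.mono_neutral_left)
      show "(\<lambda>l. l + ind B) ` cube N \<subseteq> cube (Suc N)"
      proof
        fix m assume "m \<in> (\<lambda>l. l + ind B) ` cube N"
        then obtain l where l: "l \<in> cube N" "m = l + ind B" by auto
        have "\<bar>m $ q\<bar> \<le> int (Suc N)" for q
        proof -
          have "\<bar>l $ q\<bar> \<le> int N" "\<bar>ind B $ q\<bar> \<le> 1" using l(1) by (auto simp: cube_def ind_def)
          then show ?thesis using l(2) by simp
        qed
        then show "m \<in> cube (Suc N)" by (simp add: cube_def)
      qed
      show "\<forall>m\<in>cube (Suc N) - (\<lambda>l. l + ind B) ` cube N. coef S (m - ind B) i * u m = 0"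
      proof
        fix m assume "m \<in> cube (Suc N) - (\<lambda>l. l + ind B) ` cube N"
        then have "m - ind B \<notin> cube N" by (metis DiffD2 diff_add_cancel imageI)
        then show "coef S (m - ind B) i * u m = 0" using coef_outside_cube[OF i] by simp
      qed
    qed simp
    finally show ?thesis .
  qed
  have "(\<Sum>S\<in>UNIV. \<Sum>B\<in>Pow (- S). (- 1) ^ card B * (\<Sum>l\<in>cube N. coef S l i * u (l + ind B)))
      = (\<Sum>S\<in>UNIV. \<Sum>m\<in>cube (Suc N). \<Sum>B\<in>Pow (- S). (- 1) ^ card B * coef S (m - ind B) i * u m)"
    unfolding shift by (intro sum.cong refl, subst sum.swap) (simp add: sum_distrib_left mult.assoc)
  also have "\<dots> = (\<Sum>m\<in>cube (Suc N). (\<Sum>S\<in>UNIV. \<Sum>B\<in>Pow (- S). (- 1) ^ card B * coef S (m - ind B) i) * u m)"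
    by (subst sum.swap) (simp add: sum_distrib_right)
  also have "\<dots> = (\<Sum>m\<in>cube (Suc N). if m = i then u m else 0)"
    unfolding coef_identity by (intro sum.cong) auto
  also have "\<dots> = u i"
  proof -
    have "i \<in> cube (Suc N)" using i by (auto simp: cube_def intro: order_trans)
    then show ?thesis by simp
  qed
  finally show ?thesis .
qed

lemma real_abs_bar_power2: "(real (abs_bar k))\<^sup>2 = (real_of_int (bar k))\<^sup>2"
  by (simp add: abs_bar_def)

section \<open>The functions g_S and the passage to the limit\<close>

context commuting_filtration
begin

text \<open>Expansion of the product of the commuting operators I - U_q; B is the set of directions
  from which the shift is chosen. The induction must vary x, since the outermost factor also
  evaluates the rest at a shifted point.\<close>

lemma op_prod_cobdry:
  assumes x: "x \<in> space M"
  shows "op_prod (cobdry T) A g x = (\<Sum>B\<in>Pow A. (- 1) ^ card B * g (T (ind B) x))"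
proof -
  have "foldr (cobdry T) qs g x = (\<Sum>B\<in>Pow (set qs). (- 1) ^ card B * g (T (ind B) x))"
    if "distinct qs" for qs
    using that x
  proof (induction qs arbitrary: x)
    case Nil
    have "ind {} = (0 :: int ^ 'd::{finite,linorder})" by (simp add: ind_def vec_eq_iff)
    then show ?case using T_0[OF Nil(2)] by simp
  next
    case (Cons q qs)
    let ?e = "axis q 1 :: int ^ 'd::{finite,linorder}"
    have q: "q \<notin> set qs" "distinct qs" using Cons.prems by auto
    have "foldr (cobdry T) (q # qs) g x = foldr (cobdry T) qs g x - foldr (cobdry T) qs g (T ?e x)"
      by (simp add: cobdry_def koopman_def)
    also have "\<dots> = (\<Sum>B\<in>Pow (set qs). (- 1) ^ card B * g (T (ind B) x))
        - (\<Sum>B\<in>Pow (set qs). (- 1) ^ card B * g (T (ind B) (T ?e x)))"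
      using Cons.IH[OF q(2)] Cons.prems(2) T_space by simp
    also have "(\<Sum>B\<in>Pow (set qs). (- 1) ^ card B * g (T (ind B) (T ?e x)))
        = - (\<Sum>B\<in>Pow (set qs). (- 1) ^ card (insert q B) * g (T (ind (insert q B)) x))"
      unfolding sum_negf[symmetric]
    proof (intro sum.cong refl)
      fix B assume "B \<in> Pow (set qs)"
      then have "q \<notin> B" "finite B" using q finite_subset[of B "set qs"] by auto
      then show "(- 1) ^ card B * g (T (ind B) (T ?e x)) = - ((- 1) ^ card (insert q B) * g (T (ind (insert q B)) x))"
        using T_add[OF Cons.prems(2), of "ind B" ?e] by (simp add: ind_insert)
    qed
    finally show ?case using q by (simp add: sum_Pow_insert)
  qed
  from this[of "sorted_list_of_set A"] show ?thesis by (simp add: op_prod_def)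
qed

text \<open>The contribution of the terms \<open>P\<^sub>i f\<close>, \<open>i \<in> J\<close>, to \<open>g\<^sub>S\<close> when \<open>h i = P\<^sub>i f\<close> and \<open>J \<subseteq> cube N\<close>.\<close>

definition gpart :: "(int ^ 'd::{finite,linorder} \<Rightarrow> 'a \<Rightarrow> real) \<Rightarrow> 'd::{finite,linorder} set \<Rightarrow> nat \<Rightarrow> (int ^ 'd::{finite,linorder}) set \<Rightarrow> 'a \<Rightarrow> real" where
  "gpart h S N J = (\<lambda>x. \<Sum>i\<in>J. \<Sum>l\<in>cube N. coef S l i * h i (T (l - i) x))"

text \<open>\<open>h i\<close> sits at index i in every direction and \<open>T (l - i)\<close> moves
  it to l, whichever i it came from. Pieces with the same l can therefore be collected into one
  martingale difference.\<close>

lemma gpart_term_mdiff: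
  assumes p: "1 \<le> p" and h: "\<And>i q. h i \<in> mdiff p q (i $ q)"
  shows "(\<lambda>x. c * h i (T (l - i) x)) \<in> mdiff p q (l $ q)"
  using mdiff_cmult[OF p mdiff_compose[OF p h, of i "l - i" q]] by simp

lemma gpart_Lp:
  assumes p: "1 \<le> p" and h: "\<And>i q. h i \<in> mdiff p q (i $ q)"
  shows "gpart h S N J \<in> Lp M p"
  unfolding gpart_def using gpart_term_mdiff[OF p h] by (intro Lp_sum[OF p]) (blast intro: mdiff_Lp)

lemma gpart_mdiff:
  assumes p: "1 \<le> p" and h: "\<And>i q. h i \<in> mdiff p q (i $ q)" and q: "q \<in> S"
  shows "gpart h S N J \<in> mdiff p q 0"
  unfolding gpart_def
proof (intro mdiff_sum[OF p])
  fix i l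
  show "(\<lambda>x. coef S l i * h i (T (l - i) x)) \<in> mdiff p q 0"
  proof (cases "coef S l i = 0")
    case True
    then show ?thesis using mdiff_sum[OF p, of "{}" _ q 0] by simp
  next
    case False
    then show ?thesis using gpart_term_mdiff[OF p h, of "coef S l i" i l q] coef_support(2)[OF False q] by simp
  qed
qed

text \<open>Exchanging the two sums gives pieces Y_l that are martingale differences in all
  directions. The triangle inequality is used only inside one Y_l, where invariance of the norm
  under the action leaves the kernel sum bounded by \<open>multi_hardy\<close>.\<close>

lemma gpart_norm:
  assumes p: "2 \<le> p" and h: "\<And>i q. h i \<in> mdiff p q (i $ q)" and J: "J \<subseteq> cube N"
  shows "(Lp_norm M p (gpart h S N J))\<^sup>2 \<le> (4 * ((p + 1) powr p + p\<^sup>2)) ^ CARD('d) * 32 ^ CARD('d) *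
    (\<Sum>i\<in>J. (\<Prod>q\<in>UNIV. (real_of_int (bar (i $ q)))\<^sup>2) * (Lp_norm M p (h i))\<^sup>2)"
proof -
  have p1: "1 \<le> p" using p by simp
  let ?C = "(4 * ((p + 1) powr p + p\<^sup>2)) ^ CARD('d)"
  have C: "0 \<le> ?C" by simp
  define Y where "Y l = (\<lambda>x. \<Sum>i\<in>J. coef S l i * h i (T (l - i) x))" for l
  have Y: "Y l \<in> mdiff p q (l $ q)" for l q
    unfolding Y_def by (intro mdiff_sum[OF p1] gpart_term_mdiff[OF p1 h])
  have normY: "Lp_norm M p (Y l) \<le> (\<Sum>i\<in>J. kern l i * Lp_norm M p (h i))" for l
  proof -
    have hL: "h i \<in> Lp M p" for i using mdiff_Lp[OF h] .
    have "Lp_norm M p (Y l) \<le> (\<Sum>i\<in>J. Lp_norm M p (\<lambda>x. coef S l i * h i (T (l - i) x)))"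
      unfolding Y_def using hL by (intro Lp_norm_sum[OF p1] Lp_cmult Lp_compose(1))
    also have "\<dots> = (\<Sum>i\<in>J. \<bar>coef S l i\<bar> * Lp_norm M p (h i))"
      by (simp add: Lp_norm_cmult[OF p1] Lp_compose(2)[OF hL])
    also have "\<dots> \<le> (\<Sum>i\<in>J. kern l i * Lp_norm M p (h i))"
      by (intro sum_mono mult_right_mono abs_coef_le Lp_norm_nonneg)
    finally show ?thesis .
  qed
  have "gpart h S N J = (\<lambda>x. \<Sum>l\<in>cube N. Y l x)"
    unfolding gpart_def Y_def by (intro ext sum.swap)
  then have "(Lp_norm M p (gpart h S N J))\<^sup>2 \<le> ?C * (\<Sum>l\<in>cube N. (Lp_norm M p (Y l))\<^sup>2)"
    using Lp_norm_multi_mdiff_sum[OF p finite_cube, of N Y] Y by simp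
  also have "\<dots> \<le> ?C * (\<Sum>l\<in>cube N. (\<Sum>i\<in>J. kern l i * Lp_norm M p (h i))\<^sup>2)"
    by (intro mult_left_mono[OF _ C] sum_mono power_mono normY Lp_norm_nonneg)
  also have "\<dots> \<le> ?C * (32 ^ CARD('d) * (\<Sum>i\<in>J. (\<Prod>q\<in>UNIV. (real (abs_bar (i $ q)))\<^sup>2) * (Lp_norm M p (h i))\<^sup>2))"
    by (intro mult_left_mono[OF _ C] multi_hardy J)
  finally show ?thesis by (simp add: real_abs_bar_power2 mult.assoc)
qed

text \<open>The cube of l only has to contain \<open>J\<close>, because \<open>coef\<close> vanishes
  beyond it. Partial sums over different cubes of i can thus be written with the same range of
  l.\<close>

lemma gpart_extend:
  assumes N: "N \<le> N'" and J: "J \<subseteq> cube N"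
  shows "gpart h S N' J = gpart h S N J"
  unfolding gpart_def
proof (rule ext, rule sum.cong[OF refl])
  fix x i assume "i \<in> J"
  then have i: "i \<in> cube N" using J by auto
  have "cube N \<subseteq> (cube N' :: (int ^ 'd::{finite,linorder}) set)"
    using N by (auto simp: cube_def intro: order_trans)
  then show "(\<Sum>l\<in>cube N'. coef S l i * h i (T (l - i) x)) = (\<Sum>l\<in>cube N. coef S l i * h i (T (l - i) x))"
    by (intro sum.mono_neutral_right) (simp_all add: coef_outside_cube[OF i])
qed

lemma gpart_decomposition:
  assumes x: "x \<in> space M"
  shows "(\<Sum>S\<in>UNIV. \<Sum>B\<in>Pow (- S). (- 1) ^ card B * gpart h S N (cube N) (T (ind B) x)) = (\<Sum>i\<in>cube N. h i x)"
proof -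
  have "gpart h S N (cube N) (T (ind B) x) = (\<Sum>i\<in>cube N. \<Sum>l\<in>cube N. coef S l i * h i (T ((l + ind B) - i) x))" for S B
  proof -
    have "T (l - i) (T (ind B) x) = T ((l + ind B) - i) x" for l i
      using T_add[OF x, of "l - i" "ind B"] by (simp add: algebra_simps)
    then show ?thesis by (simp add: gpart_def)
  qed
  then have "(\<Sum>S\<in>UNIV. \<Sum>B\<in>Pow (- S). (- 1) ^ card B * gpart h S N (cube N) (T (ind B) x))
      = (\<Sum>S\<in>UNIV. \<Sum>B\<in>Pow (- S). \<Sum>i\<in>cube N. (- 1) ^ card B * (\<Sum>l\<in>cube N. coef S l i * h i (T ((l + ind B) - i) x)))"
    by (simp add: sum_distrib_left)
  also have "\<dots> = (\<Sum>S\<in>UNIV. \<Sum>i\<in>cube N. \<Sum>B\<in>Pow (- S). (- 1) ^ card B * (\<Sum>l\<in>cube N. coef S l i * h i (T ((l + ind B) - i) x)))"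
    by (intro sum.cong refl sum.swap)
  also have "\<dots> = (\<Sum>i\<in>cube N. \<Sum>S\<in>UNIV. \<Sum>B\<in>Pow (- S). (- 1) ^ card B * (\<Sum>l\<in>cube N. coef S l i * h i (T ((l + ind B) - i) x)))"
    by (rule sum.swap)
  also have "\<dots> = (\<Sum>i\<in>cube N. h i x)"
  proof (intro sum.cong refl)
    fix i :: "int ^ 'd::{finite,linorder}" assume i: "i \<in> cube N"
    show "(\<Sum>S\<in>UNIV. \<Sum>B\<in>Pow (- S). (- 1) ^ card B * (\<Sum>l\<in>cube N. coef S l i * h i (T ((l + ind B) - i) x))) = h i x"
      \<comment> \<open>The abstract sequence is the orbit of \<open>h i\<close>, normalised so that
        its value at m = i is \<open>h i x\<close>.\<close>
      using finite_decomposition[OF i, of "\<lambda>m. h i (T (m - i) x)"] T_0[OF x] by simp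
  qed
  finally show ?thesis .
qed

theorem decomposition:
  assumes p: "2 \<le> p" and f: "f \<in> Lp M p" and reg: "regular M T F f"
    and summable: "(\<lambda>i. (\<Prod>q\<in>UNIV. (real_of_int (bar (i $ q)))\<^sup>2) * (Lp_norm M p (proj M T F i f))\<^sup>2) summable_on UNIV"
  obtains g where "\<And>S. g S \<in> Lp M p" "\<And>S q. q \<in> S \<Longrightarrow> g S \<in> mdiff p q 0"
    "AE x in M. f x = (\<Sum>S\<in>UNIV. op_prod (cobdry T) (- S) (g S) x)"
proof -
  have p1: "1 \<le> p" using p by simp
  define h where "h i = proj M T F i f" for i
  have h: "h i \<in> mdiff p q (i $ q)" for i q unfolding h_def by (rule proj_mdiff[OF p1 f])
  define A where "A i = (\<Prod>q\<in>UNIV. (real_of_int (bar (i $ q)))\<^sup>2) * (Lp_norm M p (h i))\<^sup>2" for i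
  have A0: "0 \<le> A i" for i by (auto simp: A_def intro!: mult_nonneg_nonneg prod_nonneg)
  have As: "A summable_on UNIV" using summable by (simp add: A_def[abs_def] h_def)
  define s where "s N = (\<Sum>i\<in>cube N. A i)" for N
  have cube_mono: "cube m \<subseteq> (cube n :: (int ^ 'd::{finite,linorder}) set)" if "m \<le> n" for m n
    using that by (auto simp: cube_def intro: order_trans)
  have "incseq s"
    unfolding incseq_def s_def using A0 by (intro allI impI sum_mono2 finite_cube cube_mono)
  moreover have "s N \<le> infsum A UNIV" for N
    unfolding s_def using As A0 by (intro finite_sum_le_infsum) auto
  ultimately have cau: "Cauchy s"
    using incseq_convergent[of s "infsum A UNIV"] LIMSEQ_imp_Cauchy by blast
  let ?G = "\<lambda>S N. gpart h S N (cube N)"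
  define C where "C = (4 * ((p + 1) powr p + p\<^sup>2)) ^ CARD('d) * 32 ^ CARD('d)"
  have C: "0 < C"
    unfolding C_def using p by (intro mult_pos_pos zero_less_power add_pos_nonneg) auto
  have GL: "?G S N \<in> Lp M p" for S N by (rule gpart_Lp[OF p1 h])
  have dist: "(Lp_norm M p (\<lambda>x. ?G S n x - ?G S m x))\<^sup>2 \<le> C * (s n - s m)" if "m \<le> n" for S m n
  proof -
    \<comment> \<open>Once both partial sums use the larger cube for l, their difference contains
      just the i in \<open>cube n - cube m\<close>, so its norm is controlled by an increment of the
      convergent sums \<open>s\<close>.\<close>
    have "?G S n x - ?G S m x = gpart h S n (cube n - cube m) x" for x
    proof -
      have "?G S m x = gpart h S n (cube m) x"
        using gpart_extend[OF that, of "cube m" h S] by simp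
      then show ?thesis unfolding gpart_def
        using sum_diff[OF finite_cube cube_mono[OF that], of "\<lambda>i. \<Sum>l\<in>cube n. coef S l i * h i (T (l - i) x)"]
        by simp
    qed
    moreover have "(\<Sum>i\<in>cube n - cube m. A i) = s n - s m"
      unfolding s_def by (rule sum_diff[OF finite_cube cube_mono[OF that]])
    ultimately show ?thesis
      using gpart_norm[OF p h, of "cube n - cube m" n S] by (simp add: C_def A_def[abs_def])
  qed
  have "\<exists>v. v \<in> Lp M p \<and> Lp_lim M p (?G S) v" for S
  proof -
    have "\<exists>N. \<forall>m\<ge>N. \<forall>n\<ge>N. Lp_norm M p (\<lambda>x. ?G S m x - ?G S n x) < e" if "e > 0" for e
    proof -
      have e2: "e\<^sup>2 / C > 0" using that C by simp
      obtain N where N: "\<And>m n. m \<ge> N \<Longrightarrow> n \<ge> N \<Longrightarrow> norm (s m - s n) < e\<^sup>2 / C"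
        using CauchyD[OF cau e2] by blast
      have le: "Lp_norm M p (\<lambda>x. ?G S n x - ?G S m x) < e" if mn: "m \<ge> N" "n \<ge> N" "m \<le> n" for m n
      proof -
        have "C * (s n - s m) \<le> C * norm (s n - s m)" using C by (intro mult_left_mono) auto
        also have "\<dots> < C * (e\<^sup>2 / C)" using N[OF mn(2,1)] C by (intro mult_strict_left_mono) auto
        finally have "(Lp_norm M p (\<lambda>x. ?G S n x - ?G S m x))\<^sup>2 < e\<^sup>2" using dist[OF mn(3), of S] C by simp
        then show ?thesis using \<open>e > 0\<close> by (intro power2_less_imp_less[of _ e]) auto
      qed
      have "Lp_norm M p (\<lambda>x. ?G S m x - ?G S n x) < e" if mn: "m \<ge> N" "n \<ge> N" for m n
        using le[OF mn] le[OF mn(2,1)] Lp_norm_minus_commute[of M p "?G S m" "?G S n"] by linarith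
      then show ?thesis by blast
    qed
    from Lp_complete[OF p1 GL this] show ?thesis unfolding Lp_lim_def by blast
  qed
  then obtain g where g: "\<And>S. g S \<in> Lp M p" "\<And>S. Lp_lim M p (?G S) (g S)" by metis
  have gm: "g S \<in> mdiff p q 0" if "q \<in> S" for S q
    by (rule mdiff_closed[OF p1 gpart_mdiff[OF p1 h that] g])
  have L1: "w \<in> Lp M p \<Longrightarrow> w \<in> Lp M 1" for w using Lp_imp_Lp_1[OF p1] .
  let ?op = "\<lambda>w x. \<Sum>S\<in>UNIV. \<Sum>B\<in>Pow (- S). (- 1) ^ card B * w S (T (ind B) x) :: real"
  have opL: "?op w \<in> Lp M p" if "\<And>S. w S \<in> Lp M p" for w
    by (intro Lp_sum[OF p1] Lp_cmult Lp_compose(1) that)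
  have "Lp_lim M p (\<lambda>N. ?op (\<lambda>S. ?G S N)) (?op g)"
  proof (intro Lp_lim_sum[OF p1] Lp_lim_cmult[OF p1] Lp_sum[OF p1] Lp_cmult Lp_compose(1) GL g(1))
    fix S and B :: "'d::{finite,linorder} set"
    have "Lp_norm M p (\<lambda>x. ?G S N (T (ind B) x) - g S (T (ind B) x)) = Lp_norm M p (\<lambda>x. ?G S N x - g S x)" for N
      by (rule Lp_compose(2)[OF Lp_diff[OF p1 GL g(1)]])
    then show "Lp_lim M p (\<lambda>N x. ?G S N (T (ind B) x)) (\<lambda>x. g S (T (ind B) x))"
      using g(2)[of S] by (simp add: Lp_lim_def)
  qed
  \<comment> \<open>The cube sums are known to tend to f in L^1, so the convergence in L^p is
    weakened to L^1 before the limits are compared.\<close>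
  from Lp_lim_imp_Lp_lim_1[OF p1 opL[OF GL] opL[OF g(1)] this]
  have lim_op: "Lp_lim M 1 (\<lambda>N. ?op (\<lambda>S. ?G S N)) (?op g)" .
  have lim_f: "Lp_lim M 1 (\<lambda>N. ?op (\<lambda>S. ?G S N)) f"
  proof (rule Lp_lim_AE_cong[OF _ _ _ _ _ _ sum_proj_cube_lim[OF p f reg]])
    show "AE x in M. (\<Sum>i\<in>cube N. proj M T F i f x) = ?op (\<lambda>S. ?G S N) x" for N
      using gpart_decomposition[of _ h N] by (intro AE_I2) (simp add: h_def)
    show "(\<lambda>x. \<Sum>i\<in>cube N. proj M T F i f x) \<in> borel_measurable M" for N
      using LpD(1)[OF mdiff_Lp[OF h]] by (intro borel_measurable_sum) (simp add: h_def)
  qed (use LpD(1)[OF opL[OF GL]] LpD(1)[OF f] in auto)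
  have "AE x in M. f x = ?op g x"
    by (rule Lp_lim_unique[OF _ L1[OF opL[OF GL]] L1[OF f] L1[OF opL[OF g(1)]] lim_f lim_op]) simp
  then have "AE x in M. f x = (\<Sum>S\<in>UNIV. op_prod (cobdry T) (- S) (g S) x)"
    using AE_space by eventually_elim (simp add: op_prod_cobdry)
  then show ?thesis using that g(1) gm by blast
qed

end

theorem theorem6:
  fixes M :: "'a measure"
    and T :: "int ^ 'd::{finite,linorder} \<Rightarrow> 'a \<Rightarrow> 'a"
    and F :: "'a measure"
    and p :: real
    and f :: "'a \<Rightarrow> real"
  assumes "prob_space M"
    and "measure_preserving_action M T"
    and "completely_commuting_filtration M T F"
    and "2 \<le> p"
    and "f \<in> Lp M p"
    and "regular M T F f"
    and "(\<lambda>i :: int ^ 'd::{finite,linorder}. (\<Prod>q\<in>UNIV. (real_of_int (bar (i $ q)))\<^sup>2) * (Lp_norm M p (proj M T F i f))\<^sup>2)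
           summable_on UNIV"
  shows "\<exists>g :: 'd::{finite,linorder} set \<Rightarrow> 'a \<Rightarrow> real.
           (\<forall>S. g S \<in> Lp M p \<and>
                g S \<in> (\<Inter>q\<in>S. Lp_ominus M p (filt_dir M T F q 0) (filt_dir M T F q (- 1)))) \<and>
           (AE x in M. f x = (\<Sum>S\<in>UNIV. op_prod (cobdry T) (- S) (g S) x))"
proof -
  interpret commuting_filtration M T F
    using assms(1-3) by (intro commuting_filtration.intro commuting_filtration_axioms.intro)
  obtain g where g: "\<And>S. g S \<in> Lp M p" "\<And>S q. q \<in> S \<Longrightarrow> g S \<in> mdiff p q 0"
    "AE x in M. f x = (\<Sum>S\<in>UNIV. op_prod (cobdry T) (- S) (g S) x)"
    using decomposition[OF assms(4-7)] by blast
  have "g S \<in> (\<Inter>q\<in>S. Lp_ominus M p (filt_dir M T F q 0) (filt_dir M T F q (- 1)))" for S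
    using mdiff_0_Lp_ominus[OF g(2)] by blast
  then show ?thesis using g(1,3) by blast
qed

end
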